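(* Let $\alpha\in(0,2)$ and let $X,X_1,X_2,\ldots$ be i.i.d. nonlattice random variables with distribution function $F$, and let $S_n=X_1+\dots+X_n$. Let $c,(k_n),\ell_1,A_n,C_n,\ell,\delta,M_R,M_L,\gamma_n,g_\lambda$ be as in the context, and assume that for all sufficiently large $x$ $$\mathbb P(X>x)=\frac{\ell(x)}{x^{\alpha}}[M_R(\delta(x))+h_R(x)],\qquad \mathbb P(X<-x)=\frac{\ell(x)}{x^{\alpha}}[M_L(\delta(x))+h_L(x)],$$ where $h_R,h_L$ are right-continuous functions such that $\lim_{n\to\infty}h_R(A_{k_n}x)=0$ for every continuity point $x>0$ of $M_R$ and $\lim_{n\to\infty}h_L(A_{k_n}x)=0$ for every continuity point $x>0$ of $M_L$. Then for every $h>0$ $$\lim_{n\to\infty}\ \sup_{x\in\mathbb R}\left|\frac{A_n}{2h}\,\mathbb P\big(S_n\in(x-h,x+h]\big)-g_{\gamma_n}\!\left(\frac{x-C_n}{A_n}\right)\right|=0 .$$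
   Context: A random variable is lattice if it is concentrated on $a+h\mathbb Z$ for some $a\in\mathbb R$, $h>0$, and nonlattice otherwise. Setting: $c>1$; $(k_n)_{n\ge1}$ is a strictly increasing sequence of positive integers with $k_{n+1}/k_n\to c$. $\ell_1:[1,\infty)\to(0,\infty)$ is slowly varying at infinity, $A(x)=A_x=x^{1/\alpha}\ell_1(x)$, and $C_n=n\int_{1/n}^{1-1/n}Q(s)\,\mathrm ds$, where $Q(s)=\inf\{x:F(x)\ge s\}$, $s\in(0,1)$. For large $x$ the slowly varying function $\ell$ is defined by $x^{-\alpha}\ell(x)=\sup\{t\in(0,1]: t^{-1/\alpha}\ell_1(1/t)>x\}$. For all large $x$ there is a unique $k_n$ with $A_{k_n}\le x<A_{k_{n+1}}$, and $\delta(x)=x/A_{k_n}$. Each of $M_R,M_L:(0,\infty)\to[0,\infty)$ is either identically $0$ or is positive, bounded, bounded away from $0$, right-continuous and satisfies $M(c^{1/\alpha}x)=M(x)$ for all $x>0$; $x\mapsto M_R(x)x^{-\alpha}$ and $x\mapsto M_L(x)x^{-\alpha}$ are nonincreasing; $M_R,M_L$ are not both identically zero, and at least one of them is not constant. Position parameter: $\gamma_n=n/k_m$ where $k_{m-1}<n\le k_m$ (with the convention $k_0=0$). For $\lambda>0$ let $\Lambda_\lambda$ be the Lévy measure with $\Lambda_\lambda((x,\infty))=x^{-\alpha}M_R(\lambda^{1/\alpha}x)$ and $\Lambda_\lambda((-\infty,-x))=x^{-\alpha}M_L(\lambda^{1/\alpha}x)$, $x>0$. $V_\lambda$ is the semistable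 random variable with characteristic function $$\psi_\lambda(t)=\exp\Big\{\mathrm i t a_\lambda+\int_{\mathbb R\setminus\{0\}}\big(e^{\mathrm itx}-1-\mathrm itx\,\mathbb I\{|x|\le1\}\big)\Lambda_\lambda(\mathrm dx)\Big\},$$ where the real constant $a_\lambda$ is the one for which $(S_{n_r}-C_{n_r})/A_{n_r}\to V_\lambda$ in distribution whenever $n_r\to\infty$ and $\gamma_{n_r}\to\lambda$, for $\lambda\in(c^{-1},1)$. Explicitly, for all $\lambda>0$, with $R_\lambda(s)=\inf\{x>0:\Lambda_\lambda((x,\infty))\le s\}$ and $L_\lambda(s)=\inf\{x>0:\Lambda_\lambda((-\infty,-x))\le s\}$, $s>0$, $$\log\psi_\lambda(t)=\int_0^\infty\big(e^{\mathrm itR_\lambda(s)}-1-\mathrm itR_\lambda(s)\mathbb I\{s>1\}\big)\mathrm ds+\int_0^\infty\big(e^{-\mathrm itL_\lambda(s)}-1+\mathrm itL_\lambda(s)\mathbb I\{s>1\}\big)\mathrm ds .$$ $G_\lambda$ is the distribution function of $V_\lambda$ and $g_\lambda$ its (smooth) density; $G_{c\lambda}=G_\lambda$. *)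

theory Defs
  imports "HOL-Probability.Probability"
begin

definition lattice_rv :: "'a measure \<Rightarrow> ('a \<Rightarrow> real) \<Rightarrow> bool" where
  "lattice_rv P X \<longleftrightarrow>
     (\<exists>a h. h > 0 \<and> (AE \<omega> in P. \<exists>j::int. X \<omega> = a + h * real_of_int j))"

(* Karamata's definition for a function on [1, \<infinity>); as usual, measurability is part of it.
   Values outside [1, \<infinity>) are irrelevant. *)
definition slowly_varying :: "(real \<Rightarrow> real) \<Rightarrow> bool" where
  "slowly_varying f \<longleftrightarrow>
     set_borel_measurable borel {1..} f \<and> (\<forall>x\<ge>1. f x > 0) \<and>
     (\<forall>t>0. ((\<lambda>x. f (t * x) / f x) \<longlongrightarrow> 1) at_top)"

definition norming :: "real \<Rightarrow> (real \<Rightarrow> real) \<Rightarrow> real \<Rightarrow> real" where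
  "norming \<alpha> l1 x = x powr (1 / \<alpha>) * l1 x"

definition quantile :: "(real \<Rightarrow> real) \<Rightarrow> real \<Rightarrow> real" where
  "quantile F s = Inf {x. F x \<ge> s}"

definition centering :: "(real \<Rightarrow> real) \<Rightarrow> nat \<Rightarrow> real" where
  "centering F n = real n * (LBINT s:{1 / real n..1 - 1 / real n}. quantile F s)"

(* The function l determined by
   x powr (-\<alpha>) * l x = sup {t \<in> (0, 1]. t powr (-1/\<alpha>) * l1 (1/t) > x} for large x. *)
definition tail_sv :: "real \<Rightarrow> (real \<Rightarrow> real) \<Rightarrow> real \<Rightarrow> real" where
  "tail_sv \<alpha> l1 x =
     x powr \<alpha> * Sup {t. 0 < t \<and> t \<le> 1 \<and> t powr (- (1 / \<alpha>)) * l1 (1 / t) > x}"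

(* In the next two definitions k 0 = 0 is the convention; the sequence proper is k 1, k 2, ...
   The index in rel_position is unique only for large x. *)
definition rel_position :: "(real \<Rightarrow> real) \<Rightarrow> (nat \<Rightarrow> nat) \<Rightarrow> real \<Rightarrow> real" where
  "rel_position A k x =
     x / A (real (k (THE n. n \<ge> 1 \<and> A (real (k n)) \<le> x \<and> x < A (real (k (n + 1))))))"

definition position_param :: "(nat \<Rightarrow> nat) \<Rightarrow> nat \<Rightarrow> real" where
  "position_param k n = real n / real (k (THE m. m \<ge> 1 \<and> k (m - 1) < n \<and> n \<le> k m))"

definition admissible_profile :: "real \<Rightarrow> real \<Rightarrow> (real \<Rightarrow> real) \<Rightarrow> bool" where
  "admissible_profile \<alpha> c M \<longleftrightarrow>
     ((\<forall>x>0. M x = 0) \<or>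
      (\<exists>a b. 0 < a \<and> (\<forall>x>0. a \<le> M x \<and> M x \<le> b)) \<and>
      (\<forall>x>0. continuous (at_right x) M) \<and>
      (\<forall>x>0. M (c powr (1 / \<alpha>) * x) = M x)) \<and>
     antimono_on {0<..} (\<lambda>x. M x * x powr (- \<alpha>))"

(* The value of the Levy measure \<Lambda>_u on (x, \<infinity>) when M = M\<^sub>R,
   and on (-\<infinity>, -x) when M = M\<^sub>L. *)
definition levy_tail :: "real \<Rightarrow> (real \<Rightarrow> real) \<Rightarrow> real \<Rightarrow> real \<Rightarrow> real" where
  "levy_tail \<alpha> M u x = x powr (- \<alpha>) * M (u powr (1 / \<alpha>) * x)"

(* R_u for M = M\<^sub>R and L_u for M = M\<^sub>L *)
definition levy_inverse :: "real \<Rightarrow> (real \<Rightarrow> real) \<Rightarrow> real \<Rightarrow> real \<Rightarrow> real" where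
  "levy_inverse \<alpha> M u s = Inf {x. x > 0 \<and> levy_tail \<alpha> M u x \<le> s}"

(* The centering by the indicator of s > 1 is what fixes the shift of the law:
   it matches the truncation at 1/n and 1 - 1/n in centering. *)
definition semistable_cf ::
    "real \<Rightarrow> (real \<Rightarrow> real) \<Rightarrow> (real \<Rightarrow> real) \<Rightarrow> real \<Rightarrow> real \<Rightarrow> complex" where
  "semistable_cf \<alpha> M\<^sub>R M\<^sub>L u t = exp (
     (LBINT s:{0<..}. iexp (t * levy_inverse \<alpha> M\<^sub>R u s) - 1
        - \<i> * complex_of_real (t * levy_inverse \<alpha> M\<^sub>R u s * indicator {1<..} s))
   + (LBINT s:{0<..}. iexp (- (t * levy_inverse \<alpha> M\<^sub>L u s)) - 1
        + \<i> * complex_of_real (t * levy_inverse \<alpha> M\<^sub>L u s * indicator {1<..} s)))"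

definition semistable_law ::
    "real \<Rightarrow> (real \<Rightarrow> real) \<Rightarrow> (real \<Rightarrow> real) \<Rightarrow> real \<Rightarrow> real measure" where
  "semistable_law \<alpha> M\<^sub>R M\<^sub>L u =
     (THE N. real_distribution N \<and> (\<forall>t. char N t = semistable_cf \<alpha> M\<^sub>R M\<^sub>L u t))"

(* Continuity selects the (in fact smooth) version of the density at every point. *)
definition semistable_density ::
    "real \<Rightarrow> (real \<Rightarrow> real) \<Rightarrow> (real \<Rightarrow> real) \<Rightarrow> real \<Rightarrow> real \<Rightarrow> real" where
  "semistable_density \<alpha> M\<^sub>R M\<^sub>L u =
     (THE g. continuous_on UNIV g \<and> (\<forall>x. g x \<ge> 0) \<and>
        semistable_law \<alpha> M\<^sub>R M\<^sub>L u = density lborel (\<lambda>x. ennreal (g x)))"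

end

theory Submission
  imports Defs "HOL-Real_Asymp.Real_Asymp"
begin

text \<open>
  With \<open>X = Q U\<close>, \<open>U\<close> uniform, and the substitutions \<open>U = s / n\<close> and \<open>U = 1 - s / n\<close>, the exponent of the compound Poisson
  approximation of the normalized sum becomes an integral over \<open>s > 0\<close> of an expression in the rescaled
  quantiles \<open>Q (1 - s / n) / A\<^sub>n\<close> and \<open>- Q (s / n) / A\<^sub>n\<close>, whose centering is exactly \<open>C\<^sub>n / A\<^sub>n\<close>. Along subsequences
  on which the position parameter converges to \<open>u\<close>, these quantiles converge almost everywhere to the inverses
  of the Levy tails of index \<open>u\<close>, and Potter's bounds dominate them by \<open>s powr - \<beta>\<close> with \<open>\<beta> > 1/2\<close>. Hence the
  characteristic functions merge with those of the semistable laws, locally uniformly. Uniformity on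
  \<open>1 \<le> \<bar>t\<bar> \<le> 2\<close> and a change of \<open>n\<close> give a stretched exponential bound for \<open>\<bar>t\<bar> \<le> \<eta> A\<^sub>n\<close>; beyond, the nonlattice
  condition makes the characteristic function geometrically small on every compact set. After smoothing
  with a Fejer kernel, whose Fourier transform has compact support, Fourier inversion and these bounds
  give uniform convergence of densities, and concentration of the kernel removes the smoothing.
\<close>

section \<open>The Fejer kernel\<close>

text \<open>There is no limit law along all n: the position parameter keeps moving in a compact part
  of (0, 1]. So the decay of the limits and the bounds and Lipschitz constants of their densities
  must be uniform in the parameter, and convergence is replaced by merging along arbitrary bounded
  sequences of frequencies. The error terms \<open>h\<^sub>R\<close> and \<open>h\<^sub>L\<close>
  are controlled along A (k n) * x for continuity points x, and A need be neither monotone nor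
  locally bounded; monotonicity of the tails and density of good points fill the gaps. The centred
  integrand is quadratic in the quantiles, so their majorant has to be square integrable at
  infinity: hence \<beta> > 1/2, possible because \<alpha> < 2. A nonlattice law need not satisfy
  Cramer's condition, so the characteristic function of the sum may fail to be integrable; this is
  why the frequencies are cut off before inversion. Existence of the semistable laws is proved, not
  presupposed: each candidate characteristic function is a limit along n close to u * k i, and
  inversion of that limit produces the density.\<close>

definition fejer :: "real \<Rightarrow> real" where
  "fejer y = (if y = 0 then 1 / (2 * pi) else (1 - cos y) / (pi * y\<^sup>2))"

text \<open>The Fourier counterpart of the Fejer kernel. Being continuous, compactly supported and 1
  at the origin, it serves as a cutoff in frequency and, with the roles exchanged, as a cutoff in
  space.\<close>

definition tent :: "real \<Rightarrow> real" where
  "tent t = max 0 (1 - \<bar>t\<bar>)"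

lemma tent_measurable [measurable]: "tent \<in> borel_measurable borel"
  unfolding tent_def[abs_def] by measurable

lemma tent_bounds: "0 \<le> tent t" "tent t \<le> 1" "\<bar>t\<bar> \<ge> 1 \<Longrightarrow> tent t = 0"
  by (auto simp: tent_def)

lemma tent_0: "tent 0 = 1"
  by (simp add: tent_def)

lemma continuous_tent: "isCont tent t"
  unfolding tent_def[abs_def] by (intro continuous_intros)

lemma fejer_nonneg: "0 \<le> fejer y"
  by (auto simp: fejer_def)

lemma fejer_minus [simp]: "fejer (- y) = fejer y"
  by (auto simp: fejer_def)

lemma fejer_measurable [measurable]: "fejer \<in> borel_measurable borel"
  unfolding fejer_def[abs_def] by measurable

text \<open>Split at 0, each half is a linear function times an exponential and has an explicit
  primitive. At \<open>t = 0\<close> both indicators are 1, whence the almost everywhere.\<close>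

lemma tent_decomp:
  "AE t in lborel. complex_of_real (tent t) * iexp (t * y) =
     indicator {0..1} t *\<^sub>R ((1 - of_real t) * iexp (t * y))
     + indicator {-1..0} t *\<^sub>R ((1 + of_real t) * iexp (t * y))"
  using AE_lborel_singleton[of 0]
proof eventually_elim
  case (elim t)
  then show ?case
    by (cases "t \<ge> 0") (auto simp: tent_def max_def indicator_def not_le not_less)
qed

lemma fejer_fourier:
  "has_bochner_integral lborel (\<lambda>t. complex_of_real (tent t) * iexp (t * y))
     (of_real (2 * pi * fejer y))"
proof (cases "y = 0")
  case True
  have D: "((\<lambda>t. complex_of_real (t\<^sup>2)) has_vector_derivative of_real (2 * t)) (at t within S)" for t S
    by (intro has_vector_derivative_of_real) (auto intro!: derivative_eq_intros)
  have 1: "has_bochner_integral lborel (\<lambda>t. indicator {0..1} t *\<^sub>R ((1 - complex_of_real t) * iexp (t * y)))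
      ((of_real 1 - of_real (1\<^sup>2) / 2) - (of_real 0 - of_real (0\<^sup>2) / 2))"
    using True
    by (intro has_bochner_integral_FTC_Icc[where F="\<lambda>t. of_real t - of_real (t\<^sup>2) / 2"])
       (auto intro!: derivative_eq_intros continuous_intros D simp del: of_real_power)
  have 2: "has_bochner_integral lborel (\<lambda>t. indicator {-1..0} t *\<^sub>R ((1 + complex_of_real t) * iexp (t * y)))
      ((of_real 0 + of_real (0\<^sup>2) / 2) - (of_real (-1) + of_real ((-1)\<^sup>2) / 2))"
    using True
    by (intro has_bochner_integral_FTC_Icc[where F="\<lambda>t. of_real t + of_real (t\<^sup>2) / 2"])
       (auto intro!: derivative_eq_intros continuous_intros D simp del: of_real_power)
  have "has_bochner_integral lborel (\<lambda>t. complex_of_real (tent t) * iexp (t * y))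
      (((of_real 1 - of_real (1\<^sup>2) / 2) - (of_real 0 - of_real (0\<^sup>2) / 2)) +
       ((of_real 0 + of_real (0\<^sup>2) / 2) - (of_real (-1) + of_real ((-1)\<^sup>2) / 2)))"
    by (rule has_bochner_integral_cong_AE[THEN iffD2, OF _ _ tent_decomp has_bochner_integral_add[OF 1 2]])
       measurable
  then show ?thesis using True by (simp add: fejer_def)
next
  case False
  \<comment> \<open>The primitives are (1 - t) * exp (t * a) / a + exp (t * a) / a^2 and its mirror
    image; dividing by \<open>a\<close> is the reason for treating \<open>y = 0\<close>
    separately.\<close>
  define a where "a = \<i> * complex_of_real y"
  have a: "a \<noteq> 0" using False by (simp add: a_def)
  have e: "iexp (t * y) = exp (of_real t * a)" for t by (simp add: a_def mult_ac)
  have D: "((\<lambda>t. exp (complex_of_real t * a)) has_vector_derivative (a * exp (of_real t * a))) (at t within S)" for t S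
  proof -
    have "((\<lambda>t. exp (t *\<^sub>R a)) has_vector_derivative (exp (t *\<^sub>R a) * a)) (at t within S)"
      by (rule exp_scaleR_has_vector_derivative_right)
    then show ?thesis by (simp add: scaleR_conv_of_real mult_ac)
  qed
  have I: "((\<lambda>t. complex_of_real t) has_vector_derivative 1) (at t within S)" for t S
    by (auto intro!: derivative_eq_intros)
  have 1: "has_bochner_integral lborel (\<lambda>t. indicator {0..1} t *\<^sub>R ((1 - complex_of_real t) * iexp (t * y)))
      (((1 - of_real 1) * exp (of_real 1 * a) / a + exp (of_real 1 * a) / a^2)
       - ((1 - of_real 0) * exp (of_real 0 * a) / a + exp (of_real 0 * a) / a^2))"
    unfolding e
  proof (intro has_bochner_integral_FTC_Icc)
    fix t :: real
    have "((\<lambda>t. ((1 - of_real t) * exp (of_real t * a)) / a + exp (of_real t * a) / a^2)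
       has_vector_derivative (((1 - of_real t) * (a * exp (of_real t * a)) + (0 - 1) * exp (of_real t * a)) / a
          + (a * exp (of_real t * a)) / a^2)) (at t within {0..1})"
      by (intro has_vector_derivative_add has_vector_derivative_divide has_vector_derivative_mult
           has_vector_derivative_diff D I has_vector_derivative_const)
    then show "((\<lambda>t. (1 - of_real t) * exp (of_real t * a) / a + exp (of_real t * a) / a^2)
       has_vector_derivative (1 - of_real t) * exp (of_real t * a)) (at t within {0..1})"
    proof (rule has_vector_derivative_eq_rhs)
      show "((1 - of_real t) * (a * exp (of_real t * a)) + (0 - 1) * exp (of_real t * a)) / a
          + (a * exp (of_real t * a)) / a^2 = (1 - of_real t) * exp (of_real t * a)"
        using a by (simp add: field_simps power2_eq_square)
    qed
  qed (auto intro!: continuous_intros)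
  have 2: "has_bochner_integral lborel (\<lambda>t. indicator {-1..0} t *\<^sub>R ((1 + complex_of_real t) * iexp (t * y)))
      (((1 + of_real 0) * exp (of_real 0 * a) / a - exp (of_real 0 * a) / a^2)
       - ((1 + of_real (-1)) * exp (of_real (-1) * a) / a - exp (of_real (-1) * a) / a^2))"
    unfolding e
  proof (intro has_bochner_integral_FTC_Icc)
    fix t :: real
    have "((\<lambda>t. ((1 + of_real t) * exp (of_real t * a)) / a - exp (of_real t * a) / a^2)
       has_vector_derivative (((1 + of_real t) * (a * exp (of_real t * a)) + (0 + 1) * exp (of_real t * a)) / a
          - (a * exp (of_real t * a)) / a^2)) (at t within {-1..0})"
      by (intro has_vector_derivative_add has_vector_derivative_divide has_vector_derivative_mult
           has_vector_derivative_diff D I has_vector_derivative_const)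
    then show "((\<lambda>t. (1 + of_real t) * exp (of_real t * a) / a - exp (of_real t * a) / a^2)
       has_vector_derivative (1 + of_real t) * exp (of_real t * a)) (at t within {-1..0})"
    proof (rule has_vector_derivative_eq_rhs)
      show "((1 + of_real t) * (a * exp (of_real t * a)) + (0 + 1) * exp (of_real t * a)) / a
          - (a * exp (of_real t * a)) / a^2 = (1 + of_real t) * exp (of_real t * a)"
        using a by (simp add: field_simps power2_eq_square)
    qed
  qed (auto intro!: continuous_intros)
  have *: "has_bochner_integral lborel (\<lambda>t. complex_of_real (tent t) * iexp (t * y))
      ((((1 - of_real 1) * exp (of_real 1 * a) / a + exp (of_real 1 * a) / a^2)
       - ((1 - of_real 0) * exp (of_real 0 * a) / a + exp (of_real 0 * a) / a^2)) +
       (((1 + of_real 0) * exp (of_real 0 * a) / a - exp (of_real 0 * a) / a^2)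
       - ((1 + of_real (-1)) * exp (of_real (-1) * a) / a - exp (of_real (-1) * a) / a^2)))"
    by (rule has_bochner_integral_cong_AE[THEN iffD2, OF _ _ tent_decomp has_bochner_integral_add[OF 1 2]])
       measurable
  \<comment> \<open>The boundary terms collapse to (exp a + exp (- a) - 2) / a^2, which is 2 * (1 -
    cos y) / y^2.\<close>
  have a2: "a^2 = - of_real (y^2)" by (simp add: a_def power_mult_distrib)
  have "exp a + exp (- a) = 2 * of_real (cos y)"
  proof -
    have "exp a = of_real (cos y) + \<i> * of_real (sin y)"
      by (simp only: a_def exp_Euler cos_of_real sin_of_real)
    moreover have "exp (- a) = of_real (cos (- y)) + \<i> * of_real (sin (- y))"
      by (simp only: a_def exp_Euler cos_of_real sin_of_real flip: mult_minus_right of_real_minus)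
    ultimately show ?thesis by simp
  qed
  then have "(exp a + exp (- a) - 2) / a^2 = of_real (2 * pi * fejer y)"
    using False unfolding a2 by (simp add: fejer_def field_simps)
  moreover have "((((1 - of_real 1) * exp (of_real 1 * a) / a + exp (of_real 1 * a) / a^2)
       - ((1 - of_real 0) * exp (of_real 0 * a) / a + exp (of_real 0 * a) / a^2)) +
       (((1 + of_real 0) * exp (of_real 0 * a) / a - exp (of_real 0 * a) / a^2)
       - ((1 + of_real (-1)) * exp (of_real (-1) * a) / a - exp (of_real (-1) * a) / a^2)))
       = (exp a + exp (- a) - 2) / a^2"
    by (simp add: diff_divide_distrib add_divide_distrib)
  ultimately show ?thesis using * by simp
qed

text \<open>Integration by parts turns (1 - cos y) / y^2 into sin y / y, so the sine integral
  supplies a primitive and its limit pi / 2 supplies the mass of the half line.\<close>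

lemma fejer_primitive_at_top: "((\<lambda>y. (Si y - (1 - cos y) / y) / pi) \<longlongrightarrow> 1 / 2) at_top"
proof -
  have "((\<lambda>y::real. (1 - cos y) / y) \<longlongrightarrow> 0) at_top"
  proof (rule Lim_null_comparison)
    show "\<forall>\<^sub>F y in at_top. norm ((1 - cos y) / y) \<le> 2 / y"
      using eventually_gt_at_top[of "0::real"]
    proof eventually_elim
      case (elim y)
      have "1 - cos y \<le> 2" using cos_ge_minus_one[of y] by linarith
      then show ?case using elim by (simp add: divide_right_mono)
    qed
    show "((\<lambda>y::real. 2 / y) \<longlongrightarrow> 0) at_top" by real_asymp
  qed
  then have "((\<lambda>y. (Si y - (1 - cos y) / y) / pi) \<longlongrightarrow> (pi / 2 - 0) / pi) at_top"
    by (intro tendsto_intros Si_at_top) auto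
  then show ?thesis by simp
qed

lemma fejer_half:
  "set_integrable lborel {0<..} fejer" "(LBINT y:{0<..}. fejer y) = 1 / 2"
proof -
  let ?F = "\<lambda>y. (Si y - (1 - cos y) / y) / pi"
  have D: "DERIV ?F x :> fejer x" if "x > 0" for x
    using that by (auto intro!: derivative_eq_intros DERIV_Si simp: fejer_def field_simps power2_eq_square)
  have C: "isCont fejer x" if "x > 0" for x
  proof -
    have "isCont (\<lambda>y. (1 - cos y) / (pi * y\<^sup>2)) x"
      using that by (auto intro!: continuous_intros)
    moreover have "\<forall>\<^sub>F y in nhds x. fejer y = (1 - cos y) / (pi * y\<^sup>2)"
      using eventually_nhds_in_open[of "{0<..}" x] that
      by (auto simp: fejer_def elim!: eventually_mono)
    ultimately show ?thesis by (simp add: isCont_cong)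
  qed
  have "((\<lambda>y::real. (1 - cos y) / y) \<longlongrightarrow> 0) (at_right 0)" by real_asymp
  moreover have "(Si \<longlongrightarrow> Si 0) (at_right 0)"
    using isCont_Si[of 0] by (simp add: isCont_def filterlim_at_split)
  ultimately have "(?F \<longlongrightarrow> (Si 0 - 0) / pi) (at_right 0)"
    by (intro tendsto_intros) auto
  then have A: "(?F \<longlongrightarrow> 0) (at_right 0)"
    using Si_neg[of 0] by simp
  have *: "set_integrable lborel (einterval 0 \<infinity>) fejer" "(LBINT y=0..\<infinity>. fejer y) = 1 / 2 - 0"
    by (rule interval_integral_FTC_nonneg[where F="?F"];
        use D C A fejer_primitive_at_top fejer_nonneg in \<open>auto simp: ereal_tendsto_simps zero_ereal_def\<close>)+
  show "set_integrable lborel {0<..} fejer" "(LBINT y:{0<..}. fejer y) = 1 / 2"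
    using * by (simp_all add: interval_lebesgue_integral_def zero_ereal_def)
qed

lemma fejer_integral: "has_bochner_integral lborel fejer 1"
proof -
  have 1: "has_bochner_integral lborel (\<lambda>y. indicator {0<..} y *\<^sub>R fejer y) (1/2)"
    using fejer_half by (auto simp: has_bochner_integral_iff set_integrable_def set_lebesgue_integral_def)
  then have 2: "has_bochner_integral lborel (\<lambda>y. indicator {0<..} (0 + (-1) * y) *\<^sub>R fejer (0 + (-1) * y)) ((1/2) /\<^sub>R \<bar>-1\<bar>)"
    by (intro lborel_has_bochner_integral_real_affine_iff[THEN iffD1]) auto
  have "has_bochner_integral lborel (\<lambda>y. indicator {0<..} y *\<^sub>R fejer y + indicator {0<..} (0 + (-1) * y) *\<^sub>R fejer (0 + (-1) * y)) (1/2 + (1/2) /\<^sub>R \<bar>-1\<bar>)"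
    by (intro has_bochner_integral_add 1 2)
  then show ?thesis
    using AE_lborel_singleton[of "0::real"]
    by (subst has_bochner_integral_cong_AE[where g="\<lambda>y. indicator {0<..} y *\<^sub>R fejer y + indicator {0<..} (0 + (-1) * y) *\<^sub>R fejer (0 + (-1) * y)"])
       (auto elim!: eventually_mono simp: indicator_def)
qed

section \<open>Densities from limits of characteristic functions\<close>

lemma fejer_scaled_fourier:
  assumes "\<epsilon> > 0"
  shows "has_bochner_integral lborel (\<lambda>t. complex_of_real (tent (\<epsilon> * t)) * iexp (t * y))
     (of_real (2 * pi * (fejer (y / \<epsilon>) / \<epsilon>)))"
proof -
  have "has_bochner_integral lborel (\<lambda>t. complex_of_real (tent (0 + \<epsilon> * t)) * iexp ((0 + \<epsilon> * t) * (y / \<epsilon>)))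
     (of_real (2 * pi * fejer (y / \<epsilon>)) /\<^sub>R \<bar>\<epsilon>\<bar>)"
    using assms fejer_fourier[of "y / \<epsilon>"]
    by (intro lborel_has_bochner_integral_real_affine_iff[THEN iffD1]) auto
  then show ?thesis
    using assms by (simp add: scaleR_conv_of_real divide_inverse mult_ac)
qed

lemma tent_scaled_integrable: "\<epsilon> > 0 \<Longrightarrow> integrable lborel (\<lambda>t. tent (\<epsilon> * t))"
  using has_bochner_integral_integrable fejer_scaled_fourier[of \<epsilon> 0]
  by (simp add: has_bochner_integral_iff complex_of_real_integrable_eq)

lemma fejer_scaled_integral:
  assumes "\<epsilon> > 0"
  shows "has_bochner_integral lborel (\<lambda>y. fejer ((y - c) / \<epsilon>) / \<epsilon>) 1"
proof -
  have "has_bochner_integral lborel (\<lambda>y. fejer (- c / \<epsilon> + (1 / \<epsilon>) * y)) (1 /\<^sub>R \<bar>1 / \<epsilon>\<bar>)"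
    using assms fejer_integral
    by (intro lborel_has_bochner_integral_real_affine_iff[THEN iffD1]) auto
  from has_bochner_integral_divide_zero[OF this, of \<epsilon>] show ?thesis
    using assms by (simp add: diff_divide_distrib)
qed

text \<open>Scaling carries [-e, e] to [-e / \<epsilon>, e / \<epsilon>], which exhausts the line
  along \<epsilon> = 1 / (n + 1).\<close>

lemma fejer_concentrates:
  assumes "e > 0" "\<tau> > 0"
  shows "\<exists>\<epsilon>>0. (LBINT y. indicator {-e..e} y * (fejer (y / \<epsilon>) / \<epsilon>)) \<ge> 1 - \<tau>"
proof -
  have "(\<lambda>n. LBINT v. indicator {- (e * real (Suc n))..e * real (Suc n)} v * fejer v) \<longlonglongrightarrow> (LBINT v. fejer v)"
  proof (rule integral_dominated_convergence[where w=fejer])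
    show "integrable lborel fejer" using fejer_integral by (auto simp: has_bochner_integral_iff)
    show "AE v in lborel. (\<lambda>n. indicator {- (e * real (Suc n))..e * real (Suc n)} v * fejer v) \<longlonglongrightarrow> fejer v"
    proof (rule AE_I2)
      fix v :: real
      obtain N :: nat where N: "\<bar>v\<bar> / e < real N" using reals_Archimedean2 by blast
      have "\<forall>\<^sub>F n in sequentially. indicator {- (e * real (Suc n))..e * real (Suc n)} v * fejer v = fejer v"
        using eventually_ge_at_top[of N]
      proof eventually_elim
        case (elim n)
        have "\<bar>v\<bar> < real N * e" using N assms by (simp add: field_simps)
        also have "\<dots> \<le> e * real (Suc n)" using elim assms by simp
        finally show ?case by (auto simp: indicator_def)
      qed
      then show "(\<lambda>n. indicator {- (e * real (Suc n))..e * real (Suc n)} v * fejer v) \<longlonglongrightarrow> fejer v"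
        by (rule tendsto_eventually)
    qed
  qed (auto simp: indicator_def fejer_nonneg)
  moreover have "(LBINT v. fejer v) = 1" using fejer_integral by (auto simp: has_bochner_integral_iff)
  ultimately have "\<forall>\<^sub>F n in sequentially. (LBINT v. indicator {- (e * real (Suc n))..e * real (Suc n)} v * fejer v) > 1 - \<tau>"
    using assms by (intro order_tendstoD) auto
  then obtain n where n: "(LBINT v. indicator {- (e * real (Suc n))..e * real (Suc n)} v * fejer v) > 1 - \<tau>"
    by (auto simp: eventually_sequentially)
  define s where "s = real (Suc n)"
  have s: "s > 0" by (simp add: s_def)
  have "(LBINT v. indicator {- (e * s)..e * s} v * fejer v)
      = \<bar>s\<bar> *\<^sub>R (LBINT v. indicator {- (e * s)..e * s} (0 + s * v) * fejer (0 + s * v))"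
    by (rule lborel_integral_real_affine) (use s in auto)
  also have "\<dots> = (LBINT y. indicator {-e..e} y * (fejer (y / (1 / s)) / (1 / s)))"
  proof -
    have "s * (indicator {- (e * s)..e * s} (0 + s * v) * fejer (0 + s * v)) =
        indicator {-e..e} v * (fejer (v / (1 / s)) / (1 / s))" for v
    proof -
      have "- (e * s) \<le> s * v \<longleftrightarrow> - e \<le> v" "s * v \<le> e * s \<longleftrightarrow> v \<le> e"
        using s mult_le_cancel_left_pos[of s "-e" v] by (simp_all add: mult.commute)
      then show ?thesis by (simp add: indicator_def mult.commute)
    qed
    then have "(LBINT v. s * (indicator {- (e * s)..e * s} (0 + s * v) * fejer (0 + s * v))) =
        (LBINT v. indicator {-e..e} v * (fejer (v / (1 / s)) / (1 / s)))" by (simp only:)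
    then show ?thesis using s by (simp only: integral_mult_right_zero abs_of_pos real_scaleR_def)
  qed
  finally show ?thesis
    using n s by (intro exI[of _ "1/s"]) (auto simp: s_def)
qed

text \<open>Fubini, with the kernel written as the Fourier integral of the tent. The compact support
  of the tent makes the double integral converge absolutely although \<open>char M\<close> need not
  be integrable.\<close>

lemma (in real_distribution) fejer_smoothing:
  assumes "\<epsilon> > 0"
  shows "complex_of_real (LINT s|M. fejer ((x - s) / \<epsilon>) / \<epsilon>) =
     (CLBINT t. iexp (- (t * x)) * char M t * of_real (tent (\<epsilon> * t))) / of_real (2 * pi)"
proof -
  interpret P: pair_sigma_finite lborel M ..
  let ?f = "\<lambda>t s. complex_of_real (tent (\<epsilon> * t)) * iexp (t * (s - x))"
  have "complex_of_real (LINT s|M. fejer ((x - s) / \<epsilon>) / \<epsilon>) =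
      (CLINT s|M. (CLBINT t. ?f t s) / of_real (2 * pi))"
  proof (subst integral_complex_of_real[symmetric], intro Bochner_Integration.integral_cong refl)
    fix s
    have "fejer ((x - s) / \<epsilon>) = fejer ((s - x) / \<epsilon>)"
      using fejer_minus[of "(s - x) / \<epsilon>"] by (simp add: minus_divide_left)
    then show "complex_of_real (fejer ((x - s) / \<epsilon>) / \<epsilon>) = (CLBINT t. ?f t s) / of_real (2 * pi)"
      using has_bochner_integral_integral_eq[OF fejer_scaled_fourier[OF assms, of "s - x"]]
      by (simp add: field_simps)
  qed
  also have "\<dots> = (CLINT s|M. (CLBINT t. ?f t s)) / of_real (2 * pi)"
    by simp
  also have "(CLINT s|M. (CLBINT t. ?f t s)) = (CLBINT t. (CLINT s|M. ?f t s))"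
  proof (rule P.Fubini_integral)
    show "integrable (lborel \<Otimes>\<^sub>M M) (\<lambda>(t, s). ?f t s)"
    \<comment> \<open>The integrand is bounded by 1 and lives on a strip of finite product
      measure.\<close>
    proof (rule integrableI_bounded_set[where A="{-1/\<epsilon>..1/\<epsilon>} \<times> UNIV" and B=1])
      show "{-1/\<epsilon>..1/\<epsilon>} \<times> UNIV \<in> sets (lborel \<Otimes>\<^sub>M M)" by simp
      show "emeasure (lborel \<Otimes>\<^sub>M M) ({-1/\<epsilon>..1/\<epsilon>} \<times> UNIV) < \<infinity>"
        by (subst emeasure_pair_measure_Times) (auto simp: ennreal_mult_less_top emeasure_lborel_Icc_eq less_top[symmetric] emeasure_eq_measure ennreal_mult_eq_top_iff)
      show "AE p in lborel \<Otimes>\<^sub>M M. p \<in> {-1/\<epsilon>..1/\<epsilon>} \<times> UNIV \<longrightarrow> norm (case p of (t, s) \<Rightarrow> ?f t s) \<le> 1"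
        using tent_bounds by (auto simp: norm_mult)
      show "AE p in lborel \<Otimes>\<^sub>M M. p \<notin> {-1/\<epsilon>..1/\<epsilon>} \<times> UNIV \<longrightarrow> (case p of (t, s) \<Rightarrow> ?f t s) = 0"
      proof (intro AE_I2 impI)
        fix p :: "real \<times> real" assume "p \<notin> {-1/\<epsilon>..1/\<epsilon>} \<times> UNIV"
        then have "\<bar>fst p\<bar> \<ge> 1 / \<epsilon>" by (cases p) auto
        then have "\<bar>\<epsilon> * fst p\<bar> \<ge> 1" using assms by (simp add: abs_mult field_simps)
        then show "(case p of (t, s) \<Rightarrow> ?f t s) = 0" using tent_bounds(3) by (simp add: split_beta)
      qed
    qed measurable
  qed
  also have "\<dots> = (CLBINT t. iexp (- (t * x)) * char M t * of_real (tent (\<epsilon> * t)))"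
  proof (intro Bochner_Integration.integral_cong refl)
    fix t
    have "(CLINT s|M. ?f t s) = (CLINT s|M. (of_real (tent (\<epsilon> * t)) * iexp (- (t * x))) * iexp (t * s))"
      by (intro Bochner_Integration.integral_cong) (auto simp: exp_add[symmetric] algebra_simps)
    also have "\<dots> = (of_real (tent (\<epsilon> * t)) * iexp (- (t * x))) * char M t"
      unfolding char_def by simp
    finally show "(CLINT s|M. ?f t s) = iexp (- (t * x)) * char M t * of_real (tent (\<epsilon> * t))"
      by (simp add: mult_ac)
  qed
  finally show ?thesis .
qed

section \<open>Fourier inversion for a continuous integrable limit of characteristic
  functions\<close>

definition inverse_fourier :: "(real \<Rightarrow> complex) \<Rightarrow> real \<Rightarrow> real" where
  "inverse_fourier \<psi> x = Re (CLBINT t. iexp (- (t * x)) * \<psi> t) / (2 * pi)"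

context
  fixes \<mu> :: "nat \<Rightarrow> real measure" and \<psi> :: "real \<Rightarrow> complex"
  assumes \<mu>: "\<And>n. real_distribution (\<mu> n)"
    and lim: "\<And>t. (\<lambda>n. char (\<mu> n) t) \<longlonglongrightarrow> \<psi> t"
    and int: "integrable lborel \<psi>"
    and cont: "\<And>t. isCont \<psi> t"
begin

lemma limit_measurable: "\<psi> \<in> borel_measurable borel"
  using cont by (intro borel_measurable_continuous_onI continuous_at_imp_continuous_on) auto

lemma limit_norm: "norm (\<psi> t) \<le> 1"
  by (rule LIMSEQ_le_const2[OF tendsto_norm[OF lim]])
     (use real_distribution.cmod_char_le_1[OF \<mu>] in auto)

lemma limit_at_0: "\<psi> 0 = 1"
  using LIMSEQ_unique[OF lim[of 0]] real_distribution.char_zero[OF \<mu>] by simp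

lemma iexp_limit_integrable: "integrable lborel (\<lambda>t. iexp (- (t * x)) * \<psi> t)"
  using limit_measurable
  by (intro Bochner_Integration.integrable_bound[OF int]) (auto simp: norm_mult)

text \<open>Smoothed densities of the approximating laws are nonnegative reals, and these form a
  closed set that two limits cannot leave: first in \<open>n\<close>, dominated by the tent, then in
  the smoothing parameter, dominated by the norm of \<open>\<psi>\<close>. So the real part taken in
  \<open>inverse_fourier\<close> discards nothing.\<close>

lemma inverse_fourier_limit:
  shows inverse_fourier_nonneg: "inverse_fourier \<psi> x \<ge> 0"
    and of_real_inverse_fourier:
      "complex_of_real (inverse_fourier \<psi> x) = (CLBINT t. iexp (- (t * x)) * \<psi> t) / of_real (2 * pi)"
proof -
  note [measurable] = limit_measurable
  interpret real_distribution "\<mu> n" for n by (rule \<mu>)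
  define R where "R = {z::complex. Re z \<ge> 0 \<and> Im z = 0}"
  have "R = {z. Re z \<ge> 0} \<inter> {z. Im z = 0}" by (auto simp: R_def)
  then have closedR: "closed R" by (simp add: closed_Int closed_halfspace_Re_ge closed_hyperplane)
     (metis closed_Int closed_halfspace_Re_ge closed_halfspace_Im_eq)
  have 1: "(CLBINT t. iexp (- (t * x)) * \<psi> t * of_real (tent (\<epsilon> * t))) / of_real (2 * pi) \<in> R"
    if eps: "\<epsilon> > 0" for \<epsilon>
  proof (rule closed_sequentially[OF closedR])
    show "(CLBINT t. iexp (- (t * x)) * char (\<mu> n) t * of_real (tent (\<epsilon> * t))) / of_real (2 * pi) \<in> R" for n
      unfolding fejer_smoothing[OF eps, symmetric]
      using eps by (auto simp: R_def fejer_nonneg intro!: integral_nonneg_AE)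
    show "(\<lambda>n. (CLBINT t. iexp (- (t * x)) * char (\<mu> n) t * of_real (tent (\<epsilon> * t))) / of_real (2 * pi))
       \<longlonglongrightarrow> (CLBINT t. iexp (- (t * x)) * \<psi> t * of_real (tent (\<epsilon> * t))) / of_real (2 * pi)"
    proof (intro tendsto_divide tendsto_const integral_dominated_convergence[where w="\<lambda>t. tent (\<epsilon> * t)"] AE_I2)
      fix t n
      show "norm (iexp (- (t * x)) * char (\<mu> n) t * of_real (tent (\<epsilon> * t))) \<le> tent (\<epsilon> * t)"
        using cmod_char_le_1[of n t] tent_bounds(1) by (simp add: norm_mult mult_left_le_one_le)
    qed (use tent_scaled_integrable[OF eps] in \<open>auto intro!: tendsto_intros lim\<close>)
  qed
  have 2: "(CLBINT t. iexp (- (t * x)) * \<psi> t) / of_real (2 * pi) \<in> R"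
  proof (rule closed_sequentially[OF closedR])
    show "(CLBINT t. iexp (- (t * x)) * \<psi> t * of_real (tent (inverse (real (Suc n)) * t))) / of_real (2 * pi) \<in> R" for n
      by (rule 1) simp
    show "(\<lambda>n. (CLBINT t. iexp (- (t * x)) * \<psi> t * of_real (tent (inverse (real (Suc n)) * t))) / of_real (2 * pi))
        \<longlonglongrightarrow> (CLBINT t. iexp (- (t * x)) * \<psi> t) / of_real (2 * pi)"
    proof (intro tendsto_divide tendsto_const integral_dominated_convergence[where w="\<lambda>t. norm (\<psi> t)"] AE_I2)
      fix t
      have "(\<lambda>n. inverse (real (Suc n)) * t) \<longlonglongrightarrow> 0 * t"
        by (intro tendsto_mult LIMSEQ_inverse_real_of_nat tendsto_const)
      then have "(\<lambda>n. tent (inverse (real (Suc n)) * t)) \<longlonglongrightarrow> tent 0"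
        by (intro isCont_tendsto_compose[OF continuous_tent]) simp
      then have "(\<lambda>n. iexp (- (t * x)) * \<psi> t * of_real (tent (inverse (real (Suc n)) * t)))
          \<longlonglongrightarrow> iexp (- (t * x)) * \<psi> t * of_real (tent 0)"
        by (intro tendsto_intros)
      then show "(\<lambda>n. iexp (- (t * x)) * \<psi> t * of_real (tent (inverse (real (Suc n)) * t)))
          \<longlonglongrightarrow> iexp (- (t * x)) * \<psi> t" by (simp add: tent_0)
      fix n
      show "norm (iexp (- (t * x)) * \<psi> t * of_real (tent (inverse (real (Suc n)) * t))) \<le> norm (\<psi> t)"
        using tent_bounds(1,2)[of "inverse (real (Suc n)) * t"]
        by (simp add: norm_mult mult_right_le_one_le)
    qed (use int in auto)
  qed
  show "inverse_fourier \<psi> x \<ge> 0" using 2 by (auto simp: R_def inverse_fourier_def)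
  show "complex_of_real (inverse_fourier \<psi> x) = (CLBINT t. iexp (- (t * x)) * \<psi> t) / of_real (2 * pi)"
    using 2 by (auto simp: R_def inverse_fourier_def complex_eq_iff)
qed

lemma inverse_fourier_continuous: "continuous_on UNIV (inverse_fourier \<psi>)"
proof -
  note [measurable] = limit_measurable
  have "isCont (inverse_fourier \<psi>) x" for x
    unfolding continuous_at_sequentially
  proof safe
    fix X assume X: "X \<longlonglongrightarrow> x"
    show "(inverse_fourier \<psi> \<circ> X) \<longlonglongrightarrow> inverse_fourier \<psi> x"
      unfolding comp_def inverse_fourier_def
      by (intro tendsto_divide tendsto_const tendsto_Re integral_dominated_convergence[where w="\<lambda>t. norm (\<psi> t)"] AE_I2)
         (use int X in \<open>auto simp: norm_mult intro!: tendsto_intros\<close>)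
  qed
  then show ?thesis by (intro continuous_at_imp_continuous_on) auto
qed

lemma inverse_fourier_le: "inverse_fourier \<psi> x \<le> (LBINT t. norm (\<psi> t)) / (2 * pi)"
proof -
  have "Re (CLBINT t. iexp (- (t * x)) * \<psi> t) \<le> norm (CLBINT t. iexp (- (t * x)) * \<psi> t)"
    by (rule complex_Re_le_cmod)
  also have "\<dots> \<le> (LBINT t. norm (iexp (- (t * x)) * \<psi> t))" by (rule integral_norm_bound)
  also have "\<dots> = (LBINT t. norm (\<psi> t))" by (simp add: norm_mult)
  finally show ?thesis by (simp add: inverse_fourier_def divide_right_mono)
qed

lemma inverse_fourier_measurable: "inverse_fourier \<psi> \<in> borel_measurable borel"
  using inverse_fourier_continuous by (rule borel_measurable_continuous_onI)

text \<open>The Fubini computation with the roles exchanged: now the tent truncates in space, and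
  the transform becomes a Fejer mean of \<open>\<psi>\<close>. This makes sense before integrability
  of the inverse is known.\<close>

lemma tent_inverse_fourier_integral:
  assumes eps: "\<epsilon> > 0"
  shows "(CLBINT x. of_real (inverse_fourier \<psi> x * tent (\<epsilon> * x)) * iexp (t * x)) =
     (CLBINT v. \<psi> (t + \<epsilon> * v) * of_real (fejer v))"
proof -
  note [measurable] = limit_measurable inverse_fourier_measurable
  let ?f = "\<lambda>x u. (iexp (- (u * x)) * \<psi> u) * of_real (tent (\<epsilon> * x)) * iexp (t * x)"
  have nf: "norm (?f x u) = tent (\<epsilon> * x) * norm (\<psi> u)" for x u
    using tent_bounds(1) by (simp add: norm_mult)
  have I: "integrable (lborel \<Otimes>\<^sub>M lborel) (\<lambda>(x, u). ?f x u)"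
  proof (rule lborel_pair.Fubini_integrable)
    show "integrable lborel (\<lambda>x. LBINT u. norm (case (x, u) of (x, u) \<Rightarrow> ?f x u))"
      unfolding prod.case nf using tent_scaled_integrable[OF eps] by simp
    show "AE x in lborel. integrable lborel (\<lambda>u. case (x, u) of (x, u) \<Rightarrow> ?f x u)"
      unfolding prod.case by (intro AE_I2 integrable_mult_left iexp_limit_integrable)
  qed measurable
  have "(CLBINT x. of_real (inverse_fourier \<psi> x * tent (\<epsilon> * x)) * iexp (t * x)) =
      (CLBINT x. CLBINT u. ?f x u / of_real (2 * pi))"
    by (intro Bochner_Integration.integral_cong) (simp_all add: of_real_inverse_fourier)
  also have "\<dots> = (CLBINT x. CLBINT u. ?f x u) / of_real (2 * pi)" by simp
  also have "(CLBINT x. CLBINT u. ?f x u) = (CLBINT u. CLBINT x. ?f x u)"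
    using lborel_pair.Fubini_integral[OF I] by simp
  also have "(CLBINT u. CLBINT x. ?f x u) / of_real (2 * pi) =
      (CLBINT u. \<psi> u * of_real (fejer ((t - u) / \<epsilon>) / \<epsilon>))"
  proof -
    have "(CLBINT x. ?f x u) = of_real (2 * pi) * (\<psi> u * of_real (fejer ((t - u) / \<epsilon>) / \<epsilon>))" for u
    proof -
      have "(CLBINT x. ?f x u) = (CLBINT x. \<psi> u * (complex_of_real (tent (\<epsilon> * x)) * iexp (x * (t - u))))"
        by (intro Bochner_Integration.integral_cong refl) (simp add: exp_add[symmetric] algebra_simps exp_diff exp_minus field_simps)
      also have "\<dots> = \<psi> u * of_real (2 * pi * (fejer ((t - u) / \<epsilon>) / \<epsilon>))"
        using has_bochner_integral_integral_eq[OF fejer_scaled_fourier[OF eps, of "t - u"]] by simp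
      finally show ?thesis by simp
    qed
    then show ?thesis by simp
  qed
  also have "\<dots> = \<bar>\<epsilon>\<bar> *\<^sub>R (CLBINT v. \<psi> (t + \<epsilon> * v) * of_real (fejer ((t - (t + \<epsilon> * v)) / \<epsilon>) / \<epsilon>))"
    by (rule lborel_integral_real_affine) (use eps in auto)
  also have "\<dots> = (CLBINT v. \<epsilon> *\<^sub>R (\<psi> (t + \<epsilon> * v) * of_real (fejer ((t - (t + \<epsilon> * v)) / \<epsilon>) / \<epsilon>)))"
    using eps by simp
  also have "\<dots> = (CLBINT v. \<psi> (t + \<epsilon> * v) * of_real (fejer v))"
    using eps by (intro Bochner_Integration.integral_cong refl) (simp add: scaleR_conv_of_real)
  finally show ?thesis .
qed

lemma tent_inverse_fourier_tendsto:
  "(\<lambda>n. CLBINT x. of_real (inverse_fourier \<psi> x * tent (inverse (real (Suc n)) * x)) * iexp (t * x)) \<longlonglongrightarrow> \<psi> t"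
proof -
  note [measurable] = limit_measurable
  have I: "integrable lborel fejer" using fejer_integral by (auto simp: has_bochner_integral_iff)
  have "(\<lambda>n. CLBINT v. \<psi> (t + inverse (real (Suc n)) * v) * of_real (fejer v)) \<longlonglongrightarrow> (CLBINT v. \<psi> t * of_real (fejer v))"
  proof (intro integral_dominated_convergence[where w=fejer] AE_I2 I)
    fix v
    have "(\<lambda>n. t + inverse (real (Suc n)) * v) \<longlonglongrightarrow> t + 0 * v"
      by (intro tendsto_intros LIMSEQ_inverse_real_of_nat)
    then have "(\<lambda>n. \<psi> (t + inverse (real (Suc n)) * v)) \<longlonglongrightarrow> \<psi> t"
      by (intro isCont_tendsto_compose[OF cont]) simp
    then show "(\<lambda>n. \<psi> (t + inverse (real (Suc n)) * v) * of_real (fejer v)) \<longlonglongrightarrow> \<psi> t * of_real (fejer v)"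
      by (intro tendsto_intros)
    fix n show "norm (\<psi> (t + inverse (real (Suc n)) * v) * of_real (fejer v)) \<le> fejer v"
      using limit_norm fejer_nonneg by (simp add: norm_mult mult_left_le_one_le)
  qed auto
  moreover have "(CLBINT v. complex_of_real (fejer v)) = 1"
    using fejer_integral by (simp add: has_bochner_integral_iff)
  ultimately show ?thesis by (subst tent_inverse_fourier_integral) simp_all
qed

text \<open>The mass is found at frequency 0: the truncated integrals increase to
  \<open>\<psi> 0 = 1\<close>, so monotone convergence yields integrability. After that, dominated
  convergence identifies the transform at every frequency.\<close>

lemma inverse_fourier_density:
  shows real_distribution_inverse_fourier: "real_distribution (density lborel (\<lambda>x. ennreal (inverse_fourier \<psi> x)))"
    and char_inverse_fourier: "char (density lborel (\<lambda>x. ennreal (inverse_fourier \<psi> x))) t = \<psi> t"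
proof -
  note [measurable] = limit_measurable inverse_fourier_measurable
  have conv: "(\<lambda>n. inverse_fourier \<psi> x * tent (inverse (real (Suc n)) * x)) \<longlonglongrightarrow> inverse_fourier \<psi> x" for x
  proof -
    have "(\<lambda>n. inverse (real (Suc n)) * x) \<longlonglongrightarrow> 0 * x"
      by (intro tendsto_mult LIMSEQ_inverse_real_of_nat tendsto_const)
    then have "(\<lambda>n. tent (inverse (real (Suc n)) * x)) \<longlonglongrightarrow> tent 0"
      by (intro isCont_tendsto_compose[OF continuous_tent]) simp
    then have "(\<lambda>n. inverse_fourier \<psi> x * tent (inverse (real (Suc n)) * x)) \<longlonglongrightarrow> inverse_fourier \<psi> x * tent 0"
      by (intro tendsto_intros)
    then show ?thesis by (simp add: tent_0)
  qed
  have I: "integrable lborel (\<lambda>x. inverse_fourier \<psi> x * tent (inverse (real (Suc n)) * x))" for n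
  proof (rule Bochner_Integration.integrable_bound)
    show "integrable lborel (\<lambda>x. (LBINT t. norm (\<psi> t)) / (2 * pi) * tent (inverse (real (Suc n)) * x))"
      by (intro integrable_mult_right tent_scaled_integrable) simp
    show "AE x in lborel. norm (inverse_fourier \<psi> x * tent (inverse (real (Suc n)) * x))
        \<le> norm ((LBINT t. norm (\<psi> t)) / (2 * pi) * tent (inverse (real (Suc n)) * x))"
    proof (rule AE_I2)
      fix x
      have "inverse_fourier \<psi> x * tent (inverse (real (Suc n)) * x)
          \<le> (LBINT t. norm (\<psi> t)) / (2 * pi) * tent (inverse (real (Suc n)) * x)"
        using inverse_fourier_le tent_bounds(1) by (rule mult_right_mono)
      moreover have "inverse_fourier \<psi> x * tent (inverse (real (Suc n)) * x) \<ge> 0"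
        using inverse_fourier_nonneg tent_bounds(1) by simp
      ultimately show "norm (inverse_fourier \<psi> x * tent (inverse (real (Suc n)) * x))
        \<le> norm ((LBINT t. norm (\<psi> t)) / (2 * pi) * tent (inverse (real (Suc n)) * x))"
        unfolding real_norm_def by linarith
    qed
  qed measurable
  have "(\<lambda>n. CLBINT x. of_real (inverse_fourier \<psi> x * tent (inverse (real (Suc n)) * x)) * iexp (0 * x)) \<longlonglongrightarrow> 1"
    using tent_inverse_fourier_tendsto[of 0] limit_at_0 by simp
  then have "(\<lambda>n. complex_of_real (LBINT x. inverse_fourier \<psi> x * tent (inverse (real (Suc n)) * x))) \<longlonglongrightarrow> complex_of_real 1"
    by (simp del: of_real_mult)
  then have lim1: "(\<lambda>n. LBINT x. inverse_fourier \<psi> x * tent (inverse (real (Suc n)) * x)) \<longlonglongrightarrow> 1"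
    by (simp only: tendsto_of_real_iff)
  have mono: "mono (\<lambda>n. inverse_fourier \<psi> x * tent (inverse (real (Suc n)) * x))" for x
  proof (rule monoI, rule mult_left_mono[OF _ inverse_fourier_nonneg])
    fix m n :: nat assume "m \<le> n"
    then have "\<bar>inverse (real (Suc n)) * x\<bar> \<le> \<bar>inverse (real (Suc m)) * x\<bar>"
      unfolding abs_mult by (intro mult_right_mono) (auto simp: divide_simps)
    then show "tent (inverse (real (Suc m)) * x) \<le> tent (inverse (real (Suc n)) * x)"
      by (auto simp: tent_def)
  qed
  have B: "has_bochner_integral lborel (inverse_fourier \<psi>) 1"
    using integrable_monotone_convergence[OF I AE_I2[OF mono] AE_I2[OF conv] lim1]
      integral_monotone_convergence[OF I AE_I2[OF mono] AE_I2[OF conv] lim1]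
    by (auto simp: has_bochner_integral_iff)
  then have int_g: "integrable lborel (inverse_fourier \<psi>)" by (simp add: has_bochner_integral_iff)
  have "(\<integral>\<^sup>+ x. ennreal (inverse_fourier \<psi> x) \<partial>lborel) = 1"
    using B inverse_fourier_nonneg by (subst nn_integral_eq_integral[OF int_g]) (auto simp: has_bochner_integral_iff)
  then have "prob_space (density lborel (\<lambda>x. ennreal (inverse_fourier \<psi> x)))"
    by (intro prob_spaceI) (simp add: emeasure_density)
  then show "real_distribution (density lborel (\<lambda>x. ennreal (inverse_fourier \<psi> x)))"
    by (auto simp: real_distribution_def real_distribution_axioms_def)
  have "(\<lambda>n. CLBINT x. of_real (inverse_fourier \<psi> x * tent (inverse (real (Suc n)) * x)) * iexp (t * x))
     \<longlonglongrightarrow> (CLBINT x. of_real (inverse_fourier \<psi> x) * iexp (t * x))"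
  proof (intro integral_dominated_convergence[where w="inverse_fourier \<psi>"] AE_I2 int_g)
    fix x
    show "(\<lambda>n. of_real (inverse_fourier \<psi> x * tent (inverse (real (Suc n)) * x)) * iexp (t * x))
      \<longlonglongrightarrow> of_real (inverse_fourier \<psi> x) * iexp (t * x)"
      by (intro tendsto_intros conv)
    fix n show "norm (of_real (inverse_fourier \<psi> x * tent (inverse (real (Suc n)) * x)) * iexp (t * x)) \<le> inverse_fourier \<psi> x"
      using inverse_fourier_nonneg tent_bounds(1,2)[of "inverse (real (Suc n)) * x"]
      by (simp add: norm_mult mult_right_le_one_le)
  qed auto
  then have "(CLBINT x. of_real (inverse_fourier \<psi> x) * iexp (t * x)) = \<psi> t"
    by (rule LIMSEQ_unique[OF _ tent_inverse_fourier_tendsto])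
  then show "char (density lborel (\<lambda>x. ennreal (inverse_fourier \<psi> x))) t = \<psi> t"
    unfolding char_def using inverse_fourier_nonneg
    by (subst integral_density) (auto simp: scaleR_conv_of_real)
qed

end

section \<open>Removing the smoothing\<close>

text \<open>Both sides are the probability that a variable with law \<open>M\<close> plus
  independent Fejer noise falls into the interval, integrated in the two possible orders.\<close>

lemma (in real_distribution) smoothed_interval_measure:
  assumes eps: "\<epsilon> > 0"
  shows "(LBINT y. fejer (y / \<epsilon>) / \<epsilon> * measure M {x - y - h<..x - y + h}) =
    (LBINT z:{x - h<..x + h}. LINT s|M. fejer ((z - s) / \<epsilon>) / \<epsilon>)"
proof -
  interpret P: pair_sigma_finite M lborel ..
  define k where "k y = fejer (y / \<epsilon>) / \<epsilon>" for y
  define I where "I z = (indicator {x - h<..x + h} z :: real)" for z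
  have [measurable]: "k \<in> borel_measurable borel" "I \<in> borel_measurable borel"
    unfolding k_def I_def by measurable
  have k0: "k y \<ge> 0" for y using eps by (simp add: k_def fejer_nonneg)
  have I01: "0 \<le> I z" "I z \<le> 1" for z by (auto simp: I_def)
  have k1: "has_bochner_integral lborel (\<lambda>y. k (y - c)) 1" for c
    unfolding k_def by (rule fejer_scaled_integral[OF eps])
  have kint: "integrable lborel (\<lambda>y. k (y - c))" for c
    using k1 by (auto simp: has_bochner_integral_iff)
  have int: "integrable lborel (\<lambda>y. k (y - c) * I (y + d))" for c d
    by (rule Bochner_Integration.integrable_bound[OF kint[of c]])
       (use k0 I01 in \<open>auto intro!: mult_right_le_one_le\<close>)
  have le1: "(LBINT y. k (y - c) * I (y + d)) \<le> 1" for c d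
  proof -
    have "(LBINT y. k (y - c) * I (y + d)) \<le> (LBINT y. k (y - c))"
      by (rule integral_mono[OF int kint]) (use k0 I01 in \<open>auto intro!: mult_right_le_one_le\<close>)
    then show ?thesis using k1[of c] by (auto simp: has_bochner_integral_iff)
  qed
  have I1: "integrable (M \<Otimes>\<^sub>M lborel) (\<lambda>(s, y). k y * I (y + s))"
  proof (rule P.Fubini_integrable)
    show "integrable M (\<lambda>s. LBINT y. norm (case (s, y) of (s, y) \<Rightarrow> k y * I (y + s)))"
    proof (rule integrable_const_bound[where B=1])
      show "AE s in M. norm (LBINT y. norm (case (s, y) of (s, y) \<Rightarrow> k y * I (y + s))) \<le> 1"
        using le1[of 0] k0 I01 by (auto simp: abs_mult)
    qed measurable
    show "AE s in M. integrable lborel (\<lambda>y. case (s, y) of (s, y) \<Rightarrow> k y * I (y + s))"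
      using int[of 0] by auto
  qed measurable
  have I2: "integrable (M \<Otimes>\<^sub>M lborel) (\<lambda>(s, y). k (y - s) * I y)"
  proof (rule P.Fubini_integrable)
    show "integrable M (\<lambda>s. LBINT y. norm (case (s, y) of (s, y) \<Rightarrow> k (y - s) * I y))"
    proof (rule integrable_const_bound[where B=1])
      show "AE s in M. norm (LBINT y. norm (case (s, y) of (s, y) \<Rightarrow> k (y - s) * I y)) \<le> 1"
        using le1[of _ 0] k0 I01 by (auto simp: abs_mult)
    qed measurable
    show "AE s in M. integrable lborel (\<lambda>y. case (s, y) of (s, y) \<Rightarrow> k (y - s) * I y)"
      using int[of _ 0] by auto
  qed measurable
  have "(LBINT y. k y * measure M {x - y - h<..x - y + h}) = (LBINT y. LINT s|M. k y * I (y + s))"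
  proof (intro Bochner_Integration.integral_cong refl)
    fix y
    have "measure M {x - y - h<..x - y + h} = (LINT s|M. indicator {x - y - h<..x - y + h} s)"
      by simp
    also have "\<dots> = (LINT s|M. I (y + s))"
      by (intro Bochner_Integration.integral_cong refl) (auto simp: I_def indicator_def)
    finally show "k y * measure M {x - y - h<..x - y + h} = (LINT s|M. k y * I (y + s))" by simp
  qed
  also have "\<dots> = (LINT s|M. (LBINT y. k y * I (y + s)))"
    using P.Fubini_integral[OF I1] by simp
  also have "\<dots> = (LINT s|M. (LBINT y. k (y - s) * I y))"
  proof (rule Bochner_Integration.integral_cong[OF refl])
    fix s
    show "(LBINT y. k y * I (y + s)) = (LBINT y. k (y - s) * I y)"
      using lborel_integral_real_affine[of 1 "\<lambda>y. k (y - s) * I y" s] by (simp add: add.commute)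
  qed
  also have "\<dots> = (LBINT y. (LINT s|M. k (y - s) * I y))"
    using P.Fubini_integral[OF I2] by simp
  also have "\<dots> = (LBINT z:{x - h<..x + h}. LINT s|M. k (z - s))"
    by (simp add: set_lebesgue_integral_def I_def mult.commute)
  finally show ?thesis by (simp add: k_def)
qed

lemma (in real_distribution) smoothed_density_measurable:
  assumes "\<epsilon> > 0"
  shows "(\<lambda>z. LINT s|M. fejer ((z - s) / \<epsilon>) / \<epsilon>) \<in> borel_measurable borel"
proof -
  have "(\<lambda>(z, s). fejer ((z - s) / \<epsilon>) / \<epsilon>) \<in> borel_measurable (borel \<Otimes>\<^sub>M M)" by measurable
  then show ?thesis using borel_measurable_lebesgue_integral by blast
qed

text \<open>Two inclusions undo the smoothing: for shifts of size at most e, the shifted interval of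
  half-width h + e contains the given one, and that of half-width h - e is contained in it. Larger
  shifts carry kernel mass at most \<tau>. They are dropped in the upper bound; in the lower bound
  they are paid for by an a priori bound \<open>P\<close> on all intervals of half-width h.\<close>

lemma (in real_distribution) interval_measure_bounds:
  fixes A B C L :: real and g :: "real \<Rightarrow> real"
  assumes eps: "\<epsilon> > 0" and A: "A > 0" and L: "L \<ge> 0" and eta: "\<eta> \<ge> 0"
    and close: "\<And>z. \<bar>A * (LINT s|M. fejer ((z - s) / \<epsilon>) / \<epsilon>) - g ((z - C) / A)\<bar> \<le> \<eta>"
    and lip: "\<And>x y. \<bar>g x - g y\<bar> \<le> L * \<bar>x - y\<bar>"
    and e: "0 < e" "e < h"
    and tau: "(LBINT y. indicator {-e..e} y * (fejer (y / \<epsilon>) / \<epsilon>)) \<ge> 1 - \<tau>"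
  shows "A * ((1 - \<tau>) * measure M {x - h<..x + h}) \<le> 2 * (h + e) * (g ((x - C) / A) + (\<eta> + L * (2 * h / A)))"
    and "(\<And>z. A * measure M {z - h<..z + h} \<le> P) \<Longrightarrow>
       A * measure M {x - h<..x + h} \<ge> 2 * (h - e) * (g ((x - C) / A) - (\<eta> + L * (2 * h / A))) - \<tau> * P"
proof -
  define k where "k y = fejer (y / \<epsilon>) / \<epsilon>" for y
  define D where "D z = (LINT s|M. fejer ((z - s) / \<epsilon>) / \<epsilon>)" for z
  define J where "J h = (LBINT y. k y * measure M {x - y - h<..x - y + h})" for h
  define G where "G = g ((x - C) / A)"
  define \<delta> where "\<delta> = \<eta> + L * (2 * h / A)"
  have [measurable]: "k \<in> borel_measurable borel" unfolding k_def by measurable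
  have [measurable]: "D \<in> borel_measurable borel" unfolding D_def[abs_def] by (rule smoothed_density_measurable[OF eps])
  have k0: "k y \<ge> 0" for y using eps by (simp add: k_def fejer_nonneg)
  have k1: "has_bochner_integral lborel k 1"
    using fejer_scaled_integral[OF eps, of 0] by (simp add: k_def[abs_def])
  then have kint: "integrable lborel k" and kI: "(LBINT y. k y) = 1" by (auto simp: has_bochner_integral_iff)
  \<comment> \<open>Within distance 2 * h of \<open>x\<close> the argument of \<open>g\<close> moves
    by at most 2 * h / A. Both half-widths h + e and h - e stay below 2 * h.\<close>
  have close': "\<bar>A * D z - G\<bar> \<le> \<delta>" if "\<bar>z - x\<bar> \<le> 2 * h" for z
  proof -
    have "\<bar>g ((z - C) / A) - G\<bar> \<le> L * \<bar>(z - C) / A - (x - C) / A\<bar>"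
      unfolding G_def by (rule lip)
    also have "(z - C) / A - (x - C) / A = (z - x) / A" by (simp add: diff_divide_distrib)
    also have "\<bar>(z - x) / A\<bar> \<le> 2 * h / A" using that A by (simp add: divide_right_mono)
    finally have "\<bar>g ((z - C) / A) - G\<bar> \<le> L * (2 * h / A)" using L by (meson mult_left_mono order_trans)
    with close[of z] show ?thesis unfolding D_def \<delta>_def by linarith
  qed
  have J: "2 * h' * (G - \<delta>) \<le> A * J h'" "A * J h' \<le> 2 * h' * (G + \<delta>)" if h': "0 < h'" "h' \<le> 2 * h" for h'
  proof -
    have "A * J h' = (LBINT z:{x - h'<..x + h'}. A * D z)"
      unfolding J_def k_def smoothed_interval_measure[OF eps] D_def by simp
    moreover have int: "set_integrable lborel {x - h'<..x + h'} (\<lambda>z. A * D z)"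
      unfolding set_integrable_def
    proof (rule integrableI_bounded_set_indicator[where B="\<bar>G\<bar> + \<delta>"])
      show "AE z in lborel. z \<in> {x - h'<..x + h'} \<longrightarrow> norm (A * D z) \<le> \<bar>G\<bar> + \<delta>"
      proof (intro AE_I2 impI)
        fix z assume "z \<in> {x - h'<..x + h'}"
        then have "\<bar>A * D z - G\<bar> \<le> \<delta>" using h' by (intro close') (auto simp: abs_le_iff)
        then show "norm (A * D z) \<le> \<bar>G\<bar> + \<delta>" by auto
      qed
    qed (auto simp: emeasure_lborel_Ioc h' less_imp_le)
    moreover have ci: "set_integrable lborel {x - h'<..x + h'} (\<lambda>z. c)"
      and cv: "(LBINT z:{x - h'<..x + h'}. c) = 2 * h' * c" for c :: real
      using h' by (simp_all add: set_integrable_def set_lebesgue_integral_def)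
    have "(LBINT z:{x - h'<..x + h'}. G - \<delta>) \<le> (LBINT z:{x - h'<..x + h'}. A * D z)"
    proof (rule set_integral_mono[OF ci int])
      fix z assume "z \<in> {x - h'<..x + h'}"
      then show "G - \<delta> \<le> A * D z" using close'[of z] h' by (auto simp: abs_le_iff)
    qed
    moreover have "(LBINT z:{x - h'<..x + h'}. A * D z) \<le> (LBINT z:{x - h'<..x + h'}. G + \<delta>)"
    proof (rule set_integral_mono[OF int ci])
      fix z assume "z \<in> {x - h'<..x + h'}"
      then show "A * D z \<le> G + \<delta>" using close'[of z] h' by (auto simp: abs_le_iff)
    qed
    ultimately show "2 * h' * (G - \<delta>) \<le> A * J h'" "A * J h' \<le> 2 * h' * (G + \<delta>)"
      by (simp_all only: cv)
  qed
  have [measurable]: "(\<lambda>y. measure M {x - y - h<..x - y + h}) \<in> borel_measurable borel" for h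
  proof -
    have "(\<lambda>y. LINT s|M. indicator {p. x - h < fst p + snd p \<and> fst p + snd p \<le> x + h} (y, s) :: real) \<in> borel_measurable borel"
      by (intro borel_measurable_lebesgue_integral) measurable
    also have "(\<lambda>y. LINT s|M. indicator {p. x - h < fst p + snd p \<and> fst p + snd p \<le> x + h} (y, s) :: real) =
      (\<lambda>y. LINT s|M. indicator {x - y - h<..x - y + h} s)"
      by (intro ext Bochner_Integration.integral_cong refl) (auto simp: indicator_def)
    finally show ?thesis by simp
  qed
  have Jint: "integrable lborel (\<lambda>y. k y * measure M {x - y - h'<..x - y + h'})" for h'
    by (rule Bochner_Integration.integrable_bound[OF kint]) (use k0 in \<open>auto intro!: mult_right_le_one_le\<close>)
  have eint: "integrable lborel (\<lambda>y. indicator {-e..e} y * k y)"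
    by (rule Bochner_Integration.integrable_bound[OF kint]) (use k0 in \<open>auto simp: indicator_def\<close>)
  have tau': "(LBINT y. indicator {-e..e} y * k y) \<ge> 1 - \<tau>" using tau by (simp add: k_def)
  have "(LBINT y. indicator {-e..e} y * k y * measure M {x - h<..x + h}) \<le> J (h + e)"
    unfolding J_def
  proof (rule integral_mono)
    fix y
    have "measure M {x - h<..x + h} \<le> measure M {x - y - (h + e)<..x - y + (h + e)}" if "y \<in> {-e..e}"
      using that by (intro finite_measure_mono) auto
    then show "indicator {-e..e} y * k y * measure M {x - h<..x + h} \<le> k y * measure M {x - y - (h + e)<..x - y + (h + e)}"
      using k0 by (auto simp: indicator_def mult_left_mono)
  qed (use eint Jint in auto)
  then have up: "(1 - \<tau>) * measure M {x - h<..x + h} \<le> J (h + e)"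
    using tau' by (simp add: mult_right_mono[OF tau' measure_nonneg, of M "{x - h<..x + h}"] order_trans[OF mult_right_mono[OF tau' measure_nonneg]])
  have "A * ((1 - \<tau>) * measure M {x - h<..x + h}) \<le> A * J (h + e)"
    using A up by simp
  also have "\<dots> \<le> 2 * (h + e) * (G + \<delta>)" using e by (intro J) auto
  finally show "A * ((1 - \<tau>) * measure M {x - h<..x + h}) \<le> 2 * (h + e) * (g ((x - C) / A) + (\<eta> + L * (2 * h / A)))"
    by (simp add: G_def \<delta>_def)
  assume P: "\<And>z. A * measure M {z - h<..z + h} \<le> P"
  have P0: "P \<ge> 0" using P[of 0] A by (meson measure_nonneg mult_nonneg_nonneg less_imp_le order_trans)
  have tau2: "(LBINT y. k y - indicator {-e..e} y * k y) \<le> \<tau>"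
    using tau' kI by (subst Bochner_Integration.integral_diff[OF kint eint]) simp
  have "J (h - e) \<le> (LBINT y. k y * measure M {x - h<..x + h} + (k y - indicator {-e..e} y * k y) * (P / A))"
    unfolding J_def
  proof (rule integral_mono)
    fix y
    show "k y * measure M {x - y - (h - e)<..x - y + (h - e)} \<le>
      k y * measure M {x - h<..x + h} + (k y - indicator {-e..e} y * k y) * (P / A)"
    proof (cases "y \<in> {-e..e}")
      case True
      then have "measure M {x - y - (h - e)<..x - y + (h - e)} \<le> measure M {x - h<..x + h}"
        by (intro finite_measure_mono) auto
      then show ?thesis using True k0 by (simp add: mult_left_mono)
    next
      case False
      have "measure M {x - y - (h - e)<..x - y + (h - e)} \<le> measure M {x - y - h<..x - y + h}"
        using e by (intro finite_measure_mono) auto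
      also have "\<dots> \<le> P / A" using P[of "x - y"] A by (simp add: field_simps)
      finally have "k y * measure M {x - y - (h - e)<..x - y + (h - e)} \<le> k y * (P / A)"
        using k0 by (rule mult_left_mono)
      moreover have "k y * measure M {x - h<..x + h} \<ge> 0" using k0 by simp
      ultimately show ?thesis using False by simp
    qed
  qed (use eint kint Jint in auto)
  also have "\<dots> = measure M {x - h<..x + h} + (LBINT y. k y - indicator {-e..e} y * k y) * (P / A)"
    using kint eint kI by (subst Bochner_Integration.integral_add) auto
  also have "\<dots> \<le> measure M {x - h<..x + h} + \<tau> * (P / A)"
    using tau2 P0 A by (intro add_left_mono mult_right_mono) auto
  finally have "A * J (h - e) \<le> A * (measure M {x - h<..x + h} + \<tau> * (P / A))"
    using A by simp
  also have "\<dots> = A * measure M {x - h<..x + h} + \<tau> * P" using A by (simp add: field_simps)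
  finally have "A * J (h - e) \<le> A * measure M {x - h<..x + h} + \<tau> * P" .
  moreover have "2 * (h - e) * (G - \<delta>) \<le> A * J (h - e)" using e by (intro J) auto
  ultimately show "A * measure M {x - h<..x + h} \<ge> 2 * (h - e) * (g ((x - C) / A) - (\<eta> + L * (2 * h / A))) - \<tau> * P"
    by (simp add: G_def \<delta>_def)
qed

text \<open>The two bounds are used in turn: the upper one, applied at every point, gives the
  uniform bound on interval probabilities that the lower one requires.\<close>

lemma local_limit_from_smoothed_densities:
  fixes \<mu> :: "nat \<Rightarrow> real measure" and A C :: "nat \<Rightarrow> real" and g :: "nat \<Rightarrow> real \<Rightarrow> real"
  assumes \<mu>: "\<And>n. real_distribution (\<mu> n)"
    and A: "filterlim A at_top sequentially"
    and smooth: "\<And>\<epsilon> \<eta>. \<epsilon> > 0 \<Longrightarrow> \<eta> > 0 \<Longrightarrow> \<forall>\<^sub>F n in sequentially. \<forall>z.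
      \<bar>A n * (LINT s|\<mu> n. fejer ((z - s) / \<epsilon>) / \<epsilon>) - g n ((z - C n) / A n)\<bar> \<le> \<eta>"
    and g0: "\<forall>\<^sub>F n in sequentially. \<forall>x. 0 \<le> g n x \<and> g n x \<le> B"
    and lip: "\<forall>\<^sub>F n in sequentially. \<forall>x y. \<bar>g n x - g n y\<bar> \<le> L * \<bar>x - y\<bar>"
    and h: "h > 0" and eta: "\<eta> > 0"
  shows "\<forall>\<^sub>F n in sequentially. \<forall>x.
    \<bar>A n / (2 * h) * measure (\<mu> n) {x - h<..x + h} - g n ((x - C n) / A n)\<bar> \<le> \<eta>"
proof -
  define B' where "B' = max B 0 + 1"
  have B': "B' \<ge> 1" by (simp add: B'_def)
  \<comment> \<open>\<open>\<theta>\<close> is both the relative change of the half-width and the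
    lost kernel mass. The final errors are 4 * \<theta> * B' + 3 * \<delta> above and 7 * \<theta> *
    B' + \<delta> below; with sixteenths of \<eta> each is at most \<eta> / 2.\<close>
  define \<theta> where "\<theta> = min (1/2) (\<eta> / (16 * B'))"
  have \<theta>: "0 < \<theta>" "\<theta> \<le> 1/2" "\<theta> * B' \<le> \<eta> / 16"
    using eta B' by (auto simp: \<theta>_def min_def field_simps)
  define \<delta> where "\<delta> = min 1 (\<eta> / 16)"
  have \<delta>: "0 < \<delta>" "\<delta> \<le> 1" "\<delta> \<le> \<eta> / 16" using eta by (auto simp: \<delta>_def)
  define e where "e = \<theta> * h"
  have e: "0 < e" "e < h" using \<theta> h by (auto simp: e_def)
  obtain \<epsilon> where eps: "\<epsilon> > 0" and tau: "(LBINT y. indicator {-e..e} y * (fejer (y / \<epsilon>) / \<epsilon>)) \<ge> 1 - \<theta>"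
    using fejer_concentrates[OF e(1) \<theta>(1)] by auto
  define L' where "L' = max L 0"
  have "((\<lambda>n. L' * (2 * h / A n)) \<longlongrightarrow> L' * 0) sequentially"
    by (intro tendsto_mult tendsto_const tendsto_divide_0[OF tendsto_const] filterlim_at_top_imp_at_infinity A)
  then have "\<forall>\<^sub>F n in sequentially. L' * (2 * h / A n) < \<delta> / 2"
    using \<delta> by (intro order_tendstoD) auto
  moreover have "\<forall>\<^sub>F n in sequentially. A n > 0"
    using A by (simp add: filterlim_at_top_dense)
  moreover have "\<forall>\<^sub>F n in sequentially. \<forall>z.
      \<bar>A n * (LINT s|\<mu> n. fejer ((z - s) / \<epsilon>) / \<epsilon>) - g n ((z - C n) / A n)\<bar> \<le> \<delta> / 2"
    using \<delta>(1) by (intro smooth eps) simp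
  moreover note g0 lip
  ultimately show ?thesis
  proof (eventually_elim, intro allI)
    case (elim n)
    fix x
    interpret real_distribution "\<mu> n" by (rule \<mu>)
    define p where "p x = A n * measure (\<mu> n) {x - h<..x + h}" for x
    define G where "G x = g n ((x - C n) / A n)" for x
    have G: "0 \<le> G x" "G x \<le> B'" for x
      using elim(4)[rule_format, of "(x - C n) / A n"] by (auto simp: G_def B'_def)
    have lip': "\<bar>g n x - g n y\<bar> \<le> L' * \<bar>x - y\<bar>" for x y
      using elim(5)[rule_format, of x y] mult_right_mono[of L L' "\<bar>x - y\<bar>"] by (simp add: L'_def)
    have L': "L' \<ge> 0" by (simp add: L'_def)
    have cl: "\<And>z. \<bar>A n * (LINT s|\<mu> n. fejer ((z - s) / \<epsilon>) / \<epsilon>) - g n ((z - C n) / A n)\<bar> \<le> \<delta> / 2"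
      using elim(3) by auto
    have d2: "\<delta> / 2 \<ge> 0" using \<delta> by simp
    note bnd = interval_measure_bounds[where g="g n" and C="C n", OF eps elim(2) L' d2 cl lip' e tau]
    have up: "p x * (1 - \<theta>) \<le> 2 * (h + e) * (G x + \<delta>)" for x
    proof -
      have "p x * (1 - \<theta>) \<le> 2 * (h + e) * (G x + (\<delta> / 2 + L' * (2 * h / A n)))"
        using bnd(1)[of x] by (simp add: p_def G_def mult_ac)
      also have "\<dots> \<le> 2 * (h + e) * (G x + \<delta>)"
        using elim(1) e by (intro mult_left_mono) auto
      finally show ?thesis .
    qed
    have up': "p x / (2 * h) \<le> (1 + \<theta>) * (1 + 2 * \<theta>) * (G x + \<delta>)" for x
    proof -
      \<comment> \<open>Division by 1 - \<theta> is replaced by multiplication with 1 + 2 *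
        \<theta>; this is where \<theta> \<le> 1/2 enters.\<close>
      have 1: "1 \<le> (1 - \<theta>) * (1 + 2 * \<theta>)" using \<theta> by (simp add: algebra_simps)
      have p0: "p x \<ge> 0" using elim(2) by (simp add: p_def)
      have "p x \<le> p x * ((1 - \<theta>) * (1 + 2 * \<theta>))" using mult_left_mono[OF 1 p0] by simp
      also have "\<dots> = (p x * (1 - \<theta>)) * (1 + 2 * \<theta>)" by simp
      also have "\<dots> \<le> (2 * (h + e) * (G x + \<delta>)) * (1 + 2 * \<theta>)"
        using up \<theta> by (intro mult_right_mono) auto
      also have "\<dots> = 2 * h * ((1 + \<theta>) * (1 + 2 * \<theta>) * (G x + \<delta>))" by (simp add: e_def algebra_simps)
      finally show ?thesis using h by (simp add: field_simps)
    qed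
    have th2: "(1 + \<theta>) * (1 + 2 * \<theta>) \<le> 1 + 4 * \<theta>"
      using \<theta> mult_left_mono[of \<theta> "1/2" \<theta>] by (simp add: algebra_simps)
    have up2: "p x / (2 * h) \<le> G x + 4 * \<theta> * B' + 3 * \<delta>" for x
    proof -
      have "p x / (2 * h) \<le> (1 + 4 * \<theta>) * (G x + \<delta>)"
        using up'[of x] th2 G(1)[of x] \<delta> by (meson add_nonneg_pos less_imp_le mult_right_mono order_trans add_nonneg_nonneg)
      also have "\<dots> = G x + 4 * \<theta> * G x + (1 + 4 * \<theta>) * \<delta>" by (simp add: algebra_simps)
      also have "\<dots> \<le> G x + 4 * \<theta> * B' + 3 * \<delta>"
        using \<theta> \<delta> G(2)[of x] by (intro add_mono mult_left_mono mult_right_mono) auto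
      finally show ?thesis .
    qed
    \<comment> \<open>The constant 6: G is at most B', 4 * \<theta> * B' at most 2 * B', and 3 *
      \<delta> at most 3 * B'.\<close>
    have P: "A n * measure (\<mu> n) {z - h<..z + h} \<le> 2 * h * (6 * B')" for z
    proof -
      have "p z / (2 * h) \<le> 6 * B'"
      proof -
        have "4 * \<theta> * B' \<le> 2 * B'" using \<theta> B' by (intro mult_right_mono) auto
        then show ?thesis using up2[of z] G(2)[of z] \<delta>(2) B' by linarith
      qed
      then show ?thesis using h by (simp add: p_def field_simps)
    qed
    have "p x \<ge> 2 * (h - e) * (G x - \<delta>) - \<theta> * (2 * h * (6 * B'))"
    proof -
      have "2 * (h - e) * (G x - \<delta>) \<le> 2 * (h - e) * (G x - (\<delta> / 2 + L' * (2 * h / A n)))"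
        using elim(1) e by (intro mult_left_mono) auto
      then show ?thesis using bnd(2)[OF P, of x] by (simp add: p_def G_def)
    qed
    then have "p x / (2 * h) \<ge> (1 - \<theta>) * (G x - \<delta>) - \<theta> * (6 * B')"
      using h by (simp add: e_def field_simps)
    moreover have "(1 - \<theta>) * (G x - \<delta>) \<ge> G x - \<theta> * B' - \<delta>"
      
    proof -
      have "\<theta> * G x \<le> \<theta> * B'" "\<theta> * \<delta> \<ge> 0" using \<theta> \<delta> G(2)[of x] by (auto intro: mult_left_mono)
      then show ?thesis by (simp add: algebra_simps)
    qed
    ultimately have "p x / (2 * h) \<ge> G x - 7 * (\<theta> * B') - \<delta>" by simp
    then have "\<bar>p x / (2 * h) - G x\<bar> \<le> \<eta>"
      using up2[of x] \<theta>(3) \<delta>(3) eta by (simp add: abs_le_iff)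
    then show "\<bar>A n / (2 * h) * measure (\<mu> n) {x - h<..x + h} - g n ((x - C n) / A n)\<bar> \<le> \<eta>"
      by (simp add: p_def G_def)
  qed
qed

section \<open>Slow variation\<close>

text \<open>The uniform convergence theorem for slow variation in additive form. Suppose the
  increment from y to y + u stays large. Each of the two points has a set of steps in [0, 2], of
  measure above 3/2, over which f changes by less than \<epsilon>/2. After translation by u both
  sets lie in [0, 3], so they meet, and at a common point f is within \<epsilon>/2 of both f y and f
  (y + u).\<close>

lemma uniform_convergence_of_increments:
  fixes f :: "real \<Rightarrow> real"
  assumes [measurable]: "f \<in> borel_measurable borel"
    and lim: "\<And>u. ((\<lambda>y. f (y + u) - f y) \<longlongrightarrow> 0) at_top"
    and eps: "\<epsilon> > 0"
  shows "\<exists>Y. \<forall>y\<ge>Y. \<forall>u\<in>{0..1}. \<bar>f (y + u) - f y\<bar> \<le> \<epsilon>"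
proof (rule ccontr)
  assume "\<not> ?thesis"
  then have "\<forall>n::nat. \<exists>y u. y \<ge> real n \<and> u \<in> {0..1} \<and> \<bar>f (y + u) - f y\<bar> > \<epsilon>"
    by (metis not_le)
  then obtain y u where yu: "\<And>n. y n \<ge> real n" "\<And>n. u n \<in> {0..1}" "\<And>n. \<bar>f (y n + u n) - f (y n)\<bar> > \<epsilon>"
    by metis
  \<comment> \<open>By pointwise convergence these sets increase to [0, 2], so their measure
    eventually exceeds 3/2.\<close>
  have measure: "\<exists>N. \<forall>n\<ge>N. measure lborel {v\<in>{0..2}. \<forall>m\<ge>n. \<bar>f (x m + v) - f (x m)\<bar> < \<epsilon> / 2} > 3 / 2"
    if x: "filterlim x at_top sequentially" for x :: "nat \<Rightarrow> real"
  proof -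
    define V where "V n = {v\<in>{0..2}. \<forall>m\<ge>n. \<bar>f (x m + v) - f (x m)\<bar> < \<epsilon> / 2}" for n
    have [measurable]: "V n \<in> sets borel" for n unfolding V_def by measurable
    have "(\<Union>n. V n) = {0..2}"
    proof (intro equalityI subsetI)
      fix v :: real assume v: "v \<in> {0..2}"
      have "(\<lambda>m. f (x m + v) - f (x m)) \<longlonglongrightarrow> 0"
        using filterlim_compose[OF lim x] .
      then have "\<forall>\<^sub>F m in sequentially. \<bar>f (x m + v) - f (x m)\<bar> < \<epsilon> / 2"
        using eps by (auto simp: tendsto_iff dest!: spec[of _ "\<epsilon> / 2"])
      then show "v \<in> (\<Union>n. V n)"
        using v by (auto simp: V_def eventually_sequentially)
    qed (auto simp: V_def)
    moreover have "incseq V" by (auto simp: incseq_def V_def)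
    ultimately have "(\<lambda>n. measure lborel (V n)) \<longlonglongrightarrow> measure lborel {0..2::real}"
      using Lim_measure_incseq[of V lborel] by (auto simp: image_subset_iff)
    then have "\<forall>\<^sub>F n in sequentially. measure lborel (V n) > 3/2"
      by (intro order_tendstoD) auto
    then show ?thesis by (simp add: V_def eventually_sequentially)
  qed
  have y_lim: "filterlim y at_top sequentially"
    by (rule filterlim_at_top_mono[OF filterlim_real_sequentially]) (use yu in auto)
  have yu_lim: "filterlim (\<lambda>n. y n + u n) at_top sequentially"
    by (rule filterlim_at_top_mono[OF y_lim]) (use yu(2) in auto)
  obtain N1 where N1: "\<And>n. n \<ge> N1 \<Longrightarrow> measure lborel {v\<in>{0..2}. \<forall>m\<ge>n. \<bar>f (y m + v) - f (y m)\<bar> < \<epsilon> / 2} > 3 / 2"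
    using measure[OF y_lim] by auto
  obtain N2 where N2: "\<And>n. n \<ge> N2 \<Longrightarrow> measure lborel {v\<in>{0..2}. \<forall>m\<ge>n. \<bar>f (y m + u m + v) - f (y m + u m)\<bar> < \<epsilon> / 2} > 3 / 2"
    using measure[OF yu_lim] by auto
  define N where "N = max N1 N2"
  define V where "V = {v\<in>{0..2}. \<forall>m\<ge>N. \<bar>f (y m + v) - f (y m)\<bar> < \<epsilon> / 2}"
  define W where "W = {v\<in>{0..2}. \<forall>m\<ge>N. \<bar>f (y m + u m + v) - f (y m + u m)\<bar> < \<epsilon> / 2}"
  have [measurable]: "V \<in> sets borel" "W \<in> sets borel" unfolding V_def W_def by measurable
  have V: "measure lebesgue V > 3/2" and W: "measure lebesgue W > 3/2"
    using N1[of N] N2[of N] by (auto simp: N_def V_def W_def)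
  define W' where "W' = (\<lambda>v. u N + v) ` W"
  have W': "measure lebesgue W' > 3/2"
    using W unfolding W'_def by (simp add: measure_translation)
  have Wm: "W \<in> lmeasurable"
    by (rule bounded_set_imp_lmeasurable) (auto simp: W_def intro!: bounded_subset[OF bounded_closed_interval[of 0 2]])
  have Vm: "V \<in> lmeasurable"
    by (rule bounded_set_imp_lmeasurable) (auto simp: V_def intro!: bounded_subset[OF bounded_closed_interval[of 0 2]])
  have W'm: "W' \<in> lmeasurable"
    unfolding W'_def by (rule measurable_translation[OF Wm])
  have "V \<inter> W' \<noteq> {}"
  proof
    assume "V \<inter> W' = {}"
    then have "measure lebesgue (V \<union> W') = measure lebesgue V + measure lebesgue W'"
      using measure_Un3[OF Vm W'm] by simp
    moreover have "measure lebesgue (V \<union> W') \<le> measure lebesgue {0..3::real}"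
    proof (rule measure_mono_fmeasurable)
      show "V \<union> W' \<subseteq> {0..3}" using yu(2)[of N] by (auto simp: V_def W'_def W_def)
      show "V \<union> W' \<in> sets lebesgue" using fmeasurableD[OF Vm] fmeasurableD[OF W'm] by (rule sets.Un)
    qed (rule lmeasurable_compact[OF compact_Icc])
    ultimately show False using V W' by simp
  qed
  then obtain v w where v: "v \<in> V" and w: "w \<in> W" and vw: "v = u N + w"
    by (auto simp: W'_def)
  have "\<bar>f (y N + v) - f (y N)\<bar> < \<epsilon> / 2" using v by (auto simp: V_def)
  moreover have "\<bar>f (y N + v) - f (y N + u N)\<bar> < \<epsilon> / 2"
    using w by (auto simp: W_def vw add.assoc)
  ultimately show False using yu(3)[of N] by linarith
qed

text \<open>Potter's bound in symmetric logarithmic form: uniformity over unit steps is chained, at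
  the price of one \<epsilon> for each unit of logarithmic distance and one for the
  remainder.\<close>

lemma slowly_varying_log_bound:
  assumes sv: "slowly_varying l" and eps: "\<epsilon> > 0"
  shows "\<exists>x0\<ge>1. \<forall>x\<ge>x0. \<forall>y\<ge>x0. \<bar>ln (l y) - ln (l x)\<bar> \<le> \<epsilon> * (1 + \<bar>ln y - ln x\<bar>)"
proof -
  \<comment> \<open>Measurability of \<open>l\<close> is known on [1, infinity) only, so the values
    below 1 are cut off; for y < 0 this leaves the constant ln 0.\<close>
  define f where "f y = ln (indicator {1..} (exp y) *\<^sub>R l (exp y))" for y :: real
  have m: "(\<lambda>x. indicator {1..} x *\<^sub>R l x) \<in> borel_measurable borel"
    using sv by (simp add: slowly_varying_def set_borel_measurable_def)
  have [measurable]: "f \<in> borel_measurable borel"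
    unfolding f_def using measurable_compose[OF _ m, of exp borel] by measurable
  have pos: "l x > 0" if "x \<ge> 1" for x using sv that by (auto simp: slowly_varying_def)
  have feq: "f y = ln (l (exp y))" if "y \<ge> 0" for y using that by (simp add: f_def)
  have lim: "((\<lambda>y. f (y + u) - f y) \<longlongrightarrow> 0) at_top" for u
  proof -
    have "((\<lambda>x. l (exp u * x) / l x) \<longlongrightarrow> 1) at_top"
      using sv by (auto simp: slowly_varying_def)
    from tendsto_ln[OF filterlim_compose[OF this exp_at_top]]
    have "((\<lambda>y. ln (l (exp u * exp y) / l (exp y))) \<longlongrightarrow> 0) at_top" by simp
    moreover have "\<forall>\<^sub>F y in at_top. ln (l (exp u * exp y) / l (exp y)) = f (y + u) - f y"
      using eventually_ge_at_top[of "0::real"] eventually_ge_at_top[of "-u"]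
    proof eventually_elim
      case (elim y)
      then have "l (exp (y + u)) > 0" "l (exp y) > 0" by (auto intro!: pos)
      then show ?case using elim by (simp add: feq exp_add[symmetric] ln_div add.commute)
    qed
    ultimately show ?thesis by (rule Lim_transform_eventually)
  qed
  obtain Y where Y: "\<And>y u. y \<ge> Y \<Longrightarrow> u \<in> {0..1} \<Longrightarrow> \<bar>f (y + u) - f y\<bar> \<le> \<epsilon>"
    using uniform_convergence_of_increments[OF _ lim eps] by force
  have step: "\<bar>f (y + u) - f y\<bar> \<le> \<epsilon> * (1 + u)" if "y \<ge> Y" "0 \<le> u" "u \<le> real n" for y u n
    using that
  proof (induction n arbitrary: y u)
    case 0
    then show ?case using eps by simp
  next
    case (Suc n)
    show ?case
    proof (cases "u \<le> 1")
      case True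
      then have "\<bar>f (y + u) - f y\<bar> \<le> \<epsilon>" using Suc.prems by (intro Y) auto
      also have "\<dots> \<le> \<epsilon> * (1 + u)" using eps Suc.prems by simp
      finally show ?thesis .
    next
      case False
      have "\<bar>f ((y + 1) + (u - 1)) - f (y + 1)\<bar> \<le> \<epsilon> * (1 + (u - 1))"
        using False Suc.prems by (intro Suc.IH) auto
      moreover have "\<bar>f (y + 1) - f y\<bar> \<le> \<epsilon>" using Suc.prems by (intro Y) auto
      ultimately show ?thesis by (simp add: algebra_simps)
    qed
  qed
  have step': "\<bar>f z - f y\<bar> \<le> \<epsilon> * (1 + \<bar>z - y\<bar>)" if "y \<ge> Y" "z \<ge> Y" for y z
  proof (cases "z \<ge> y")
    case True
    obtain n :: nat where "z - y \<le> real n" using real_arch_simple by blast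
    from step[OF \<open>y \<ge> Y\<close> _ this] True show ?thesis by simp
  next
    case False
    obtain n :: nat where "y - z \<le> real n" using real_arch_simple by blast
    from step[OF \<open>z \<ge> Y\<close> _ this] False show ?thesis by (simp add: abs_minus_commute)
  qed
  show ?thesis
  proof (intro exI[of _ "exp (max Y 0)"] conjI allI impI)
    fix x y :: real assume xy: "exp (max Y 0) \<le> x" "exp (max Y 0) \<le> y"
    have x: "0 < x" "0 < y" using xy exp_gt_zero[of "max Y 0"] by linarith+
    then have "max Y 0 \<le> ln x" "max Y 0 \<le> ln y"
      using xy ln_ge_iff[OF x(1), of "max Y 0"] ln_ge_iff[OF x(2), of "max Y 0"] by blast+
    then show "\<bar>ln (l y) - ln (l x)\<bar> \<le> \<epsilon> * (1 + \<bar>ln y - ln x\<bar>)"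
      using step'[of "ln x" "ln y"] x by (simp add: feq)
  qed simp
qed

lemma norming_log_bound:
  assumes sv: "slowly_varying l" and eps: "\<epsilon> > 0"
  shows "\<exists>x0\<ge>1. \<forall>x\<ge>x0. \<forall>y\<ge>x0.
    \<bar>ln (norming \<alpha> l y) - ln (norming \<alpha> l x) - (ln y - ln x) / \<alpha>\<bar> \<le> \<epsilon> * (1 + \<bar>ln y - ln x\<bar>)"
proof -
  obtain x0 where x0: "x0 \<ge> 1" "\<And>x y. x \<ge> x0 \<Longrightarrow> y \<ge> x0 \<Longrightarrow> \<bar>ln (l y) - ln (l x)\<bar> \<le> \<epsilon> * (1 + \<bar>ln y - ln x\<bar>)"
    using slowly_varying_log_bound[OF sv eps] by auto
  have *: "ln (norming \<alpha> l x) = ln x / \<alpha> + ln (l x)" if "x \<ge> x0" for x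
  proof -
    have "l x > 0" using sv that x0(1) by (auto simp: slowly_varying_def)
    then show ?thesis using that x0(1) by (simp add: norming_def ln_mult ln_powr)
  qed
  show ?thesis
  proof (intro exI[of _ x0] conjI allI impI x0(1))
    fix x y :: real assume "x \<ge> x0" "y \<ge> x0"
    with x0(2)[of x y] show "\<bar>ln (norming \<alpha> l y) - ln (norming \<alpha> l x) - (ln y - ln x) / \<alpha>\<bar> \<le> \<epsilon> * (1 + \<bar>ln y - ln x\<bar>)"
      by (simp add: * diff_divide_distrib)
  qed
qed

text \<open>Its reciprocal is the infimum of the y \<ge> 1 at which the norming function exceeds x,
  so this is a generalized inverse. It is the common factor of both tail hypotheses.\<close>

definition tail_sup :: "real \<Rightarrow> (real \<Rightarrow> real) \<Rightarrow> real \<Rightarrow> real" where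
  "tail_sup \<alpha> l x = Sup {t. 0 < t \<and> t \<le> 1 \<and> norming \<alpha> l (1 / t) > x}"

lemma tail_sv_eq_tail_sup: "x > 0 \<Longrightarrow> tail_sv \<alpha> l x / x powr \<alpha> = tail_sup \<alpha> l x"
proof -
  assume "x > 0"
  moreover have "norming \<alpha> l (1 / t) = t powr (- (1 / \<alpha>)) * l (1 / t)" if "t > 0" for t
    using that powr_divide[of 1 t "1 / \<alpha>"] by (simp add: norming_def powr_minus_divide)
  then have "{t. 0 < t \<and> t \<le> 1 \<and> t powr (- (1 / \<alpha>)) * l (1 / t) > x} =
      {t. 0 < t \<and> t \<le> 1 \<and> norming \<alpha> l (1 / t) > x}"
    by auto
  ultimately show ?thesis by (simp add: tail_sv_def tail_sup_def)
qed

text \<open>\<open>M\<close> is the product of a monotone function, which has countably many jumps,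
  and the continuous function x powr \<alpha>.\<close>

lemma countable_discontinuities:
  fixes M :: "real \<Rightarrow> real"
  assumes am: "antimono_on {0<..} (\<lambda>x. M x * x powr (- \<alpha>))"
  shows "countable {x\<in>{0<..}. \<not> isCont M x}"
proof -
  let ?g = "\<lambda>x. M x * x powr (- \<alpha>)"
  have "mono_on {0<..} (\<lambda>x. - ?g x)"
    using am by (auto simp: monotone_on_def)
  then have "countable {x\<in>{0<..}. \<not> isCont (\<lambda>x. - ?g x) x}"
    using mono_on_ctble_discont_open[of "{0<..}" "\<lambda>x. - ?g x"] by simp
  moreover have "{x\<in>{0<..}. \<not> isCont M x} \<subseteq> {x\<in>{0<..}. \<not> isCont (\<lambda>x. - ?g x) x}"
  proof safe
    fix x :: real assume x: "x > 0" "isCont (\<lambda>x. - ?g x) x" "\<not> isCont M x"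
    have "isCont (\<lambda>y. - (y powr \<alpha>)) x" using x(1) by (intro continuous_intros) auto
    from continuous_mult[OF x(2) this] have "isCont (\<lambda>y. - ?g y * - (y powr \<alpha>)) x" .
    moreover have ev: "\<forall>\<^sub>F y in nhds x. - ?g y * - (y powr \<alpha>) = M y"
      using eventually_nhds_in_open[of "{0<..}" x] x(1)
      by (auto elim!: eventually_mono simp: powr_minus)
    ultimately have "isCont M x" using isCont_cong[OF ev] by blast
    then show False using x by simp
  qed
  ultimately show ?thesis by (rule countable_subset[rotated])
qed

section \<open>Regularly varying norming and its generalized inverse\<close>

locale regular_norming =
  fixes \<alpha> :: real and l1 :: "real \<Rightarrow> real"
  assumes alpha_pos: "0 < \<alpha>" and sv: "slowly_varying l1"
begin

abbreviation "A \<equiv> norming \<alpha> l1"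

lemma A_pos: "x \<ge> 1 \<Longrightarrow> A x > 0"
  using sv by (simp add: norming_def slowly_varying_def)

lemma A_log:
  assumes "\<epsilon> > 0"
  obtains x0 where "x0 \<ge> 1"
    "\<And>x y. x \<ge> x0 \<Longrightarrow> y \<ge> x0 \<Longrightarrow> \<bar>ln (A y) - ln (A x) - (ln y - ln x) / \<alpha>\<bar> \<le> \<epsilon> * (1 + \<bar>ln y - ln x\<bar>)"
  using norming_log_bound[OF sv assms, of \<alpha>] by blast

text \<open>The logarithmic bound is uniform in the ratio of the arguments, so this ratio may vary
  and merely converge, as n / k m does later.\<close>

lemma A_ratio_tendsto:
  assumes x: "filterlim x at_top F" and y: "filterlim y at_top F"
    and r: "((\<lambda>i. y i / x i) \<longlongrightarrow> r) F" "r > 0"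
  shows "((\<lambda>i. A (y i) / A (x i)) \<longlongrightarrow> r powr (1 / \<alpha>)) F"
proof -
  define w where "w i = ln (y i) - ln (x i)" for i
  have w: "(w \<longlongrightarrow> ln r) F"
  proof (rule Lim_transform_eventually)
    show "((\<lambda>i. ln (y i / x i)) \<longlongrightarrow> ln r) F" using r by (intro tendsto_ln) auto
    show "\<forall>\<^sub>F i in F. ln (y i / x i) = w i"
      using filterlim_at_top_dense[THEN iffD1, OF x, rule_format, of 0] filterlim_at_top_dense[THEN iffD1, OF y, rule_format, of 0]
      by eventually_elim (simp add: w_def ln_div)
  qed
  have "((\<lambda>i. (ln (A (y i)) - ln (A (x i))) - w i / \<alpha>) \<longlongrightarrow> 0) F"
  proof (rule tendstoI)
    fix e :: real assume e: "e > 0"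
    \<comment> \<open>Eventually |w| < |ln r| + 1, so the error \<epsilon> * (1 + |w|) is at most e
      / 2.\<close>
    define \<epsilon> where "\<epsilon> = e / (2 * (2 + \<bar>ln r\<bar>))"
    have eps: "\<epsilon> > 0" using e by (simp add: \<epsilon>_def)
    obtain x0 where x0: "x0 \<ge> 1"
      "\<And>x y. x \<ge> x0 \<Longrightarrow> y \<ge> x0 \<Longrightarrow> \<bar>ln (A y) - ln (A x) - (ln y - ln x) / \<alpha>\<bar> \<le> \<epsilon> * (1 + \<bar>ln y - ln x\<bar>)"
      using A_log[OF eps] by blast
    have "\<forall>\<^sub>F i in F. dist (w i) (ln r) < 1" using w by (rule tendstoD) simp
    moreover have "\<forall>\<^sub>F i in F. x i \<ge> x0" "\<forall>\<^sub>F i in F. y i \<ge> x0"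
      using x y by (auto simp: filterlim_at_top)
    ultimately show "\<forall>\<^sub>F i in F. dist ((ln (A (y i)) - ln (A (x i))) - w i / \<alpha>) 0 < e"
    proof eventually_elim
      case (elim i)
      have "\<bar>ln (A (y i)) - ln (A (x i)) - w i / \<alpha>\<bar> \<le> \<epsilon> * (1 + \<bar>w i\<bar>)"
        unfolding w_def using elim by (intro x0) auto
      also have "\<dots> \<le> \<epsilon> * (2 + \<bar>ln r\<bar>)"
        using elim(1) eps by (intro mult_left_mono) (auto simp: dist_real_def)
      also have "\<dots> = e / 2" using abs_ge_zero[of "ln r"] by (simp add: \<epsilon>_def field_simps add_nonneg_eq_0_iff)
      also have "\<dots> < e" using e by simp
      finally show ?case by (simp add: dist_real_def)
    qed
  qed
  from tendsto_add[OF this tendsto_divide[OF w tendsto_const[of \<alpha>]]]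
  have "((\<lambda>i. ln (A (y i)) - ln (A (x i))) \<longlongrightarrow> ln r / \<alpha>) F" using alpha_pos by simp
  then have "((\<lambda>i. exp (ln (A (y i)) - ln (A (x i)))) \<longlongrightarrow> exp (ln r / \<alpha>)) F"
    by (rule tendsto_exp)
  moreover have "exp (ln r / \<alpha>) = r powr (1 / \<alpha>)" using r by (simp add: powr_def)
  moreover have "\<forall>\<^sub>F i in F. exp (ln (A (y i)) - ln (A (x i))) = A (y i) / A (x i)"
    using filterlim_at_top[THEN iffD1, OF x, rule_format, of 1] filterlim_at_top[THEN iffD1, OF y, rule_format, of 1]
    by eventually_elim (simp add: exp_diff A_pos)
  ultimately show ?thesis using Lim_transform_eventually by fastforce
qed

text \<open>With the gap between \<beta> and 1/\<alpha> as \<epsilon>, the logarithmic bound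
  exponentiates to a power bound with constant exp \<epsilon>.\<close>

lemma potter_lower:
  assumes "\<beta> < 1 / \<alpha>"
  obtains x0 K where "x0 \<ge> 1" "K > 0"
    "\<And>x y. x \<ge> x0 \<Longrightarrow> y \<ge> x \<Longrightarrow> (y / x) powr \<beta> \<le> K * (A y / A x)"
proof -
  define \<epsilon> where "\<epsilon> = 1 / \<alpha> - \<beta>"
  have eps: "\<epsilon> > 0" using assms by (simp add: \<epsilon>_def)
  obtain x0 where x0: "x0 \<ge> 1"
    "\<And>x y. x \<ge> x0 \<Longrightarrow> y \<ge> x0 \<Longrightarrow> \<bar>ln (A y) - ln (A x) - (ln y - ln x) / \<alpha>\<bar> \<le> \<epsilon> * (1 + \<bar>ln y - ln x\<bar>)"
    using A_log[OF eps] by blast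
  have "(y / x) powr \<beta> \<le> exp \<epsilon> * (A y / A x)" if "x \<ge> x0" "y \<ge> x" for x y
  proof -
    have pos: "0 < x" "0 < y" "A x > 0" "A y > 0" using that x0(1) by (auto intro!: A_pos)
    have w: "ln y - ln x \<ge> 0" using that pos by simp
    have "\<beta> * (ln y - ln x) \<le> \<epsilon> + (ln (A y) - ln (A x))"
    proof -
      have "(ln y - ln x) / \<alpha> - (ln (A y) - ln (A x)) \<le> \<epsilon> * (1 + (ln y - ln x))"
        using x0(2)[of x y] that w by auto
      moreover have "\<epsilon> * (1 + (ln y - ln x)) = \<epsilon> + ((ln y - ln x) / \<alpha> - \<beta> * (ln y - ln x))"
        by (simp add: \<epsilon>_def algebra_simps diff_divide_distrib)
      ultimately show ?thesis by linarith
    qed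
    then have "exp (\<beta> * (ln y - ln x)) \<le> exp (\<epsilon> + (ln (A y) - ln (A x)))" by simp
    then show ?thesis using pos by (simp add: powr_def ln_div exp_add exp_diff)
  qed
  then show ?thesis using that[of x0 "exp \<epsilon>"] x0(1) by simp
qed

lemma potter_upper:
  assumes "\<beta> > 1 / \<alpha>"
  obtains x0 K where "x0 \<ge> 1" "K > 0"
    "\<And>x y. x \<ge> x0 \<Longrightarrow> y \<ge> x \<Longrightarrow> A y / A x \<le> K * (y / x) powr \<beta>"
proof -
  define \<epsilon> where "\<epsilon> = \<beta> - 1 / \<alpha>"
  have eps: "\<epsilon> > 0" using assms by (simp add: \<epsilon>_def)
  obtain x0 where x0: "x0 \<ge> 1"
    "\<And>x y. x \<ge> x0 \<Longrightarrow> y \<ge> x0 \<Longrightarrow> \<bar>ln (A y) - ln (A x) - (ln y - ln x) / \<alpha>\<bar> \<le> \<epsilon> * (1 + \<bar>ln y - ln x\<bar>)"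
    using A_log[OF eps] by blast
  have "A y / A x \<le> exp \<epsilon> * (y / x) powr \<beta>" if "x \<ge> x0" "y \<ge> x" for x y
  proof -
    have pos: "0 < x" "0 < y" "A x > 0" "A y > 0" using that x0(1) by (auto intro!: A_pos)
    have w: "ln y - ln x \<ge> 0" using that pos by simp
    have "ln (A y) - ln (A x) \<le> \<epsilon> + \<beta> * (ln y - ln x)"
    proof -
      have "(ln (A y) - ln (A x)) - (ln y - ln x) / \<alpha> \<le> \<epsilon> * (1 + (ln y - ln x))"
        using x0(2)[of x y] that w by auto
      moreover have "\<epsilon> * (1 + (ln y - ln x)) = \<epsilon> + (\<beta> * (ln y - ln x) - (ln y - ln x) / \<alpha>)"
        by (simp add: \<epsilon>_def algebra_simps diff_divide_distrib)
      ultimately show ?thesis by linarith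
    qed
    then have "exp (ln (A y) - ln (A x)) \<le> exp (\<epsilon> + \<beta> * (ln y - ln x))" by simp
    then show ?thesis using pos by (simp add: powr_def ln_div exp_add exp_diff)
  qed
  then show ?thesis using that[of x0 "exp \<epsilon>"] x0(1) by simp
qed

lemma A_at_top: "filterlim A at_top at_top"
proof -
  define \<beta> where "\<beta> = 1 / (2 * \<alpha>)"
  have b: "0 < \<beta>" "\<beta> < 1 / \<alpha>" using alpha_pos by (auto simp: \<beta>_def divide_simps)
  obtain x0 K where x0: "x0 \<ge> 1" "K > 0"
    and K: "\<And>x y. x \<ge> x0 \<Longrightarrow> y \<ge> x \<Longrightarrow> (y / x) powr \<beta> \<le> K * (A y / A x)"
    using potter_lower[OF b(2)] by blast
  have p: "A x0 > 0" "0 < x0" using x0 by (auto intro: A_pos)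
  have "filterlim (\<lambda>y. (A x0 / K) * (y / x0) powr \<beta>) at_top at_top"
  proof (rule filterlim_tendsto_pos_mult_at_top[OF tendsto_const])
    show "A x0 / K > 0" using p x0 by simp
    have "filterlim (\<lambda>y. y / x0) at_top at_top" using p(2) by real_asymp
    moreover have "filterlim (\<lambda>y. y powr \<beta>) at_top at_top" using b(1) by real_asymp
    ultimately show "filterlim (\<lambda>y. (y / x0) powr \<beta>) at_top at_top"
      by (rule filterlim_compose[rotated])
  qed
  then show ?thesis
  proof (rule filterlim_at_top_mono)
    show "\<forall>\<^sub>F y in at_top. A x0 / K * (y / x0) powr \<beta> \<le> A y"
      using eventually_ge_at_top[of x0]
    proof eventually_elim
      case (elim y)
      then show ?case using K[of x0 y] p x0 by (simp add: field_simps)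
    qed
  qed
qed

abbreviation "T \<equiv> tail_sup \<alpha> l1"

lemma tail_set_nonempty: "\<exists>t. 0 < t \<and> t \<le> 1 \<and> A (1 / t) > x"
proof -
  have "\<forall>\<^sub>F y in at_top. A y > x" using A_at_top by (simp add: filterlim_at_top_dense)
  moreover have "\<forall>\<^sub>F y in at_top. y \<ge> (1::real)" by (rule eventually_ge_at_top)
  ultimately have "\<forall>\<^sub>F y in at_top. A y > x \<and> y \<ge> 1" by eventually_elim simp
  then obtain y where "A y > x" "y \<ge> 1" by (auto simp: eventually_at_top_linorder)
  then show ?thesis by (intro exI[of _ "1 / y"]) auto
qed

lemma tail_set_bdd: "bdd_above {t. 0 < t \<and> t \<le> 1 \<and> A (1 / t) > x}"
  by (rule bdd_aboveI[of _ 1]) auto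

lemma tail_sup_ge: "0 < t \<Longrightarrow> t \<le> 1 \<Longrightarrow> A (1 / t) > x \<Longrightarrow> t \<le> T x"
  unfolding tail_sup_def by (rule cSup_upper[OF _ tail_set_bdd]) auto

lemma tail_sup_pos: "T x > 0"
proof -
  obtain t where "0 < t" "t \<le> 1" "A (1 / t) > x" using tail_set_nonempty[of x] by auto
  then show ?thesis using tail_sup_ge[of t x] by simp
qed

lemma tail_sup_le:
  assumes "\<And>t. 0 < t \<Longrightarrow> t \<le> 1 \<Longrightarrow> A (1 / t) > x \<Longrightarrow> t \<le> b"
  shows "T x \<le> b"
  unfolding tail_sup_def using tail_set_nonempty[of x] assms by (intro cSup_least) auto

lemma tail_sup_antimono: "x \<le> y \<Longrightarrow> T y \<le> T x"
  by (rule tail_sup_le) (auto intro!: tail_sup_ge)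

text \<open>The generalized inverse of a regularly varying function of index 1/\<alpha> has index
  -\<alpha>. The hypothesis \<open>T0\<close> is genuine: slow variation lets A be unbounded on a
  compact set, and then the supremum is not governed by large arguments.\<close>

lemma tail_sup_asymp:
  assumes T0: "(T \<longlongrightarrow> 0) at_top" and y: "filterlim y at_top F" and z: "z > 0"
  shows "((\<lambda>i. y i * T (A (y i) * z)) \<longlongrightarrow> z powr (- \<alpha>)) F"
proof (rule order_tendstoI)
  have Ay: "filterlim (\<lambda>i. A (y i) * z) at_top F"
    by (rule filterlim_at_top_mult_tendsto_pos[OF tendsto_const z filterlim_compose[OF A_at_top y]])
  fix r assume r: "z powr (- \<alpha>) < r"
  obtain r' where r': "z powr (- \<alpha>) < r'" "r' < r" using dense[OF r] by blast
  have r'0: "r' > 0" using r'(1) powr_ge_zero[of z "-\<alpha>"] by linarith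
  define w' where "w' = - ln r'"
  have "ln (z powr (- \<alpha>)) < ln r'" using r' z by (subst ln_less_cancel_iff) (auto simp: r'0)
  then have w': "w' / \<alpha> < ln z" using z alpha_pos by (simp add: w'_def ln_powr field_simps)
  \<comment> \<open>The first term makes w / \<alpha> + \<epsilon> * |w| nondecreasing in w, so that
    w \<le> w' can be used; the second leaves room below ln z.\<close>
  define \<epsilon> where "\<epsilon> = min (1 / (2 * \<alpha>)) ((ln z - w' / \<alpha>) / (2 * (1 + \<bar>w'\<bar>)))"
  have eps: "\<epsilon> > 0" using w' alpha_pos by (simp add: \<epsilon>_def add_pos_nonneg)
  have eps2: "\<epsilon> \<le> 1 / \<alpha>"
  proof -
    have "1 / (2 * \<alpha>) \<le> 1 / \<alpha>" using alpha_pos by (simp add: field_simps)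
    then show ?thesis by (simp add: \<epsilon>_def min_le_iff_disj)
  qed
  have eps3: "w' / \<alpha> + \<epsilon> * (1 + \<bar>w'\<bar>) < ln z"
  proof -
    have p: "1 + \<bar>w'\<bar> > 0" by simp
    have "\<epsilon> * (1 + \<bar>w'\<bar>) \<le> (ln z - w' / \<alpha>) / (2 * (1 + \<bar>w'\<bar>)) * (1 + \<bar>w'\<bar>)"
      by (intro mult_right_mono) (auto simp: \<epsilon>_def)
    also have "\<dots> = (ln z - w' / \<alpha>) / 2" using p by (simp add: field_simps)
    finally have 1: "\<epsilon> * (1 + \<bar>w'\<bar>) \<le> (ln z - w' / \<alpha>) / 2" .
    have "W + E < L" if "E \<le> (L - W) / 2" "W < L" for E L W :: real using that by (simp add: field_simps)
    from this[OF 1 w'] show ?thesis .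
  qed
  obtain x0 where x0: "x0 \<ge> 1"
    "\<And>x y. x \<ge> x0 \<Longrightarrow> y \<ge> x0 \<Longrightarrow> \<bar>ln (A y) - ln (A x) - (ln y - ln x) / \<alpha>\<bar> \<le> \<epsilon> * (1 + \<bar>ln y - ln x\<bar>)"
    using A_log[OF eps] by blast
  have "\<forall>\<^sub>F i in F. T (A (y i) * z) < 1 / x0"
    using filterlim_compose[OF T0 Ay] x0(1) by (intro order_tendstoD) auto
  moreover have "\<forall>\<^sub>F i in F. y i \<ge> x0" using y by (simp add: filterlim_at_top)
  ultimately show "\<forall>\<^sub>F i in F. y i * T (A (y i) * z) < r"
  proof eventually_elim
    case (elim i)
    have yi: "y i > 0" using elim x0(1) by linarith
    have "T (A (y i) * z) \<le> r' / y i"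
    proof (rule tail_sup_le, rule ccontr)
      fix t assume t: "0 < t" "t \<le> 1" "A (1 / t) > A (y i) * z" and "\<not> t \<le> r' / y i"
      then have t2: "r' / y i < t" by simp
      \<comment> \<open>Here \<open>T0\<close> acts: every competitor t is small, so 1 / t lies in
        the range of the logarithmic bound.\<close>
      have "t < 1 / x0" using tail_sup_ge[OF t] elim(1) by linarith
      then have s: "1 / t \<ge> x0" using t(1) x0(1) by (simp add: field_simps)
      define w where "w = ln (1 / t) - ln (y i)"
      have "ln (r' / y i) < ln t" using t2 r'0 yi t(1) by (subst ln_less_cancel_iff) auto
      then have w: "w \<le> w'" using r'0 yi t(1) by (simp add: w_def w'_def ln_div)
      have Ap: "A (y i) > 0" "A (1 / t) > 0" using elim(2) s x0(1) by (auto intro!: A_pos)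
      have "ln (A (1 / t)) - ln (A (y i)) \<le> w / \<alpha> + \<epsilon> * (1 + \<bar>w\<bar>)"
        using x0(2)[OF elim(2) s] by (simp add: w_def)
      also have "\<dots> \<le> w' / \<alpha> + \<epsilon> * (1 + \<bar>w'\<bar>)"
      proof -
        have "\<epsilon> * (\<bar>w\<bar> - \<bar>w'\<bar>) \<le> \<epsilon> * (w' - w)" using eps w by (intro mult_left_mono) auto
        also have "\<dots> \<le> (1 / \<alpha>) * (w' - w)" using eps2 w by (intro mult_right_mono) auto
        finally show ?thesis by (simp add: algebra_simps diff_divide_distrib)
      qed
      also have "\<dots> < ln z" by (rule eps3)
      finally have "ln (A (1 / t)) < ln (A (y i) * z)" using Ap z by (simp add: ln_mult)
      then show False using t(3) Ap z by (simp add: )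
    qed
    then have "y i * T (A (y i) * z) \<le> r'" using yi by (simp add: field_simps)
    then show ?case using r' by simp
  qed
next
  fix r assume r: "r < z powr (- \<alpha>)"
  have "max r 0 < z powr (- \<alpha>)" using r z by simp
  then obtain r' where r': "max r 0 < r'" "r' < z powr (- \<alpha>)" using dense by blast
  have r'0: "r' > 0" using r' by simp
  \<comment> \<open>The competitor is t = r' / y i: since r' < z powr (-\<alpha>), the ratio of A (y
    i / r') to A (y i) has a limit above z.\<close>
  have "filterlim (\<lambda>i. y i / r') at_top F"
    using filterlim_at_top_mult_tendsto_pos[OF tendsto_const[of "1 / r'"] _ y] r'0 by simp
  moreover have "((\<lambda>i. (y i / r') / y i) \<longlongrightarrow> 1 / r') F"
  proof (rule Lim_transform_eventually[OF tendsto_const])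
    show "\<forall>\<^sub>F i in F. 1 / r' = y i / r' / y i"
      using filterlim_at_top_dense[THEN iffD1, OF y, rule_format, of 0] by eventually_elim simp
  qed
  ultimately have "((\<lambda>i. A (y i / r') / A (y i)) \<longlongrightarrow> (1 / r') powr (1 / \<alpha>)) F"
    using r'0 by (intro A_ratio_tendsto y) auto
  moreover have "z < (1 / r') powr (1 / \<alpha>)"
  proof -
    have "z powr \<alpha> < 1 / r'" using r'(2) r'0 z by (simp add: powr_minus field_simps)
    then have "(z powr \<alpha>) powr (1 / \<alpha>) < (1 / r') powr (1 / \<alpha>)"
      using alpha_pos by (intro powr_less_mono2) auto
    then show ?thesis using z alpha_pos by (simp add: powr_powr)
  qed
  ultimately have "\<forall>\<^sub>F i in F. A (y i / r') / A (y i) > z" by (rule order_tendstoD)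
  moreover have "\<forall>\<^sub>F i in F. y i \<ge> max 1 r'"
    using y unfolding filterlim_at_top by blast
  ultimately show "\<forall>\<^sub>F i in F. r < y i * T (A (y i) * z)"
  proof eventually_elim
    case (elim i)
    have "A (y i) > 0" using elim by (intro A_pos) simp
    then have "r' / y i \<le> T (A (y i) * z)"
      using elim r'0 by (intro tail_sup_ge) (auto simp: field_simps)
    then have "r' \<le> y i * T (A (y i) * z)" using elim by (simp add: field_simps)
    then show ?case using r' by simp
  qed
qed

end

section \<open>The geometric subsequence and log-periodic profiles\<close>

locale geometric_norming = regular_norming +
  fixes c :: real and k :: "nat \<Rightarrow> nat"
  assumes c: "c > 1" and k: "k 0 = 0" "strict_mono k"
    and k_ratio: "(\<lambda>n. real (k (n + 1)) / real (k n)) \<longlonglongrightarrow> c"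
begin

abbreviation "a n \<equiv> A (real (k n))"
abbreviation "C \<equiv> c powr (1 / \<alpha>)"

lemma C_gt_1: "C > 1" using c alpha_pos by simp

lemma C_pos: "C > 0" using C_gt_1 by linarith

lemma k_pos: "n \<ge> 1 \<Longrightarrow> k n \<ge> 1"
  using k strict_monoD[OF k(2), of 0 n] by simp

lemma k_at_top: "filterlim (\<lambda>n. real (k n)) at_top sequentially"
  using filterlim_compose[OF filterlim_real_sequentially filterlim_subseq[OF k(2)]] .

lemma a_pos: "n \<ge> 1 \<Longrightarrow> a n > 0"
  using k_pos[of n] by (intro A_pos) simp

lemma a_at_top: "filterlim a at_top sequentially"
  by (rule filterlim_compose[OF A_at_top k_at_top])

lemma k_ratio_power: "(\<lambda>m. real (k (m + q)) / real (k m)) \<longlonglongrightarrow> c ^ q"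
proof (induction q)
  case 0
  have "\<forall>\<^sub>F m in sequentially. real (k (m + 0)) / real (k m) = 1"
    using eventually_ge_at_top[of 1] by eventually_elim (use k_pos in force)
  then show ?case unfolding power_0 by (rule tendsto_eventually)
next
  case (Suc q)
  have "(\<lambda>m. real (k (m + q + 1)) / real (k (m + q))) \<longlonglongrightarrow> c"
    using LIMSEQ_ignore_initial_segment[OF k_ratio, of q] by simp
  from tendsto_mult[OF this Suc.IH]
  have "(\<lambda>m. real (k (m + q + 1)) / real (k (m + q)) * (real (k (m + q)) / real (k m))) \<longlonglongrightarrow> c ^ Suc q" by simp
  moreover have "\<forall>\<^sub>F m in sequentially. real (k (m + q + 1)) / real (k (m + q)) * (real (k (m + q)) / real (k m)) = real (k (m + Suc q)) / real (k m)"
    using eventually_ge_at_top[of 1]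
  proof eventually_elim
    case (elim m)
    then show ?case using k_pos[of "m + q"] by simp
  qed
  ultimately show ?case by (rule Lim_transform_eventually)
qed

lemma a_ratio: "(\<lambda>m. a (m + p) / a (m + q)) \<longlonglongrightarrow> C ^ p / C ^ q"
proof -
  have 1: "(\<lambda>m. a (m + q) / a m) \<longlonglongrightarrow> C ^ q" for q
  proof -
    have "filterlim (\<lambda>m. real (k (m + q))) at_top sequentially"
      using filterlim_compose[OF k_at_top filterlim_add_const_nat_at_top[of q]] .
    then have "(\<lambda>m. a (m + q) / a m) \<longlonglongrightarrow> (c ^ q) powr (1 / \<alpha>)"
      using k_ratio_power c by (intro A_ratio_tendsto k_at_top) auto
    also have "(c ^ q) powr (1 / \<alpha>) = C ^ q"
      using c by (simp add: powr_realpow[symmetric] powr_powr mult.commute)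
    finally show ?thesis .
  qed
  have "(\<lambda>m. (a (m + p) / a m) / (a (m + q) / a m)) \<longlonglongrightarrow> C ^ p / C ^ q"
    using c by (intro tendsto_divide 1) auto
  moreover have "\<forall>\<^sub>F m in sequentially. (a (m + p) / a m) / (a (m + q) / a m) = a (m + p) / a (m + q)"
    using eventually_ge_at_top[of 1]
  proof eventually_elim
    case (elim m)
    then show ?case using a_pos[of m] by simp
  qed
  ultimately show ?thesis by (rule Lim_transform_eventually)
qed

text \<open>A need not be monotone, but along \<open>k\<close> it eventually increases because
  consecutive ratios tend to C > 1. Beyond the maximum of the initial values only indices from the
  increasing range qualify, so the definite description denotes.\<close>

lemma rel_position_eq:
  "\<exists>X0. \<forall>x\<ge>X0. \<forall>n\<ge>1. a n \<le> x \<and> x < a (n + 1) \<longrightarrow> rel_position A k x = x / a n"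
proof -
  have "(\<lambda>m. a (m + 1) / a (m + 0)) \<longlonglongrightarrow> C ^ 1 / C ^ 0" by (rule a_ratio)
  then have "\<forall>\<^sub>F m in sequentially. a (m + 1) / a m > 1"
    using C_gt_1 by (intro order_tendstoD) auto
  moreover have "\<forall>\<^sub>F m in sequentially. m \<ge> (1::nat)" by (rule eventually_ge_at_top)
  ultimately have "\<forall>\<^sub>F m in sequentially. a m < a (Suc m)"
  proof eventually_elim
    case (elim m)
    then show ?case using a_pos[of m] by (simp add: field_simps)
  qed
  then obtain N where N: "\<And>m. m \<ge> N \<Longrightarrow> a m < a (Suc m)" by (auto simp: eventually_sequentially)
  have mono: "a i \<le> a j" if "N \<le> i" "i \<le> j" for i j
    using that(2,1) by (induction rule: dec_induct) (auto intro: order_trans[OF _ less_imp_le[OF N]])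
  define X0 where "X0 = Max (a ` {..N + 1}) + 1"
  have X0: "a j < X0" if "j \<le> N + 1" for j
  proof -
    have "a j \<le> Max (a ` {..N + 1})" using that by (intro Max_ge) auto
    then show ?thesis by (simp add: X0_def)
  qed
  have big: "n > N" if "x \<ge> X0" "x < a (n + 1)" for x n
    using that X0[of "n + 1"] by (cases "n \<le> N") auto
  show ?thesis
  proof (intro exI[of _ X0] allI impI)
    fix x n assume x: "X0 \<le> x" and n: "1 \<le> n" "a n \<le> x \<and> x < a (n + 1)"
    have "(THE n. n \<ge> 1 \<and> a n \<le> x \<and> x < a (n + 1)) = n"
    proof (rule the_equality)
      fix n' assume n': "n' \<ge> 1 \<and> a n' \<le> x \<and> x < a (n' + 1)"
      have "N < n" "N < n'" using big x n n' by auto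
      then show "n' = n"
        using mono[of "n + 1" n'] mono[of "n' + 1" n] n n' by (cases n n' rule: linorder_cases) auto
    qed (use n in auto)
    then show "rel_position A k x = x / a n" by (simp add: rel_position_def)
  qed
qed

text \<open>At a power C^i the point a m * z is asymptotic to a (m + i) and may fall into either of
  two neighbouring blocks; such points are set aside together with the jumps of
  \<open>M\<close>.\<close>

definition regular_point :: "(real \<Rightarrow> real) \<Rightarrow> real \<Rightarrow> bool" where
  "regular_point M z \<longleftrightarrow> z > 0 \<and> isCont M z \<and> (\<forall>i::int. z \<noteq> C powr i)"

text \<open>\<open>C ^ p / C ^ q\<close> stands for an arbitrary integer power of the multiplicative
  period.\<close>

lemma profile_scale:
  assumes per: "\<And>x. x > 0 \<Longrightarrow> M (C * x) = M x" and x: "x > 0"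
  shows "M (C ^ p / C ^ q * x) = M x"
proof -
  have up: "M (C ^ n * y) = M y" if "y > 0" for n y
    using that
  proof (induction n arbitrary: y)
    case (Suc n)
    have "M (C ^ Suc n * y) = M (C ^ n * (C * y))" by (simp add: mult_ac)
    also have "\<dots> = M (C * y)" using Suc c by (intro Suc.IH) simp
    finally show ?case using per[OF Suc.prems] by simp
  qed simp
  have "M (C ^ p / C ^ q * x) = M (C ^ q * (C ^ p / C ^ q * x))"
    using x c by (intro up[symmetric]) simp
  also have "C ^ q * (C ^ p / C ^ q * x) = C ^ p * x" using c by simp
  finally show ?thesis using up[OF x] by simp
qed

text \<open>If C^i < z < C^(i + 1), then a m * z eventually lies between a (m + i) and a (m + i +
  1), its relative position tends to z / C^i, and periodicity removes the power of C. As i may be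
  negative, the sequence is shifted by the negative part \<open>p\<close> of i, and the shift is
  undone at the end.\<close>

lemma profile_at_rel_position:
  assumes per: "\<And>x. x > 0 \<Longrightarrow> M (C * x) = M x" and z: "regular_point M z"
  shows "(\<lambda>m. M (rel_position A k (a m * z))) \<longlonglongrightarrow> M z"
proof -
  have z0: "z > 0" using z by (simp add: regular_point_def)
  define i where "i = \<lfloor>log C z\<rfloor>"
  define p where "p = nat (- i)"
  define q where "q = nat i"
  have Cpq: "C ^ q / C ^ p = C powr i"
  proof (cases "i \<ge> 0")
    case True
    then show ?thesis using C_gt_1 powr_realpow[OF C_pos, of "nat i"] by (simp add: p_def q_def)
  next
    case False
    then have "C ^ q / C ^ p = inverse (C powr (- real_of_int i))"
      using C_gt_1 powr_realpow[OF C_pos, of "nat (- i)"]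
      by (simp add: p_def q_def divide_inverse)
    then show ?thesis using C_gt_1 by (simp add: powr_minus)
  qed
  have "C powr i \<le> z" "z < C powr (i + 1)"
    using z0 C_gt_1 by (auto simp: i_def powr_le_iff less_powr_iff)
  moreover have "z \<noteq> C powr i" using z by (simp add: regular_point_def)
  ultimately have "C powr i < z" by linarith
  then have lo: "C ^ q / C ^ p < z" by (simp only: Cpq)
  have "C powr 1 = C" using C_pos by (intro powr_one) simp
  then have "C powr (real_of_int i + 1) = C * (C ^ q / C ^ p)"
    unfolding Cpq powr_add by (simp only: mult.commute)
  then have hi: "z < C ^ (q + 1) / C ^ p" using \<open>z < C powr (i + 1)\<close> by (simp only: of_int_add of_int_1) simp
  obtain X0 where X0: "\<And>x n. x \<ge> X0 \<Longrightarrow> n \<ge> 1 \<Longrightarrow> a n \<le> x \<Longrightarrow> x < a (n + 1) \<Longrightarrow> rel_position A k x = x / a n"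
    using rel_position_eq by blast
  have shift: "filterlim (\<lambda>m. m + j) at_top sequentially" for j :: nat by (rule filterlim_add_const_nat_at_top)
  have "\<forall>\<^sub>F m in sequentially. a (m + q) / a (m + p) < z"
    using a_ratio[of q p] lo by (rule order_tendstoD)
  moreover have "\<forall>\<^sub>F m in sequentially. z < a (m + (q + 1)) / a (m + p)"
    using a_ratio[of "q + 1" p] hi by (rule order_tendstoD)
  moreover have "\<forall>\<^sub>F m in sequentially. a (m + p) \<ge> X0 / z"
    using filterlim_compose[OF a_at_top shift[of p]] by (simp add: filterlim_at_top)
  moreover have "\<forall>\<^sub>F m in sequentially. m \<ge> (1::nat)" by (rule eventually_ge_at_top)
  ultimately have ev: "\<forall>\<^sub>F m in sequentially. a (m + p) / a (m + q) * z = rel_position A k (a (m + p) * z)"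
  proof eventually_elim
    case (elim m)
    have p: "a (m + p) > 0" using elim by (intro a_pos) simp
    have "rel_position A k (a (m + p) * z) = a (m + p) * z / a (m + q)"
    proof (rule X0)
      show "X0 \<le> a (m + p) * z" using elim(3) z0 by (simp add: field_simps)
      show "a (m + q) \<le> a (m + p) * z" using elim(1) p by (simp add: field_simps)
      show "a (m + p) * z < a (m + q + 1)" using elim(2) p by (simp add: field_simps)
    qed (use elim in auto)
    then show ?case by simp
  qed
  have cont: "isCont M (C ^ p / C ^ q * z)"
  proof -
    have "isCont (\<lambda>x. M (C ^ q / C ^ p * x)) (C ^ p / C ^ q * z)"
    proof (rule isCont_o2[where g=M])
      have "C ^ q / C ^ p * (C ^ p / C ^ q * z) = z" using c by simp
      then show "isCont M (C ^ q / C ^ p * (C ^ p / C ^ q * z))"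
        using z by (simp only: regular_point_def)
    qed (intro continuous_intros)
    moreover have "\<forall>\<^sub>F x in nhds (C ^ p / C ^ q * z). M (C ^ q / C ^ p * x) = M x"
    proof -
      have "C ^ p / C ^ q * z > 0" using z0 C_pos by (intro mult_pos_pos divide_pos_pos zero_less_power)
      then have "\<forall>\<^sub>F x in nhds (C ^ p / C ^ q * z). x \<in> {0<..}"
        by (intro eventually_nhds_in_open) auto
      then show ?thesis by (rule eventually_mono) (intro profile_scale per, auto)
    qed
    ultimately show ?thesis by (simp add: isCont_cong)
  qed
  have "(\<lambda>m. a (m + p) / a (m + q) * z) \<longlonglongrightarrow> C ^ p / C ^ q * z"
    by (intro tendsto_intros a_ratio)
  then have "(\<lambda>m. M (a (m + p) / a (m + q) * z)) \<longlonglongrightarrow> M (C ^ p / C ^ q * z)"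
    by (rule isCont_tendsto_compose[OF cont])
  then have "(\<lambda>m. M (a (m + p) / a (m + q) * z)) \<longlonglongrightarrow> M z"
    using profile_scale[of M z p q] per z0 by simp
  moreover have "\<forall>\<^sub>F m in sequentially. M (a (m + p) / a (m + q) * z) = M (rel_position A k (a (m + p) * z))"
    using ev by eventually_elim simp
  ultimately have "(\<lambda>m. M (rel_position A k (a (m + p) * z))) \<longlonglongrightarrow> M z"
    by (rule Lim_transform_eventually)
  then show ?thesis by (rule LIMSEQ_offset)
qed

lemma regular_points_dense:
  assumes am: "antimono_on {0<..} (\<lambda>x. M x * x powr (- \<alpha>))" and uv: "0 \<le> u" "u < v"
  shows "\<exists>z. u < z \<and> z < v \<and> regular_point M z"
proof -
  have "countable {x\<in>{0<..}. \<not> isCont M x}" using am by (rule countable_discontinuities)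
  then have "countable ({x\<in>{0<..}. \<not> isCont M x} \<union> range (\<lambda>i::int. C powr i))"
    by auto
  from open_minus_countable[OF this, of "{u<..<v}"] uv
  obtain z where "z \<in> {u<..<v}" "z \<notin> {x\<in>{0<..}. \<not> isCont M x} \<union> range (\<lambda>i::int. C powr i)" by auto
  then show ?thesis using uv by (intro exI[of _ z]) (auto simp: regular_point_def)
qed

end

section \<open>Convergence of the tails\<close>

context geometric_norming
begin

definition block :: "nat \<Rightarrow> nat" where
  "block n = (THE m. m \<ge> 1 \<and> k (m - 1) < n \<and> n \<le> k m)"

lemma block:
  assumes "n \<ge> 1"
  shows "block n \<ge> 1" "k (block n - 1) < n" "n \<le> k (block n)"
proof -
  have ex: "\<exists>m. n \<le> k m" using seq_suble[OF k(2), of n] by blast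
  define m where "m = (LEAST m. n \<le> k m)"
  have m: "n \<le> k m" unfolding m_def using ex by (rule LeastI_ex)
  have m0: "m \<ge> 1" using m assms k(1) by (cases m) auto
  have m': "k (m - 1) < n" using not_less_Least[of "m - 1" "\<lambda>m. n \<le> k m"] m0 by (simp add: m_def not_le)
  have "block n = m"
    unfolding block_def
  proof (rule the_equality)
    fix j assume j: "j \<ge> 1 \<and> k (j - 1) < n \<and> n \<le> k j"
    have "m \<le> j" unfolding m_def using j by (intro Least_le) auto
    moreover have "\<not> m < j"
    proof
      assume "m < j"
      then have "m \<le> j - 1" by simp
      then have "k m \<le> k (j - 1)" using k(2) by (simp add: strict_mono_less_eq)
      then show False using j m by simp
    qed
    ultimately show "j = m" by simp
  qed (use m m0 m' in auto)
  then show "block n \<ge> 1" "k (block n - 1) < n" "n \<le> k (block n)" using m m0 m' by auto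
qed

lemma position_param_eq: "position_param k n = real n / real (k (block n))"
  by (simp add: position_param_def block_def)

lemma block_at_top: "filterlim block at_top sequentially"
  unfolding filterlim_at_top
proof safe
  fix Z
  show "\<forall>\<^sub>F n in sequentially. Z \<le> block n"
    using eventually_gt_at_top[of "k Z"] eventually_ge_at_top[of 1]
  proof eventually_elim
    case (elim n)
    then have "k Z < k (block n)" using block(3)[of n] by simp
    then show ?case using k(2) by (simp add: strict_mono_less)
  qed
qed

lemma position_param_pos: "n \<ge> 1 \<Longrightarrow> position_param k n > 0"
  using block[of n] k_pos[of "block n"] by (simp add: position_param_eq)

lemma position_param_le_1: "n \<ge> 1 \<Longrightarrow> position_param k n \<le> 1"
  using block[of n] k_pos[of "block n"] by (simp add: position_param_eq field_simps)

text \<open>For n in the block ending at k (m + 1) the parameter exceeds k m / k (m + 1), whose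
  limit is 1 / c; half of that limit is a safe bound.\<close>

lemma position_param_lower: "\<forall>\<^sub>F n in sequentially. position_param k n \<ge> 1 / (2 * c)"
proof -
  have "\<forall>\<^sub>F m in sequentially. real (k (m + 1)) / real (k m) < 2 * c"
    using k_ratio c by (intro order_tendstoD) auto
  then obtain N where N: "\<And>m. m \<ge> N \<Longrightarrow> real (k (m + 1)) / real (k m) < 2 * c"
    by (auto simp: eventually_sequentially)
  have "\<forall>\<^sub>F n in sequentially. block n \<ge> N + 2" using block_at_top by (simp add: filterlim_at_top)
  then show ?thesis using eventually_ge_at_top[of 1]
  proof eventually_elim
    case (elim n)
    define m where "m = block n - 1"
    have m: "m \<ge> N" "m \<ge> 1" "block n = m + 1" using elim by (auto simp: m_def)
    have km: "real (k m) > 0" "real (k (m + 1)) > 0" using k_pos[of m] k_pos[of "m + 1"] m by auto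
    have "real (k (m + 1)) < 2 * c * real (k m)" using N[OF m(1)] km by (simp add: field_simps)
    also have "\<dots> \<le> 2 * c * real n" using block(2)[of n] elim c m by simp
    finally show ?case using km c m by (simp add: position_param_eq field_simps)
  qed
qed

lemma position_param_subseq:
  assumes s: "filterlim s at_top sequentially"
  obtains r \<nu> where "strict_mono (r :: nat \<Rightarrow> nat)" "\<nu> > 0" "(\<lambda>i. position_param k (s (r i))) \<longlonglongrightarrow> \<nu>"
proof -
  have ev1: "\<forall>\<^sub>F i in sequentially. s i \<ge> 1" using s by (simp add: filterlim_at_top)
  have ev2: "\<forall>\<^sub>F i in sequentially. position_param k (s i) \<ge> 1 / (2 * c)"
    using eventually_compose_filterlim[OF position_param_lower s] .
  obtain N where N: "\<And>i. i \<ge> N \<Longrightarrow> s i \<ge> 1 \<and> position_param k (s i) \<ge> 1 / (2 * c)"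
    using eventually_conj[OF ev1 ev2] by (auto simp: eventually_sequentially)
  define f where "f i = position_param k (s (i + N))" for i
  have f: "f i \<in> {1 / (2 * c)..1}" for i
    using N[of "i + N"] position_param_le_1 by (auto simp: f_def)
  have "seq_compact {1 / (2 * c)..1::real}" using compact_Icc compact_imp_seq_compact by blast
  then obtain \<nu> r where r: "\<nu> \<in> {1 / (2 * c)..1}" "strict_mono r" "(f \<circ> r) \<longlonglongrightarrow> \<nu>"
    using f unfolding seq_compact_def by blast
  show ?thesis
  proof (rule that)
    show "strict_mono (\<lambda>i. r i + N)" using r(2) by (simp add: strict_mono_def)
    have "1 / (2 * c) > 0" using c by simp
    then show "\<nu> > 0" using r(1) by (simp only: atLeastAtMost_iff) linarith
    show "(\<lambda>i. position_param k (s (r i + N))) \<longlonglongrightarrow> \<nu>" using r(3) by (simp add: f_def comp_def)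
  qed
qed

text \<open>Being monotone, T either vanishes at infinity or stays above some \<tau> > 0. The latter
  would keep \<open>H\<close> away from 0 along a m * z for a regular point z, since
  \<open>M\<close> is positive there. Slow variation of \<open>l1\<close> alone would not exclude
  it.\<close>

lemma tail_sup_tendsto_0:
  assumes H0: "(H \<longlongrightarrow> 0) at_top"
    and per: "\<And>x. x > 0 \<Longrightarrow> M (C * x) = M x" and am: "antimono_on {0<..} (\<lambda>x. M x * x powr (- \<alpha>))"
    and pos: "\<And>x. x > 0 \<Longrightarrow> M x > 0"
    and H: "\<forall>\<^sub>F x in at_top. H x = T x * (M (rel_position A k x) + h x)"
    and h: "\<And>x. x > 0 \<Longrightarrow> isCont M x \<Longrightarrow> (\<lambda>n. h (a n * x)) \<longlonglongrightarrow> 0"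
  shows "(T \<longlongrightarrow> 0) at_top"
proof -
  have "\<exists>x. T x < \<tau>" if tau: "\<tau> > 0" for \<tau>
  proof (rule ccontr)
    assume "\<nexists>x. T x < \<tau>"
    then have T: "T x \<ge> \<tau>" for x by (simp add: not_less)
    obtain z where z: "regular_point M z" using regular_points_dense[OF am, of 0 1] by auto
    then have z0: "z > 0" "isCont M z" by (auto simp: regular_point_def)
    have az: "filterlim (\<lambda>m. a m * z) at_top sequentially"
      by (rule filterlim_at_top_mult_tendsto_pos[OF tendsto_const z0(1) a_at_top])
    have "(\<lambda>m. M (rel_position A k (a m * z)) + h (a m * z)) \<longlonglongrightarrow> M z + 0"
      by (intro tendsto_add profile_at_rel_position per z h z0)
    then have "\<forall>\<^sub>F m in sequentially. M (rel_position A k (a m * z)) + h (a m * z) > M z / 2"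
      using pos[OF z0(1)] by (intro order_tendstoD) auto
    moreover have "\<forall>\<^sub>F m in sequentially. H (a m * z) = T (a m * z) * (M (rel_position A k (a m * z)) + h (a m * z))"
      using eventually_compose_filterlim[OF H az] .
    ultimately have "\<forall>\<^sub>F m in sequentially. H (a m * z) \<ge> \<tau> * (M z / 2)"
    proof eventually_elim
      case (elim m)
      have "\<tau> * (M z / 2) \<le> T (a m * z) * (M (rel_position A k (a m * z)) + h (a m * z))"
        using T tau elim(1) pos[OF z0(1)] tail_sup_pos[of "a m * z"] by (intro mult_mono) auto
      then show ?case using elim by simp
    qed
    moreover have "(\<lambda>m. H (a m * z)) \<longlonglongrightarrow> 0" using filterlim_compose[OF H0 az] .
    ultimately have "\<tau> * (M z / 2) \<le> 0" by (intro tendsto_lowerbound) auto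
    then show False using tau pos[OF z0(1)] by (simp add: mult_le_0_iff)
  qed
  then show ?thesis
  proof (intro order_tendstoI)
    fix y :: real assume "0 < y" "\<And>\<tau>. 0 < \<tau> \<Longrightarrow> \<exists>x. T x < \<tau>"
    then obtain x where "T x < y" by blast
    then have "\<forall>x'\<ge>x. T x' < y" using tail_sup_antimono le_less_trans by blast
    then show "\<forall>\<^sub>F x in at_top. T x < y" by (auto simp: eventually_at_top_linorder)
  next
    fix y :: real assume "y < 0"
    then show "\<forall>\<^sub>F x in at_top. y < T x" using tail_sup_pos less_trans by (intro always_eventually allI) blast
  qed
qed

end

text \<open>The tail \<open>H\<close> is abstract so that the right tail and the reflected left tail
  are two instances of one argument.\<close>

locale profile_tail = geometric_norming +
  fixes M h H :: "real \<Rightarrow> real"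
  assumes T0: "(tail_sup \<alpha> l1 \<longlongrightarrow> 0) at_top"
    and per: "\<And>x. x > 0 \<Longrightarrow> M (C * x) = M x"
    and M_antimono: "antimono_on {0<..} (\<lambda>x. M x * x powr (- \<alpha>))"
    and H_antimono: "antimono H"
    and H_eq: "\<forall>\<^sub>F x in at_top. H x = tail_sup \<alpha> l1 x * (M (rel_position A k x) + h x)"
    and h_lim: "\<And>x. x > 0 \<Longrightarrow> isCont M x \<Longrightarrow> (\<lambda>n. h (A (real (k n)) * x)) \<longlonglongrightarrow> 0"
begin

lemma tail_at_regular_point:
  assumes z: "regular_point M z"
  shows "(\<lambda>m. real (k m) * H (a m * z)) \<longlonglongrightarrow> z powr (- \<alpha>) * M z"
proof -
  have z0: "z > 0" "isCont M z" using z by (auto simp: regular_point_def)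
  have az: "filterlim (\<lambda>m. a m * z) at_top sequentially"
    by (rule filterlim_at_top_mult_tendsto_pos[OF tendsto_const z0(1) a_at_top])
  have "(\<lambda>m. (real (k m) * T (a m * z)) * (M (rel_position A k (a m * z)) + h (a m * z))) \<longlonglongrightarrow> z powr (- \<alpha>) * (M z + 0)"
    by (intro tendsto_mult tendsto_add profile_at_rel_position per z h_lim z0 tail_sup_asymp T0 k_at_top)
  moreover have "\<forall>\<^sub>F m in sequentially. (real (k m) * T (a m * z)) * (M (rel_position A k (a m * z)) + h (a m * z)) = real (k m) * H (a m * z)"
    using eventually_compose_filterlim[OF H_eq az] by eventually_elim simp
  ultimately show ?thesis using Lim_transform_eventually by fastforce
qed

text \<open>Measured in units of a (m i), the point A (n i) * y tends to z = \<nu>^(1/\<alpha>) * y.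
  Regular points on either side of z, where the limit along \<open>a\<close> is known, sandwich the
  monotone tail, and continuity of x powr (-\<alpha>) * M x at z closes the gap.\<close>

lemma tail_tendsto:
  fixes n m :: "nat \<Rightarrow> nat"
  assumes n: "filterlim n at_top sequentially" and m: "filterlim m at_top sequentially"
    and lam: "(\<lambda>i. real (n i) / real (k (m i))) \<longlonglongrightarrow> \<nu>" "\<nu> > 0"
    and y: "y > 0" "isCont M (\<nu> powr (1 / \<alpha>) * y)"
  shows "(\<lambda>i. real (n i) * H (A (real (n i)) * y)) \<longlonglongrightarrow> levy_tail \<alpha> M \<nu> y"
proof -
  define z where "z = \<nu> powr (1 / \<alpha>) * y"
  have z: "z > 0" "isCont M z" using y lam by (auto simp: z_def)
  let ?g = "\<lambda>x. x powr (- \<alpha>) * M x"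
  have cont: "isCont ?g z" using z by (intro continuous_intros) auto
  have nreal: "filterlim (\<lambda>i. real (n i)) at_top sequentially"
    by (rule filterlim_compose[OF filterlim_real_sequentially n])
  have km: "filterlim (\<lambda>i. real (k (m i))) at_top sequentially"
    by (rule filterlim_compose[OF k_at_top m])
  have m1: "\<forall>\<^sub>F i in sequentially. m i \<ge> 1" using m by (simp add: filterlim_at_top)
  have ratio: "(\<lambda>i. A (real (n i)) / a (m i) * y) \<longlonglongrightarrow> z"
    unfolding z_def by (intro tendsto_mult tendsto_const A_ratio_tendsto km nreal lam)
  have reg: "(\<lambda>i. real (k (m i)) * H (a (m i) * z')) \<longlonglongrightarrow> ?g z'" if "regular_point M z'" for z'
    using filterlim_compose[OF tail_at_regular_point[OF that] m] .
  have main: "(\<lambda>i. real (k (m i)) * H (A (real (n i)) * y)) \<longlonglongrightarrow> ?g z"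
  proof (rule order_tendstoI)
    fix r assume r: "r < ?g z"
    have "\<forall>\<^sub>F x in at_right z. r < ?g x"
      using cont r by (auto simp: isCont_def filterlim_at_split intro: order_tendstoD)
    then obtain b where b: "b > z" "\<And>x. z < x \<Longrightarrow> x < b \<Longrightarrow> r < ?g x"
      unfolding eventually_at_right_field by blast
    obtain z' where z': "z < z'" "z' < b" "regular_point M z'"
      using regular_points_dense[OF M_antimono, of z b] z b by auto
    have "\<forall>\<^sub>F i in sequentially. real (k (m i)) * H (a (m i) * z') > r"
      using reg[OF z'(3)] b(2)[OF z'(1,2)] by (rule order_tendstoD)
    moreover have "\<forall>\<^sub>F i in sequentially. A (real (n i)) / a (m i) * y < z'"
      using ratio z'(1) by (rule order_tendstoD)
    ultimately show "\<forall>\<^sub>F i in sequentially. r < real (k (m i)) * H (A (real (n i)) * y)"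
      using m1
    proof eventually_elim
      case (elim i)
      have "A (real (n i)) * y \<le> a (m i) * z'" using elim a_pos[of "m i"] by (simp add: field_simps)
      then have "H (a (m i) * z') \<le> H (A (real (n i)) * y)" using H_antimono by (simp add: antimonoD)
      then have "real (k (m i)) * H (a (m i) * z') \<le> real (k (m i)) * H (A (real (n i)) * y)"
        by (rule mult_left_mono) simp
      then show ?case using elim(1) by linarith
    qed
  next
    fix r assume r: "?g z < r"
    have "\<forall>\<^sub>F x in at_left z. ?g x < r"
      using cont r by (auto simp: isCont_def filterlim_at_split intro: order_tendstoD)
    then obtain b where b: "b < z" "\<And>x. b < x \<Longrightarrow> x < z \<Longrightarrow> ?g x < r"
      unfolding eventually_at_left_field by blast
    obtain z' where z': "max b 0 < z'" "z' < z" "regular_point M z'"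
      using regular_points_dense[OF M_antimono, of "max b 0" z] z b by auto
    have "\<forall>\<^sub>F i in sequentially. real (k (m i)) * H (a (m i) * z') < r"
      using reg[OF z'(3)] b(2)[of z'] z' by (intro order_tendstoD) auto
    moreover have "\<forall>\<^sub>F i in sequentially. A (real (n i)) / a (m i) * y > z'"
      using ratio z'(2) by (rule order_tendstoD)
    ultimately show "\<forall>\<^sub>F i in sequentially. real (k (m i)) * H (A (real (n i)) * y) < r"
      using m1
    proof eventually_elim
      case (elim i)
      have "A (real (n i)) * y \<ge> a (m i) * z'" using elim a_pos[of "m i"] by (simp add: field_simps)
      then have "H (a (m i) * z') \<ge> H (A (real (n i)) * y)" using H_antimono by (simp add: antimonoD)
      then have "real (k (m i)) * H (a (m i) * z') \<ge> real (k (m i)) * H (A (real (n i)) * y)"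
        by (rule mult_left_mono) simp
      then show ?case using elim(1) by linarith
    qed
  qed
  have "(\<lambda>i. (real (n i) / real (k (m i))) * (real (k (m i)) * H (A (real (n i)) * y))) \<longlonglongrightarrow> \<nu> * ?g z"
    by (intro tendsto_mult lam main)
  moreover have "\<nu> * ?g z = levy_tail \<alpha> M \<nu> y"
  proof -
    have "\<nu> * z powr (- \<alpha>) = y powr (- \<alpha>)"
      using lam y alpha_pos by (simp add: z_def powr_mult powr_powr powr_minus)
    then show ?thesis by (simp add: levy_tail_def z_def mult.assoc[symmetric])
  qed
  moreover have "\<forall>\<^sub>F i in sequentially. (real (n i) / real (k (m i))) * (real (k (m i)) * H (A (real (n i)) * y)) = real (n i) * H (A (real (n i)) * y)"
    using m1
  proof eventually_elim
    case (elim i)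
    then show ?case using k_pos[of "m i"] by simp
  qed
  ultimately show ?thesis using Lim_transform_eventually by fastforce
qed

text \<open>By compactness: a sequence with unbounded values would have a subsequence with
  convergent position, along which the tail at a smaller multiple of A n converges and yet
  dominates. A factor below 1 is taken because 1 may correspond to a jump of
  \<open>M\<close>.\<close>

lemma tail_bound: "\<exists>K N. K > 0 \<and> N \<ge> 1 \<and> (\<forall>n\<ge>N. real n * H (A (real n)) < K)"
proof (rule ccontr)
  assume "\<not> ?thesis"
  then have neg: "\<exists>n\<ge>N. real n * H (A (real n)) \<ge> K" if "K > 0" "N \<ge> 1" for K and N :: nat
    using that by (meson not_less)
  have "\<forall>j::nat. \<exists>n\<ge>Suc j. real n * H (A (real n)) \<ge> real (Suc j)"
    using neg by simp
  then obtain s where s: "\<And>j. s j \<ge> Suc j" "\<And>j. real (s j) * H (A (real (s j))) \<ge> real (Suc j)" by metis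
  have s_lim: "filterlim s at_top sequentially"
    by (rule filterlim_at_top_mono[OF filterlim_ident]) (rule always_eventually, rule allI, rule Suc_leD, rule s(1))
  obtain r \<nu> where r: "strict_mono r" "\<nu> > 0" "(\<lambda>i. position_param k (s (r i))) \<longlonglongrightarrow> \<nu>"
    using position_param_subseq[OF s_lim] by blast
  have sr: "filterlim (\<lambda>i. s (r i)) at_top sequentially"
    by (rule filterlim_compose[OF s_lim filterlim_subseq[OF r(1)]])
  define y where "y = \<nu> powr (1 / \<alpha>)"
  have y: "y > 0" using r(2) by (simp add: y_def)
  obtain z where z: "0 < z" "z < y" "regular_point M z"
    using regular_points_dense[OF M_antimono, of 0 y] y by auto
  have lim: "(\<lambda>i. real (s (r i)) * H (A (real (s (r i))) * (z / y))) \<longlonglongrightarrow> levy_tail \<alpha> M \<nu> (z / y)"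
  proof (rule tail_tendsto[OF sr])
    show "filterlim (\<lambda>i. block (s (r i))) at_top sequentially"
      by (rule filterlim_compose[OF block_at_top sr])
    show "isCont M (\<nu> powr (1 / \<alpha>) * (z / y))" using z y by (simp add: regular_point_def y_def)
  qed (use r z y in \<open>auto simp: position_param_eq\<close>)
  obtain N :: nat where N: "levy_tail \<alpha> M \<nu> (z / y) + 1 \<le> real N" using real_arch_simple by blast
  have "\<forall>\<^sub>F i in sequentially. real (s (r i)) * H (A (real (s (r i))) * (z / y)) < levy_tail \<alpha> M \<nu> (z / y) + 1"
    using lim by (rule order_tendstoD) simp
  moreover have "\<forall>\<^sub>F i in sequentially. i \<ge> N" by (rule eventually_ge_at_top)
  ultimately have "\<forall>\<^sub>F i::nat in sequentially. False"
  proof eventually_elim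
    case (elim i)
    have n1: "s (r i) \<ge> 1" using s(1)[of "r i"] by simp
    have "A (real (s (r i))) > 0" using n1 by (intro A_pos) simp
    then have "A (real (s (r i))) * (z / y) \<le> A (real (s (r i)))"
      using z y by (intro mult_right_le_one_le) auto
    then have "H (A (real (s (r i)))) \<le> H (A (real (s (r i))) * (z / y))" using H_antimono by (simp add: antimonoD)
    then have "real (s (r i)) * H (A (real (s (r i)))) \<le> real (s (r i)) * H (A (real (s (r i))) * (z / y))"
      by (rule mult_left_mono) simp
    moreover have "real (Suc (r i)) \<ge> real N" using elim(2) seq_suble[OF r(1), of i] by simp
    ultimately show ?case using s(2)[of "r i"] elim(1) N by linarith
  qed
  then show False by simp
qed

end

section \<open>Convergence of the quantiles\<close>

locale semistable_profile =
  fixes \<alpha> c :: real and M :: "real \<Rightarrow> real" and b :: real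
  assumes alpha_pos: "0 < \<alpha>" and c: "c > 1" and b_pos: "b > 0"
    and M_nonneg: "\<And>x. x > 0 \<Longrightarrow> M x \<ge> 0"
    and M_le: "\<And>x. x > 0 \<Longrightarrow> M x \<le> b"
    and M_antimono: "antimono_on {0<..} (\<lambda>x. M x * x powr (- \<alpha>))"
    and per: "\<And>x. x > 0 \<Longrightarrow> M (c powr (1 / \<alpha>) * x) = M x"
begin

text \<open>In this form the Levy tail is u times the monotone function M x * x powr (-\<alpha>) at
  a rescaled point, so monotonicity carries over.\<close>

lemma levy_tail_eq:
  assumes "u > 0" "y > 0"
  shows "levy_tail \<alpha> M u y = u * (M (u powr (1 / \<alpha>) * y) * (u powr (1 / \<alpha>) * y) powr (- \<alpha>))"
  using assms alpha_pos by (simp add: levy_tail_def powr_mult powr_powr powr_minus)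

lemma levy_tail_antimono:
  assumes "u > 0" "0 < x" "x \<le> y"
  shows "levy_tail \<alpha> M u y \<le> levy_tail \<alpha> M u x"
  using assms monotone_onD[OF M_antimono, of "u powr (1 / \<alpha>) * x" "u powr (1 / \<alpha>) * y"]
  by (simp add: levy_tail_eq)

lemma levy_tail_bounds:
  assumes "u > 0" "y > 0"
  shows "0 \<le> levy_tail \<alpha> M u y" "levy_tail \<alpha> M u y \<le> b * y powr (- \<alpha>)"
  using assms M_nonneg[of "u powr (1 / \<alpha>) * y"] M_le[of "u powr (1 / \<alpha>) * y"]
  by (auto simp: levy_tail_def mult.commute intro: mult_left_mono)

lemma levy_set_mem:
  assumes "u > 0" "s > 0" "y \<ge> (b / s) powr (1 / \<alpha>)"
  shows "y \<in> {x. x > 0 \<and> levy_tail \<alpha> M u x \<le> s}"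
proof -
  have p: "(b / s) powr (1 / \<alpha>) > 0" using b_pos assms by simp
  then have y: "y > 0" using assms by linarith
  have "b / s = ((b / s) powr (1 / \<alpha>)) powr \<alpha>" using b_pos assms alpha_pos by (simp add: powr_powr)
  also have "\<dots> \<le> y powr \<alpha>" using assms p alpha_pos by (intro powr_mono2) auto
  finally have "b * y powr (- \<alpha>) \<le> s" using y assms by (simp add: powr_minus field_simps)
  then show ?thesis using levy_tail_bounds(2)[OF assms(1) y] y by simp
qed

lemma levy_set_bdd: "bdd_below {x. x > 0 \<and> levy_tail \<alpha> M u x \<le> s}"
  by (rule bdd_belowI[of _ 0]) auto

lemma levy_inverse_le:
  assumes "x > 0" "levy_tail \<alpha> M u x \<le> s"
  shows "levy_inverse \<alpha> M u s \<le> x"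
  unfolding levy_inverse_def using assms by (intro cInf_lower levy_set_bdd) auto

lemma levy_inverse_ge:
  assumes "u > 0" "s > 0" "\<And>x. x > 0 \<Longrightarrow> levy_tail \<alpha> M u x \<le> s \<Longrightarrow> y \<le> x"
  shows "y \<le> levy_inverse \<alpha> M u s"
  unfolding levy_inverse_def using assms levy_set_mem[OF assms(1,2)] by (intro cInf_greatest) auto

lemma levy_inverse_nonneg: "u > 0 \<Longrightarrow> s > 0 \<Longrightarrow> 0 \<le> levy_inverse \<alpha> M u s"
  by (rule levy_inverse_ge) auto

lemma levy_inverse_upper:
  assumes "u > 0" "s > 0"
  shows "levy_inverse \<alpha> M u s \<le> (b / s) powr (1 / \<alpha>)"
  using levy_set_mem[OF assms order_refl] by (intro levy_inverse_le) auto

lemma levy_inverse_lower: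
  assumes "u > 0" "s > 0" "a > 0" "\<And>x. x > 0 \<Longrightarrow> a \<le> M x"
  shows "(a / s) powr (1 / \<alpha>) \<le> levy_inverse \<alpha> M u s"
proof (rule levy_inverse_ge)
  fix x assume x: "x > 0" "levy_tail \<alpha> M u x \<le> s"
  have "a * x powr (- \<alpha>) \<le> levy_tail \<alpha> M u x"
    using assms x by (simp add: levy_tail_def mult.commute mult_left_mono)
  then have "a * x powr (- \<alpha>) \<le> s" using x by linarith
  then have "a / s \<le> x powr \<alpha>" using x assms by (simp add: powr_minus field_simps)
  then have "(a / s) powr (1 / \<alpha>) \<le> (x powr \<alpha>) powr (1 / \<alpha>)"
    using assms alpha_pos by (intro powr_mono2) auto
  then show "(a / s) powr (1 / \<alpha>) \<le> x" using x alpha_pos by (simp add: powr_powr)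
qed (use assms in auto)

lemma levy_inverse_antimono:
  assumes "u > 0" "0 < s" "s \<le> s'"
  shows "levy_inverse \<alpha> M u s' \<le> levy_inverse \<alpha> M u s"
  using assms by (intro levy_inverse_ge[where s=s]) (auto intro!: levy_inverse_le)

lemma levy_inverse_measurable:
  assumes "u > 0"
  shows "(\<lambda>s. indicator {0<..} s * levy_inverse \<alpha> M u s) \<in> borel_measurable borel"
proof -
  have "mono_on {0<..} (\<lambda>s. - levy_inverse \<alpha> M u s)"
    using levy_inverse_antimono[OF assms] by (auto simp: mono_on_def)
  then have "(\<lambda>s. - levy_inverse \<alpha> M u s) \<in> borel_measurable (restrict_space borel {0<..})"
    by (rule borel_measurable_mono_on_fnc)
  then have "(\<lambda>s. - (- levy_inverse \<alpha> M u s)) \<in> borel_measurable (restrict_space borel {0<..})"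
    by (rule borel_measurable_uminus)
  then show ?thesis by (simp add: borel_measurable_restrict_space_iff)
qed

lemma continuity_points_dense:
  assumes "u > 0" "0 \<le> x" "x < y"
  shows "\<exists>z. x < z \<and> z < y \<and> isCont M (u powr (1 / \<alpha>) * z)"
proof -
  define w where "w = u powr (1 / \<alpha>)"
  have w: "w > 0" using assms by (simp add: w_def)
  have "countable {x\<in>{0<..}. \<not> isCont M x}" using M_antimono by (rule countable_discontinuities)
  from open_minus_countable[OF this, of "{w * x<..<w * y}"] assms w
  obtain z where z: "z \<in> {w * x<..<w * y}" "z \<notin> {x\<in>{0<..}. \<not> isCont M x}" by auto
  have "0 \<le> w * x" using assms w by simp
  then have "isCont M z" using z by simp
  then show ?thesis using z w
    by (intro exI[of _ "z / w"]) (auto simp: w_def[symmetric] field_simps)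
qed

text \<open>Inverses of monotone functions converge at every level where the limit is not flat. A
  flat stretch contains a rational, so it suffices to avoid the countably many levels attained at
  rationals. The conditions on \<open>q\<close> are weak enough for rescaled quantiles as well as
  for inverses with a varying parameter; \<open>q0\<close> matters when the limit is 0, where
  positive y give no lower bound.\<close>

lemma levy_inverse_tendsto:
  assumes u: "u > 0" and s: "s > 0" "s \<notin> levy_tail \<alpha> M u ` (\<rat> \<inter> {0<..})"
    and H: "\<And>y. y > 0 \<Longrightarrow> isCont M (u powr (1 / \<alpha>) * y) \<Longrightarrow> (\<lambda>i. H i y) \<longlonglongrightarrow> levy_tail \<alpha> M u y"
    and q1: "\<And>y. y > 0 \<Longrightarrow> \<forall>\<^sub>F i in sequentially. H i y < s \<longrightarrow> q i \<le> y"
    and q2: "\<And>y. y > 0 \<Longrightarrow> \<forall>\<^sub>F i in sequentially. s < H i y \<longrightarrow> y \<le> q i"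
    and q0: "\<And>e. e > 0 \<Longrightarrow> \<forall>\<^sub>F i in sequentially. q i > - e"
  shows "q \<longlonglongrightarrow> levy_inverse \<alpha> M u s"
proof -
  define R where "R = levy_inverse \<alpha> M u s"
  have R0: "R \<ge> 0" unfolding R_def by (rule levy_inverse_nonneg[OF u s(1)])
  show ?thesis unfolding R_def[symmetric]
  proof (rule order_tendstoI)
    fix y assume y: "y < R"
    show "\<forall>\<^sub>F i in sequentially. y < q i"
    proof (cases "y < 0")
      case True
      then show ?thesis using q0[of "- y"] by simp
    next
      case False
      then obtain z where z: "y < z" "z < R" "isCont M (u powr (1 / \<alpha>) * z)"
        using continuity_points_dense[OF u, of y R] y by auto
      have z0: "z > 0" using False z by linarith
      have "levy_tail \<alpha> M u z > s"
        using levy_inverse_le[OF z0, of u s] z(2) by (auto simp: R_def not_le[symmetric])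
      then have "\<forall>\<^sub>F i in sequentially. H i z > s" using H[OF z0 z(3)] by (intro order_tendstoD)
      then show ?thesis using q2[OF z0] by eventually_elim (use z(1) in auto)
    qed
  next
    fix y assume y: "R < y"
    obtain x where x: "x \<in> \<rat>" "R < x" "x < y" using Rats_dense_in_real[OF y] by blast
    obtain z where z: "x < z" "z < y" "isCont M (u powr (1 / \<alpha>) * z)"
      using continuity_points_dense[OF u, of x y] x R0 by auto
    have x0: "x > 0" and z0: "z > 0" using x z R0 by auto
    have "\<exists>v. v > 0 \<and> levy_tail \<alpha> M u v \<le> s \<and> v < x"
    proof (rule ccontr)
      assume "\<not> ?thesis"
      then have "x \<le> R" unfolding R_def by (intro levy_inverse_ge u s) (auto simp: not_less)
      then show False using x by simp
    qed
    then obtain v where v: "v > 0" "levy_tail \<alpha> M u v \<le> s" "v < x" by blast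
    have "levy_tail \<alpha> M u x \<le> s" using levy_tail_antimono[OF u v(1), of x] v by simp
    moreover have "levy_tail \<alpha> M u x \<noteq> s" using s(2) x x0 by auto
    ultimately have "levy_tail \<alpha> M u x < s" by simp
    then have "levy_tail \<alpha> M u z < s" using levy_tail_antimono[OF u x0, of z] z by simp
    then have "\<forall>\<^sub>F i in sequentially. H i z < s" using H[OF z0 z(3)] by (intro order_tendstoD)
    then show "\<forall>\<^sub>F i in sequentially. q i < y" using q1[OF z0] by eventually_elim (use z in auto)
  qed
qed

lemma AE_levy_regular: "AE s in lborel. s \<notin> levy_tail \<alpha> M u ` (\<rat> \<inter> {0<..})"
proof -
  have "countable (levy_tail \<alpha> M u ` (\<rat> \<inter> {0<..}))"
    by (intro countable_image countable_Int1 countable_rat)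
  then show ?thesis by (rule AE_not_in[OF countable_imp_null_set_lborel])
qed

lemma levy_tail_tendsto:
  assumes "(\<lambda>i. v i) \<longlonglongrightarrow> u" "u > 0" "y > 0" "isCont M (u powr (1 / \<alpha>) * y)"
  shows "(\<lambda>i. levy_tail \<alpha> M (v i) y) \<longlonglongrightarrow> levy_tail \<alpha> M u y"
proof -
  have "(\<lambda>i. v i powr (1 / \<alpha>) * y) \<longlonglongrightarrow> u powr (1 / \<alpha>) * y"
    using assms by (intro tendsto_intros) auto
  from isCont_tendsto_compose[OF assms(4) this] show ?thesis
    unfolding levy_tail_def by (intro tendsto_intros)
qed

text \<open>Convergence at almost every level is all that dominated convergence asks for; this
  yields the continuity of the limiting characteristic function in \<open>u\<close>.\<close>

lemma levy_inverse_continuous: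
  assumes v: "v \<longlonglongrightarrow> u" "u > 0"
  shows "AE s in lborel. s > 0 \<longrightarrow> (\<lambda>i. levy_inverse \<alpha> M (v i) s) \<longlonglongrightarrow> levy_inverse \<alpha> M u s"
  using AE_levy_regular[of u]
proof eventually_elim
  case (elim s)
  have pos: "\<forall>\<^sub>F i in sequentially. v i > 0" using v by (rule order_tendstoD)
  show ?case
  proof
    assume s: "s > 0"
    show "(\<lambda>i. levy_inverse \<alpha> M (v i) s) \<longlonglongrightarrow> levy_inverse \<alpha> M u s"
    proof (rule levy_inverse_tendsto[OF v(2) s elim])
      fix y :: real assume y: "y > 0"
      show "isCont M (u powr (1 / \<alpha>) * y) \<Longrightarrow> (\<lambda>i. levy_tail \<alpha> M (v i) y) \<longlonglongrightarrow> levy_tail \<alpha> M u y"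
        by (rule levy_tail_tendsto[OF v y])
      show "\<forall>\<^sub>F i in sequentially. levy_tail \<alpha> M (v i) y < s \<longrightarrow> levy_inverse \<alpha> M (v i) s \<le> y"
        using y by (intro always_eventually allI impI levy_inverse_le) auto
      show "\<forall>\<^sub>F i in sequentially. s < levy_tail \<alpha> M (v i) y \<longrightarrow> y \<le> levy_inverse \<alpha> M (v i) s"
        using pos
      proof eventually_elim
        case (elim i)
        show ?case
        proof
          assume *: "s < levy_tail \<alpha> M (v i) y"
          show "y \<le> levy_inverse \<alpha> M (v i) s"
          proof (rule levy_inverse_ge[OF elim s], rule ccontr)
            fix x assume "x > 0" "levy_tail \<alpha> M (v i) x \<le> s" "\<not> y \<le> x"
            then show False using levy_tail_antimono[OF elim, of x y] * by simp
          qed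
        qed
      qed
    next
      fix e :: real assume "e > 0"
      show "\<forall>\<^sub>F i in sequentially. - e < levy_inverse \<alpha> M (v i) s"
        using pos
      proof eventually_elim
        case (elim i)
        then show ?case using levy_inverse_nonneg[OF elim s] \<open>e > 0\<close> by linarith
      qed
    qed
  qed
qed

end

section \<open>Rescaled quantiles of a summand: convergence and domination\<close>

locale quantile_tail = profile_tail + semistable_profile +
  fixes q :: "real \<Rightarrow> real"
  assumes q_le: "\<And>s x. 0 < s \<Longrightarrow> s < 1 \<Longrightarrow> H x < s \<Longrightarrow> q s \<le> x"
    and q_ge: "\<And>s x. 0 < s \<Longrightarrow> s < 1 \<Longrightarrow> s < H x \<Longrightarrow> x \<le> q s"
    and q_antimono: "\<And>s s'. 0 < s \<Longrightarrow> s \<le> s' \<Longrightarrow> s' < 1 \<Longrightarrow> q s' \<le> q s"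
begin

lemma scaled_quantile_tendsto:
  fixes n m :: "nat \<Rightarrow> nat"
  assumes n: "filterlim n at_top sequentially" and m: "filterlim m at_top sequentially"
    and u: "(\<lambda>i. real (n i) / real (k (m i))) \<longlonglongrightarrow> u" "u > 0"
  shows "AE s in lborel. s > 0 \<longrightarrow> (\<lambda>i. q (s / real (n i)) / A (real (n i))) \<longlonglongrightarrow> levy_inverse \<alpha> M u s"
  using AE_levy_regular[of u]
proof eventually_elim
  case (elim s)
  have nreal: "filterlim (\<lambda>i. real (n i)) at_top sequentially"
    by (rule filterlim_compose[OF filterlim_real_sequentially n])
  have An: "filterlim (\<lambda>i. A (real (n i))) at_top sequentially"
    by (rule filterlim_compose[OF A_at_top nreal])
  show ?case
  proof
    assume s: "s > 0"
    have "\<forall>\<^sub>F i in sequentially. real (n i) \<ge> max 1 (2 * s)"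
      using nreal unfolding filterlim_at_top by blast
    then have ev: "\<forall>\<^sub>F i in sequentially. real (n i) \<ge> 1 \<and> real (n i) \<ge> 2 * s"
      by eventually_elim simp
    show "(\<lambda>i. q (s / real (n i)) / A (real (n i))) \<longlonglongrightarrow> levy_inverse \<alpha> M u s"
    proof (rule levy_inverse_tendsto[OF u(2) s elim, where H="\<lambda>i y. real (n i) * H (A (real (n i)) * y)"])
      fix y :: real assume y: "y > 0"
      show "isCont M (u powr (1 / \<alpha>) * y) \<Longrightarrow> (\<lambda>i. real (n i) * H (A (real (n i)) * y)) \<longlonglongrightarrow> levy_tail \<alpha> M u y"
        by (rule tail_tendsto[OF n m u y])
      show "\<forall>\<^sub>F i in sequentially. real (n i) * H (A (real (n i)) * y) < s \<longrightarrow> q (s / real (n i)) / A (real (n i)) \<le> y"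
        using ev
      proof eventually_elim
        case (elim i)
        show ?case
        proof
          assume "real (n i) * H (A (real (n i)) * y) < s"
          then have "q (s / real (n i)) \<le> A (real (n i)) * y"
            using elim s by (intro q_le) (auto simp: field_simps)
          then show "q (s / real (n i)) / A (real (n i)) \<le> y"
            using A_pos[of "real (n i)"] elim by (simp add: field_simps)
        qed
      qed
      show "\<forall>\<^sub>F i in sequentially. s < real (n i) * H (A (real (n i)) * y) \<longrightarrow> y \<le> q (s / real (n i)) / A (real (n i))"
        using ev
      proof eventually_elim
        case (elim i)
        show ?case
        proof
          assume "s < real (n i) * H (A (real (n i)) * y)"
          then have "q (s / real (n i)) \<ge> A (real (n i)) * y"
            using elim s by (intro q_ge) (auto simp: field_simps)
          then show "y \<le> q (s / real (n i)) / A (real (n i))"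
            using A_pos[of "real (n i)"] elim by (simp add: field_simps)
        qed
      qed
    next
      fix e :: real assume e: "e > 0"
      have "\<forall>\<^sub>F i in sequentially. A (real (n i)) \<ge> (\<bar>q (1/2)\<bar> + 1) / e"
        using An unfolding filterlim_at_top by blast
      then show "\<forall>\<^sub>F i in sequentially. - e < q (s / real (n i)) / A (real (n i))"
        using ev
      proof eventually_elim
        case (elim i)
        have Ap: "A (real (n i)) > 0" using elim by (intro A_pos) auto
        have "- \<bar>q (1/2)\<bar> \<le> q (1/2)" by simp
        also have "q (1/2) \<le> q (s / real (n i))" using elim s by (intro q_antimono) (auto simp: field_simps)
        finally have 1: "- \<bar>q (1/2)\<bar> \<le> q (s / real (n i))" .
        have "\<bar>q (1/2)\<bar> + 1 \<le> e * A (real (n i))" using elim e by (simp add: field_simps)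
        then have "- (e * A (real (n i))) < q (s / real (n i))" using 1 by linarith
        then show ?case using Ap by (simp add: field_simps)
      qed
    qed
  qed
qed

text \<open>Because n * H (A n) is bounded, H (A m) drops below s / n for some m of order n / s, so
  q (s / n) \<le> A m, and Potter's bound compares A m with A n. If m exceeds n, then s is bounded
  and any power bound will do.\<close>

lemma scaled_quantile_bound:
  assumes beta: "0 < \<beta>" "\<beta> < 1 / \<alpha>"
  shows "\<exists>K. K > 0 \<and> (\<forall>\<^sub>F n in sequentially. \<forall>s. 1 \<le> s \<and> s \<le> real n / 2 \<longrightarrow>
    \<bar>q (s / real n)\<bar> / A (real n) \<le> K * s powr (- \<beta>))"
proof -
  obtain K0 N where KN: "K0 > 0" "N \<ge> 1" "\<And>n. n \<ge> N \<Longrightarrow> real n * H (A (real n)) < K0"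
    using tail_bound by blast
  obtain x1 K1 where K1: "x1 \<ge> 1" "K1 > 0" "\<And>x y. x \<ge> x1 \<Longrightarrow> y \<ge> x \<Longrightarrow> (y / x) powr \<beta> \<le> K1 * (A y / A x)"
    using potter_lower[OF beta(2)] by blast
  define \<beta>' where "\<beta>' = 1 / \<alpha> + 1"
  have "\<beta>' > 1 / \<alpha>" by (simp add: \<beta>'_def)
  then obtain x2 K2 where K2: "x2 \<ge> 1" "K2 > 0" "\<And>x y. x \<ge> x2 \<Longrightarrow> y \<ge> x \<Longrightarrow> A y / A x \<le> K2 * (y / x) powr \<beta>'"
    using potter_upper by blast
  have b': "\<beta>' > 0" using alpha_pos by (simp add: \<beta>'_def add_pos_pos)
  \<comment> \<open>One constant above all thresholds: m \<ge> D puts m in the range of the tail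
    bound, and D \<ge> K0 gives K0 / m \<le> s / n.\<close>
  define D where "D = K0 + x1 + x2 + real N"
  have D: "D \<ge> 1" "D \<ge> K0" "D \<ge> x1" "D \<ge> x2" "D \<ge> real N" using KN K1 K2 by (auto simp: D_def)
  define K3 where "K3 = K1 * (2 * D) powr \<beta> + K2 * (2 * D) powr \<beta>' * (2 * D) powr \<beta>"
  define K4 where "K4 = \<bar>q (1/2)\<bar> * (K1 * x1 powr \<beta> / A x1)"
  have Ax1: "A x1 > 0" using K1 by (intro A_pos)
  have K3: "K3 > 0" using K1 K2 D by (simp add: K3_def add_pos_pos)
  have K4: "K4 \<ge> 0" using K1 Ax1 by (simp add: K4_def)
  show ?thesis
  proof (intro exI conjI)
    show "K3 + K4 > 0" using K3 K4 by simp
    have "\<forall>\<^sub>F n in sequentially. real n \<ge> D" using filterlim_real_sequentially by (simp add: filterlim_at_top)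
    then show "\<forall>\<^sub>F n in sequentially. \<forall>s. 1 \<le> s \<and> s \<le> real n / 2 \<longrightarrow>
      \<bar>q (s / real n)\<bar> / A (real n) \<le> (K3 + K4) * s powr (- \<beta>)"
    proof (eventually_elim, intro allI impI, elim conjE)
      fix n s assume n: "real n \<ge> D" and s: "1 \<le> s" "s \<le> real n / 2"
      have n0: "real n > 0" using n D by linarith
      have An: "A (real n) > 0" using n D by (intro A_pos) linarith
      \<comment> \<open>As D * n / s \<ge> D \<ge> 1, rounding up at most doubles the value.\<close>
      define m where "m = nat \<lceil>D * real n / s\<rceil>"
      have Dns: "D * real n / s \<ge> D" using s n0 D by (simp add: field_simps)
      have m1: "D * real n / s \<le> real m" using Dns D by (simp add: m_def real_nat_ceiling_ge)
      have m2: "real m \<le> 2 * D * real n / s"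
      proof -
        have "real m \<le> D * real n / s + 1" using Dns D by (simp add: m_def of_nat_ceiling)
        then show ?thesis using Dns D by simp
      qed
      have mD: "real m \<ge> D" using m1 Dns by linarith
      have m0: "real m > 0" using mD D by linarith
      have "m \<ge> N" using mD D by simp
      then have "H (A (real m)) < K0 / real m" using KN(3)[of m] m0 by (simp add: field_simps)
      also have "\<dots> \<le> D / real m" using D m0 by (intro divide_right_mono) auto
      also have "\<dots> \<le> s / real n" using m1 s n0 m0 by (simp add: field_simps)
      finally have up: "q (s / real n) \<le> A (real m)" using s n0 by (intro q_le) (auto simp: field_simps)
      have Ds: "2 * D / s \<le> 2 * D" using s D by (simp add: field_simps)
      have split: "(2 * D / s) powr \<beta> = (2 * D) powr \<beta> * s powr (- \<beta>)"
        using s D by (simp add: powr_divide powr_minus_divide)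
      have Am: "A (real m) \<le> K3 * s powr (- \<beta>) * A (real n)"
      proof (cases "m \<le> n")
        case True
        have "(real n / real m) powr \<beta> \<le> K1 * (A (real n) / A (real m))"
          using True mD D by (intro K1) auto
        moreover have "A (real m) > 0" using mD D by (intro A_pos) linarith
        ultimately have "(real n / real m) powr \<beta> * A (real m) \<le> K1 * A (real n)" by (simp add: field_simps)
        then have "(real m / real n) powr \<beta> * ((real n / real m) powr \<beta> * A (real m)) \<le> (real m / real n) powr \<beta> * (K1 * A (real n))"
          by (intro mult_left_mono) auto
        moreover have "(real m / real n) powr \<beta> * (real n / real m) powr \<beta> = 1"
          using n0 m0 by (simp add: powr_mult[symmetric])
        ultimately have "A (real m) \<le> (real m / real n) powr \<beta> * (K1 * A (real n))"
          by (simp add: mult.assoc[symmetric])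
        also have "\<dots> \<le> (2 * D / s) powr \<beta> * (K1 * A (real n))"
          using m2 n0 An K1 s beta by (intro mult_right_mono powr_mono2) (auto simp: field_simps)
        also have "\<dots> \<le> K3 * s powr (- \<beta>) * A (real n)"
          unfolding split using An K1 K2 by (simp add: K3_def algebra_simps)
        finally show ?thesis .
      next
        case False
        have "A (real m) / A (real n) \<le> K2 * (real m / real n) powr \<beta>'"
          using False n D by (intro K2) auto
        also have "\<dots> \<le> K2 * (2 * D) powr \<beta>'"
        proof -
          have "real m / real n \<le> 2 * D / s" using m2 n0 s by (simp add: field_simps)
          then have "real m / real n \<le> 2 * D" using Ds by linarith
          then show ?thesis using K2 b' by (intro mult_left_mono powr_mono2) auto
        qed
        also have "\<dots> \<le> K2 * (2 * D) powr \<beta>' * ((2 * D) powr \<beta> * s powr (- \<beta>))"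
        proof -
          \<comment> \<open>n < m forces s \<le> 2 * D, so (2 * D / s) powr \<beta> is at least 1
            and may be inserted as a factor.\<close>
          have "real n < real m" using False by simp
          then have "real n < 2 * D * real n / s" using m2 by linarith
          then have "real n * s < real n * (2 * D)" using s by (simp add: field_simps)
          then have "s \<le> 2 * D" using n0 by (simp only: mult_less_cancel_left_pos)
          then have "1 \<le> (2 * D / s) powr \<beta>" using s beta by (intro ge_one_powr_ge_zero) auto
          then show ?thesis using mult_left_mono[of 1 _ "K2 * (2 * D) powr \<beta>'"] K2 unfolding split by simp
        qed
        also have "\<dots> \<le> K3 * s powr (- \<beta>)" using K1 by (simp add: K3_def algebra_simps)
        finally show ?thesis using An by (simp add: field_simps)
      qed
      \<comment> \<open>From below, s / n \<le> 1/2 leaves the constant q (1/2). It is absorbed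
        because A n grows at least like n powr \<beta> and s \<le> n.\<close>
      have lo: "- (K4 * s powr (- \<beta>) * A (real n)) \<le> q (s / real n)"
      proof -
        have "(real n / x1) powr \<beta> \<le> K1 * (A (real n) / A x1)" using n D by (intro K1) auto
        then have "1 \<le> K1 * x1 powr \<beta> / A x1 * (real n powr (- \<beta>) * A (real n))"
          using n0 K1 Ax1 by (simp add: powr_divide powr_minus field_simps)
        also have "\<dots> \<le> K1 * x1 powr \<beta> / A x1 * (s powr (- \<beta>) * A (real n))"
          using s n0 K1 Ax1 An beta by (intro mult_left_mono mult_right_mono powr_mono2') auto
        finally have "\<bar>q (1/2)\<bar> * 1 \<le> \<bar>q (1/2)\<bar> * (K1 * x1 powr \<beta> / A x1 * (s powr (- \<beta>) * A (real n)))"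
          by (intro mult_left_mono) auto
        then have "\<bar>q (1/2)\<bar> \<le> K4 * s powr (- \<beta>) * A (real n)" by (simp add: K4_def mult.assoc)
        moreover have "q (1/2) \<le> q (s / real n)" using s n0 by (intro q_antimono) (auto simp: field_simps)
        ultimately show ?thesis by linarith
      qed
      have "K3 * s powr (- \<beta>) * A (real n) \<ge> 0" "K4 * s powr (- \<beta>) * A (real n) \<ge> 0" using K3 K4 An by auto
      then have "\<bar>q (s / real n)\<bar> \<le> (K3 + K4) * s powr (- \<beta>) * A (real n)"
        using up Am lo unfolding distrib_right by (simp add: abs_le_iff)
      then show "\<bar>q (s / real n)\<bar> / A (real n) \<le> (K3 + K4) * s powr (- \<beta>)" using An by (simp add: field_simps)
    qed
  qed
qed

end

context cdf_distribution
begin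

lemma quantile_le_iff: "0 < s \<Longrightarrow> s < 1 \<Longrightarrow> quantile (cdf M) s \<le> x \<longleftrightarrow> s \<le> cdf M x"
  using pseudoinverse[of s x] by (simp add: quantile_def)

lemma quantile_mono: "0 < s \<Longrightarrow> s \<le> s' \<Longrightarrow> s' < 1 \<Longrightarrow> quantile (cdf M) s \<le> quantile (cdf M) s'"
  using quantile_le_iff[of s "quantile (cdf M) s'"] quantile_le_iff[of s' "quantile (cdf M) s'"] by simp

lemma cdf_compl: "cdf M x = 1 - measure M {x<..}"
proof -
  have "{x<..} = UNIV - {..x}" by auto
  then show ?thesis using prob_compl[of "{..x}"] by (simp add: cdf_def)
qed

lemma right_quantile_le_iff: "0 < s \<Longrightarrow> s < 1 \<Longrightarrow> quantile (cdf M) (1 - s) \<le> x \<longleftrightarrow> measure M {x<..} \<le> s"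
  using quantile_le_iff[of "1 - s" x] by (simp add: cdf_compl)

text \<open>For the open left half line there is no equivalence as on the right; only strict
  inequalities between \<open>s\<close> and the tail give information. This is why
  \<open>quantile_tail\<close> is phrased with strict inequalities.\<close>

lemma left_quantile_le:
  assumes "0 < s" "s < 1" "measure M {..< - x} < s"
  shows "- quantile (cdf M) s \<le> x"
proof (rule ccontr)
  assume "\<not> ?thesis"
  then have "{..quantile (cdf M) s} \<subseteq> {..< - x}" by auto
  then have "cdf M (quantile (cdf M) s) \<le> measure M {..< - x}"
    unfolding cdf_def by (intro finite_measure_mono) auto
  then show False using quantile_le_iff[of s "quantile (cdf M) s"] assms by simp
qed

lemma left_quantile_ge:
  assumes "0 < s" "s < 1" "s < measure M {..< - x}"
  shows "x \<le> - quantile (cdf M) s"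
proof -
  have "measure M {..< - x} \<le> cdf M (- x)" unfolding cdf_def by (intro finite_measure_mono) auto
  then show ?thesis using quantile_le_iff[of s "- x"] assms by simp
qed

end

section \<open>Characteristic functions\<close>

lemma powr_tail_integrable:
  assumes "p > 1"
  shows "integrable lborel (\<lambda>s::real. indicator {1<..} s * s powr (- p))"
proof -
  let ?F = "\<lambda>x. x powr (1 - p) / (1 - p)"
  have D: "DERIV ?F x :> x powr (- p)" if "x > 1" for x
    using DERIV_cdivide[OF has_real_derivative_powr[of x "1 - p"], of "1 - p"] that assms by simp
  have "(?F \<longlongrightarrow> ?F 1) (at_right 1)" using assms by (intro tendsto_intros) auto
  moreover have "(?F \<longlongrightarrow> 0) at_top" using assms by real_asymp
  ultimately have "set_integrable lborel (einterval 1 \<infinity>) (\<lambda>x. x powr (- p))"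
    by (intro interval_integral_FTC_nonneg(1)[where F="?F" and A="?F 1" and B=0])
       (use D in \<open>auto simp: ereal_tendsto_simps one_ereal_def intro!: continuous_intros\<close>)
  then show ?thesis by (simp add: set_integrable_def one_ereal_def)
qed

text \<open>Both \<open>w\<close> and exp (w - 1) lie in the closed unit disc, so their n-th powers
  differ by at most n times their distance, and this distance is of second order in w - 1.\<close>

lemma power_exp_approx:
  fixes w :: complex
  assumes w: "norm w \<le> 1"
  shows "norm (w ^ n - exp (of_nat n * (w - 1))) \<le> exp 2 * (real n * norm (w - 1) ^ 2)"
proof -
  have re: "\<bar>Re (w - 1)\<bar> \<le> 2" "Re (w - 1) \<le> 0"
    using abs_Re_le_cmod[of w] w by auto
  have "norm (exp (w - 1)) \<le> 1" using re by (simp add: norm_exp_eq_Re)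
  then have "norm (w ^ n - exp (w - 1) ^ n) \<le> real n * norm (w - exp (w - 1))"
    by (intro norm_power_diff w)
  moreover have "norm (w - exp (w - 1)) \<le> exp 2 * norm (w - 1) ^ 2"
  proof -
    have "norm (exp (w - 1) - (\<Sum>k\<le>1. (w - 1) ^ k / fact k)) \<le> exp \<bar>Re (w - 1)\<bar> * norm (w - 1) ^ Suc 1 / fact 1"
      by (rule Taylor_exp)
    also have "(\<Sum>k\<le>1. (w - 1) ^ k / fact k) = w" by simp
    also have "exp \<bar>Re (w - 1)\<bar> * norm (w - 1) ^ Suc 1 / fact 1 \<le> exp 2 * norm (w - 1) ^ 2"
      using re by (simp add: power2_eq_square mult_right_mono)
    finally show ?thesis by (simp add: norm_minus_commute)
  qed
  ultimately have "norm (w ^ n - exp (w - 1) ^ n) \<le> real n * (exp 2 * norm (w - 1) ^ 2)"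
    by (meson mult_left_mono of_nat_0_le_iff order_trans)
  then show ?thesis by (simp add: exp_of_nat_mult[symmetric] mult_ac)
qed

text \<open>The weight \<open>\<theta>\<close> of the centering is 1 in the exponent of the limit; the value 0 serves to
  control the characteristic function of a single summand.\<close>

definition levy_integrand :: "real \<Rightarrow> (real \<Rightarrow> real) \<Rightarrow> real \<Rightarrow> real \<Rightarrow> complex" where
  "levy_integrand \<theta> q t s = iexp (t * q s) - 1 - \<i> * complex_of_real (\<theta> * t * q s * indicator {1<..} s)"

lemma norm_iexp_minus_1: "norm (iexp x - 1) \<le> 2" "norm (iexp x - 1) \<le> \<bar>x\<bar>"
proof -
  show "norm (iexp x - 1) \<le> 2"
    using norm_triangle_ineq4[of "iexp x" 1] by simp
  show "norm (iexp x - 1) \<le> \<bar>x\<bar>" using iexp_approx1[of x 0] by simp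
qed

lemma levy_integrand_norm: "norm (levy_integrand 1 q t s) \<le> (if s \<le> 1 then 2 else (t * q s)\<^sup>2 / 2)"
proof (cases "s \<le> 1")
  case True
  then show ?thesis using norm_iexp_minus_1(1)[of "t * q s"] by (simp add: levy_integrand_def)
next
  case False
  have "norm (iexp (t * q s) - (\<Sum>k\<le>1. (\<i> * (t * q s))^k / fact k)) \<le> \<bar>t * q s\<bar> ^ Suc 1 / fact (Suc 1)"
    by (rule iexp_approx1)
  then show ?thesis using False by (simp add: levy_integrand_def power2_eq_square algebra_simps abs_mult_self_eq)
qed

text \<open>\<open>q\<close> is measurable on the positive half line only; under the outer indicator
  it may be replaced by its product with that indicator.\<close>

lemma levy_integrand_measurable:
  assumes "(\<lambda>s. indicator {0<..} s * q s) \<in> borel_measurable borel"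
  shows "(\<lambda>s. indicator {0<..} s *\<^sub>R levy_integrand \<theta> q t s) \<in> borel_measurable lborel"
proof -
  note [measurable] = assms
  have "(\<lambda>s. indicator {0<..} s *\<^sub>R levy_integrand \<theta> (\<lambda>s. indicator {0<..} s * q s) t s) \<in> borel_measurable borel"
    unfolding levy_integrand_def by measurable
  also have "(\<lambda>s. indicator {0<..} s *\<^sub>R levy_integrand \<theta> (\<lambda>s. indicator {0<..} s * q s) t s) =
    (\<lambda>s. indicator {0<..} s *\<^sub>R levy_integrand \<theta> q t s)"
    by (auto simp: indicator_def levy_integrand_def)
  finally show ?thesis by simp
qed

text \<open>The constant 2 bounds the uncentred part on (0, 1], the second summand the quadratic
  remainder beyond 1, which is integrable for \<beta> > 1/2.\<close>

definition levy_dominant :: "real \<Rightarrow> real \<Rightarrow> real \<Rightarrow> real" where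
  "levy_dominant K \<beta> s = indicator {0<..1} s * 2 + K * (indicator {1<..} s * s powr (- (2 * \<beta>)))"

lemma levy_dominant_integrable: "\<beta> > 1 / 2 \<Longrightarrow> integrable lborel (levy_dominant K \<beta>)"
  unfolding levy_dominant_def
  by (intro Bochner_Integration.integrable_add integrable_mult_right powr_tail_integrable) auto

lemma levy_integrand_le_dominant:
  assumes s: "s > 0" and q: "s > 1 \<Longrightarrow> \<bar>q s\<bar> \<le> K * s powr (- \<beta>)" and t: "\<bar>t\<bar> \<le> B" and K: "K \<ge> 0"
  shows "norm (levy_integrand 1 q t s) \<le> levy_dominant ((B * K)\<^sup>2 / 2) \<beta> s"
proof (cases "s \<le> 1")
  case True
  then show ?thesis using levy_integrand_norm[of q t s] s by (simp add: levy_dominant_def)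
next
  case False
  have "\<bar>t * q s\<bar> \<le> B * (K * s powr (- \<beta>))"
    unfolding abs_mult using q t False by (intro mult_mono) auto
  then have "(t * q s)\<^sup>2 \<le> (B * (K * s powr (- \<beta>)))\<^sup>2" by (simp add: power2_le_iff_abs_le abs_le_square_iff[symmetric] order_trans[OF _ abs_ge_self])
  also have "\<dots> = (B * K)\<^sup>2 * s powr (- (2 * \<beta>))"
    using s by (simp add: power_mult_distrib powr_power)
  finally show ?thesis using levy_integrand_norm[of q t s] False by (simp add: levy_dominant_def)
qed

lemma levy_integral_tendsto:
  fixes q :: "nat \<Rightarrow> real \<Rightarrow> real"
  assumes meas: "\<And>i. (\<lambda>s. indicator {0<..} s * q i s) \<in> borel_measurable borel"
      "(\<lambda>s. indicator {0<..} s * q' s) \<in> borel_measurable borel"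
    and lim: "AE s in lborel. s > 0 \<longrightarrow> (\<lambda>i. q i s) \<longlonglongrightarrow> q' s"
    and bound: "\<forall>\<^sub>F i in sequentially. \<forall>s>1. \<bar>q i s\<bar> \<le> K * s powr (- \<beta>)"
    and beta: "\<beta> > 1 / 2" and K: "K \<ge> 0" and t: "t \<longlonglongrightarrow> t'"
  shows "(\<lambda>i. CLBINT s:{0<..}. levy_integrand 1 (q i) (t i) s) \<longlonglongrightarrow> (CLBINT s:{0<..}. levy_integrand 1 q' t' s)"
proof -
  define B where "B = \<bar>t'\<bar> + 1"
  have "\<forall>\<^sub>F i in sequentially. \<bar>t i\<bar> < B" using tendsto_rabs[OF t] by (rule order_tendstoD) (simp add: B_def)
  from eventually_conj[OF this bound] obtain N where
    N: "\<And>i. i \<ge> N \<Longrightarrow> \<bar>t i\<bar> < B" "\<And>i s. i \<ge> N \<Longrightarrow> s > 1 \<Longrightarrow> \<bar>q i s\<bar> \<le> K * s powr (- \<beta>)"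
    unfolding eventually_sequentially by blast
  have "(\<lambda>i. CLBINT s:{0<..}. levy_integrand 1 (q (i + N)) (t (i + N)) s) \<longlonglongrightarrow> (CLBINT s:{0<..}. levy_integrand 1 q' t' s)"
    unfolding set_lebesgue_integral_def
  proof (rule integral_dominated_convergence[where w="levy_dominant ((B * K)\<^sup>2 / 2) \<beta>"])
    show "AE s in lborel. (\<lambda>i. indicator {0<..} s *\<^sub>R levy_integrand 1 (q (i + N)) (t (i + N)) s) \<longlonglongrightarrow>
        indicator {0<..} s *\<^sub>R levy_integrand 1 q' t' s"
      using lim
    proof eventually_elim
      case (elim s)
      show ?case
      proof (cases "s > 0")
        case True
        have "(\<lambda>i. q (i + N) s) \<longlonglongrightarrow> q' s" using elim True by (auto intro: LIMSEQ_ignore_initial_segment)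
        moreover have "(\<lambda>i. t (i + N)) \<longlonglongrightarrow> t'" using t by (rule LIMSEQ_ignore_initial_segment)
        ultimately show ?thesis unfolding levy_integrand_def by (intro tendsto_intros)
      qed simp
    qed
    show "AE s in lborel. norm (indicator {0<..} s *\<^sub>R levy_integrand 1 (q (i + N)) (t (i + N)) s)
        \<le> levy_dominant ((B * K)\<^sup>2 / 2) \<beta> s" for i
    proof (rule AE_I2)
      fix s :: real
      show "norm (indicator {0<..} s *\<^sub>R levy_integrand 1 (q (i + N)) (t (i + N)) s) \<le> levy_dominant ((B * K)\<^sup>2 / 2) \<beta> s"
      proof (cases "s > 0")
        case True
        then show ?thesis using N(1)[of "i + N"] N(2)[of "i + N" s] K
          by (auto intro!: levy_integrand_le_dominant)
      next
        case False
        then show ?thesis by (simp add: levy_dominant_def)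
      qed
    qed
  qed (use levy_dominant_integrable[OF beta] levy_integrand_measurable meas in auto)
  then show ?thesis by (rule LIMSEQ_offset)
qed

text \<open>Without centering the integrand is only of first order, and s powr (-\<beta>) need not
  be integrable at infinity. Since \<open>q\<close> vanishes beyond N, a factor s powr \<gamma>
  \<le> N powr \<gamma> can be borrowed; for \<gamma> < 1/2 this price is affordable later.\<close>

lemma uncentered_levy_integral_bound:
  assumes meas: "(\<lambda>s. indicator {0<..} s * q s) \<in> borel_measurable borel"
    and bound: "\<And>s. s > 1 \<Longrightarrow> \<bar>q s\<bar> \<le> K * s powr (- \<beta>)" and zero: "\<And>s. s \<ge> N \<Longrightarrow> q s = 0"
    and K: "K \<ge> 0" and N: "N \<ge> 1" and g: "\<gamma> \<ge> 0" "\<beta> + \<gamma> > 1"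
  shows "norm (CLBINT s:{0<..}. levy_integrand 0 q t s)
    \<le> 2 + \<bar>t\<bar> * K * N powr \<gamma> * (LBINT s. indicator {1<..} s * s powr (- (\<beta> + \<gamma>)))"
proof -
  let ?w = "\<lambda>s. indicator {0<..1} s * 2 + \<bar>t\<bar> * K * N powr \<gamma> * (indicator {1<..} s * s powr (- (\<beta> + \<gamma>)))"
  have i1: "integrable lborel (\<lambda>s::real. indicator {0<..1} s * 2 :: real)" by simp
  note i2 = integrable_mult_right[OF powr_tail_integrable[OF g(2)], of "\<bar>t\<bar> * K * N powr \<gamma>"]
  have le: "norm (indicator {0<..} s *\<^sub>R levy_integrand 0 q t s) \<le> ?w s" for s
  proof -
    consider "s \<le> 0" | "0 < s" "s \<le> 1" | "1 < s" "s < N" | "1 < s" "s \<ge> N" by linarith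
    then show ?thesis
    proof cases
      case 1 then show ?thesis by simp
    next
      case 2 then show ?thesis using norm_iexp_minus_1(1)[of "t * q s"] by (simp add: levy_integrand_def)
    next
      case 3
      have "norm (levy_integrand 0 q t s) \<le> \<bar>t * q s\<bar>"
        using norm_iexp_minus_1(2)[of "t * q s"] by (simp add: levy_integrand_def)
      also have "\<dots> \<le> \<bar>t\<bar> * (K * s powr (- \<beta>))"
        unfolding abs_mult using bound[of s] 3 by (intro mult_left_mono) auto
      also have "\<dots> \<le> \<bar>t\<bar> * (K * (N powr \<gamma> * s powr (- (\<beta> + \<gamma>))))"
      proof (intro mult_left_mono)
        have "s powr (- \<beta>) = s powr \<gamma> * s powr (- (\<beta> + \<gamma>))" using 3 by (simp add: powr_add[symmetric])
        also have "\<dots> \<le> N powr \<gamma> * s powr (- (\<beta> + \<gamma>))" using 3 g by (intro mult_right_mono powr_mono2) auto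
        finally show "s powr (- \<beta>) \<le> N powr \<gamma> * s powr (- (\<beta> + \<gamma>))" .
      qed (use K in auto)
      finally show ?thesis using 3 by (simp add: mult_ac)
    next
      case 4 then show ?thesis using zero[of s] K by (simp add: levy_integrand_def)
    qed
  qed
  have "norm (CLBINT s:{0<..}. levy_integrand 0 q t s) \<le> (LBINT s. ?w s)"
    unfolding set_lebesgue_integral_def
  proof (rule Bochner_Integration.integral_norm_bound_integral)
    have w: "integrable lborel ?w" using i1 i2 by (rule Bochner_Integration.integrable_add)
    then show "integrable lborel ?w" .
    show "integrable lborel (\<lambda>s. indicator {0<..} s *\<^sub>R levy_integrand 0 q t s)"
    proof (rule Bochner_Integration.integrable_bound[OF w])
      show "AE s in lborel. norm (indicator {0<..} s *\<^sub>R levy_integrand 0 q t s) \<le> norm (?w s)"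
      proof (rule AE_I2)
        fix s show "norm (indicator {0<..} s *\<^sub>R levy_integrand 0 q t s) \<le> norm (?w s)"
          unfolding real_norm_def by (rule order_trans[OF le abs_ge_self])
      qed
    qed (rule levy_integrand_measurable[OF meas])
  qed (rule le)
  also have "\<dots> = 2 + \<bar>t\<bar> * K * N powr \<gamma> * (LBINT s. indicator {1<..} s * s powr (- (\<beta> + \<gamma>)))"
    using i1 i2 by (subst Bochner_Integration.integral_add) auto
  finally show ?thesis .
qed

text \<open>The left tail enters as the right tail of the reflected variable, hence at frequency
  -t.\<close>

definition levy_exponent ::
    "real \<Rightarrow> (real \<Rightarrow> real) \<Rightarrow> (real \<Rightarrow> real) \<Rightarrow> real \<Rightarrow> real \<Rightarrow> complex" where
  "levy_exponent \<alpha> M\<^sub>R M\<^sub>L u t =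
     (CLBINT s:{0<..}. levy_integrand 1 (levy_inverse \<alpha> M\<^sub>R u) t s) +
     (CLBINT s:{0<..}. levy_integrand 1 (levy_inverse \<alpha> M\<^sub>L u) (- t) s)"

lemma semistable_cf_eq: "semistable_cf \<alpha> M\<^sub>R M\<^sub>L u t = exp (levy_exponent \<alpha> M\<^sub>R M\<^sub>L u t)"
  by (simp add: semistable_cf_def levy_exponent_def levy_integrand_def mult.assoc)

section \<open>The characteristic function of a summand in terms of its quantiles\<close>

context cdf_distribution
begin

text \<open>The cutoff at n / 2 corresponds to the level 1/2, so that the right and left versions
  together cover the unit interval once.\<close>

definition right_quantile :: "nat \<Rightarrow> real \<Rightarrow> real \<Rightarrow> real" where
  "right_quantile n a s = (if 0 < s \<and> s < real n / 2 then quantile (cdf M) (1 - s / real n) / a else 0)"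

definition left_quantile :: "nat \<Rightarrow> real \<Rightarrow> real \<Rightarrow> real" where
  "left_quantile n a s = (if 0 < s \<and> s < real n / 2 then - quantile (cdf M) (s / real n) / a else 0)"

lemma quantile_measurable: "(\<lambda>v. indicator {0<..<1} v * quantile (cdf M) v) \<in> borel_measurable borel"
proof -
  have "quantile (cdf M) \<in> borel_measurable (restrict_space borel {0<..<1})"
    unfolding quantile_def[abs_def] by (rule measurable_CI)
  then show ?thesis by (simp add: borel_measurable_restrict_space_iff)
qed

lemma scaled_quantile_measurable:
  shows "right_quantile n a \<in> borel_measurable borel" "left_quantile n a \<in> borel_measurable borel"
proof -
  note [measurable] = quantile_measurable
  define Q where "Q v = indicator {0<..<1} v * quantile (cdf M) v" for v
  have [measurable]: "Q \<in> borel_measurable borel" unfolding Q_def by measurable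
  have "right_quantile n a = (\<lambda>s. if 0 < s \<and> s < real n / 2 then Q (1 - s / real n) / a else 0)"
    by (rule ext, cases "n = 0") (auto simp: right_quantile_def Q_def indicator_def field_simps)
  also have "\<dots> \<in> borel_measurable borel" by measurable
  finally show "right_quantile n a \<in> borel_measurable borel" .
  have "left_quantile n a = (\<lambda>s. if 0 < s \<and> s < real n / 2 then - Q (s / real n) / a else 0)"
    by (rule ext, cases "n = 0") (auto simp: left_quantile_def Q_def indicator_def field_simps)
  also have "\<dots> \<in> borel_measurable borel" by measurable
  finally show "left_quantile n a \<in> borel_measurable borel" .
qed

lemma char_eq_quantile_integral: "char M u = (CLBINT v:{0<..<1}. iexp (u * quantile (cdf M) v))"
proof -
  have "char M u = (CLINT x|distr (restrict_space lborel {0<..<1}) borel I. iexp (u * x))"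
    unfolding char_def distr_I_eq_M ..
  also have "\<dots> = (CLINT v|restrict_space lborel {0<..<1}. iexp (u * I v))"
  proof (rule integral_distr)
    show "I \<in> restrict_space lborel {0<..<1} \<rightarrow>\<^sub>M borel"
      unfolding measurable_cong_sets[OF sets_restrict_space_cong[OF sets_lborel] refl] by (rule measurable_CI)
  qed simp
  also have "\<dots> = (CLBINT v:{0<..<1}. iexp (u * I v))"
    by (simp add: integral_restrict_space set_lebesgue_integral_def)
  finally show ?thesis by (simp add: quantile_def)
qed

text \<open>The window of the centering becomes s > 1 in both halves, apart from the single point s
  = 1, and beyond n / 2 the integrands vanish, so no error term arises. With \<theta> = 0 the
  identity measures how far the characteristic function of one summand is from 1.\<close>

lemma char_decomposition:
  assumes n: "n \<ge> 2"
  shows "of_nat n * (char M (t / a) - 1) - \<i> * of_real (\<theta> * t * (centering (cdf M) n / a)) =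
    (CLBINT s:{0<..}. levy_integrand \<theta> (right_quantile n a) t s) +
    (CLBINT s:{0<..}. levy_integrand \<theta> (left_quantile n a) (- t) s)"
proof -
  define u where "u = t / a"
  define Q where "Q v = indicator {0<..<1} v * quantile (cdf M) v" for v
  have [measurable]: "Q \<in> borel_measurable borel" unfolding Q_def by (rule quantile_measurable)
  define J where "J v = (indicator {1 / real n..1 - 1 / real n} v :: real)" for v
  have [measurable]: "J \<in> borel_measurable borel" unfolding J_def by measurable
  define G where "G v = iexp (u * Q v) - 1 - \<i> * of_real (\<theta> * u * (J v * Q v))" for v
  have [measurable]: "G \<in> borel_measurable borel" unfolding G_def by measurable
  have n0: "real n \<ge> 2" using n by simp
  define B where "B = \<bar>Q (1 / real n)\<bar> + \<bar>Q (1 - 1 / real n)\<bar>"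
  \<comment> \<open>The quantile function need not be integrable on the unit interval; inside the
    window it lies between its values at the two endpoints.\<close>
  have JQ: "\<bar>J v * Q v\<bar> \<le> B" for v
  proof (cases "v \<in> {1 / real n..1 - 1 / real n}")
    case True
    have p: "0 < 1 / real n" "1 - 1 / real n < 1" using n0 by auto
    have "1 / real n \<le> v" "v \<le> 1 - 1 / real n" using True by auto
    then have "0 < v" "v < 1" using p by linarith+
    moreover have "quantile (cdf M) (1 / real n) \<le> quantile (cdf M) v"
      using True p \<open>v < 1\<close> by (intro quantile_mono) auto
    moreover have "quantile (cdf M) v \<le> quantile (cdf M) (1 - 1 / real n)"
      using True p \<open>0 < v\<close> by (intro quantile_mono) auto
    moreover have "1 / real n < 1" "0 < 1 - 1 / real n" using n0 by auto
    ultimately have "\<bar>quantile (cdf M) v\<bar> \<le> \<bar>quantile (cdf M) (1 / real n)\<bar> + \<bar>quantile (cdf M) (1 - 1 / real n)\<bar>"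
      and "1 / real n < 1" "0 < 1 - 1 / real n" by linarith+
    then show ?thesis using p by (simp add: J_def B_def Q_def indicator_def)
  qed (simp add: J_def B_def)
  have int1: "integrable lborel (\<lambda>v. indicator {0<..<1} v *\<^sub>R iexp (u * Q v))"
    by (rule integrableI_bounded_set_indicator[where B=1]) auto
  have int2: "integrable lborel (\<lambda>v::real. indicator {0<..<1} v *\<^sub>R (1::complex))"
    by (rule integrableI_bounded_set_indicator[where B=1]) auto
  have int3: "integrable lborel (\<lambda>v. indicator {0<..<1} v *\<^sub>R (J v * Q v))"
    by (rule integrableI_bounded_set_indicator[where B=B]) (use JQ in auto)
  have intG: "integrable lborel (\<lambda>v. indicator {0<..<1} v *\<^sub>R G v)"
    using Bochner_Integration.integrable_diff[OF Bochner_Integration.integrable_diff[OF int1 int2]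
        integrable_mult_right[OF integrable_of_real[OF int3], of "\<i> * of_real (\<theta> * u)"]]
    by (simp add: G_def scaleR_conv_of_real algebra_simps)
  have intsub: "integrable lborel (\<lambda>v. indicator S v *\<^sub>R G v)" if "S \<subseteq> {0<..<1}" "S \<in> sets borel" for S
    using integrable_mult_indicator[of S lborel "\<lambda>v. indicator {0<..<1} v *\<^sub>R G v"] that intG
    by (simp add: indicator_inter_arith[symmetric] Int_absorb2)
  have G_val: "(CLBINT v. indicator {0<..<1} v *\<^sub>R G v) =
      (char M u - 1) - \<i> * of_real (\<theta> * u * (LBINT v:{1 / real n..1 - 1 / real n}. quantile (cdf M) v))"
  proof -
    have "(CLBINT v. indicator {0<..<1} v *\<^sub>R G v) =
       (CLBINT v. indicator {0<..<1} v *\<^sub>R iexp (u * Q v)) - (CLBINT v. indicator {0<..<1::real} v *\<^sub>R 1)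
       - \<i> * of_real (\<theta> * u) * (CLBINT v. of_real (indicator {0<..<1} v *\<^sub>R (J v * Q v)))"
    proof -
      let ?c = "\<i> * complex_of_real (\<theta> * u)"
      have G_eq: "indicator {0<..<1} v *\<^sub>R G v = indicator {0<..<1} v *\<^sub>R iexp (u * Q v) - indicator {0<..<1} v *\<^sub>R 1
          - ?c * of_real (indicator {0<..<1} v *\<^sub>R (J v * Q v))" for v
        by (simp add: G_def scaleR_conv_of_real algebra_simps)
      have int4: "integrable lborel (\<lambda>v. ?c * complex_of_real (indicator {0<..<1} v *\<^sub>R (J v * Q v)))"
        by (intro integrable_mult_right integrable_of_real int3)
      show ?thesis
        unfolding G_eq Bochner_Integration.integral_diff[OF Bochner_Integration.integrable_diff[OF int1 int2] int4]
          Bochner_Integration.integral_diff[OF int1 int2] integral_mult_right_zero by (rule refl)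
    qed
    moreover have "(CLBINT v. indicator {0<..<1} v *\<^sub>R iexp (u * Q v)) = char M u"
      unfolding char_eq_quantile_integral set_lebesgue_integral_def
      by (intro Bochner_Integration.integral_cong) (auto simp: Q_def indicator_def)
    moreover have "(CLBINT v. indicator {0<..<1::real} v *\<^sub>R (1::complex)) = 1"
      by (simp add: scaleR_conv_of_real)
    moreover have "(LBINT v. indicator {0<..<1} v *\<^sub>R (J v * Q v)) =
        (LBINT v:{1 / real n..1 - 1 / real n}. quantile (cdf M) v)"
      unfolding set_lebesgue_integral_def
    proof (rule Bochner_Integration.integral_cong[OF refl])
      fix v
      have "0 < 1 / real n" using n0 by simp
      then have "v \<in> {1 / real n..1 - 1 / real n} \<Longrightarrow> v \<in> {0<..<1}"
        unfolding atLeastAtMost_iff greaterThanLessThan_iff by linarith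
      then show "indicator {0<..<1} v *\<^sub>R (J v * Q v) = indicator {1 / real n..1 - 1 / real n} v *\<^sub>R quantile (cdf M) v"
        by (auto simp: J_def Q_def indicator_def)
    qed
    ultimately show ?thesis by (simp only: integral_complex_of_real of_real_mult mult.assoc)
  qed
  have split: "(CLBINT v. indicator {0<..<1} v *\<^sub>R G v) =
      (CLBINT v. indicator {0<..<1/2} v *\<^sub>R G v) + (CLBINT v. indicator {1/2<..<1} v *\<^sub>R G v)"
  proof -
    have "(CLBINT v. indicator {0<..<1} v *\<^sub>R G v) =
        (CLBINT v. indicator {0<..<1/2} v *\<^sub>R G v + indicator {1/2<..<1} v *\<^sub>R G v)"
    proof (rule integral_cong_AE)
      show "AE v in lborel. indicator {0<..<1} v *\<^sub>R G v = indicator {0<..<1/2} v *\<^sub>R G v + indicator {1/2<..<1} v *\<^sub>R G v"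
        using AE_lborel_singleton[of "1/2::real"] by eventually_elim (auto simp: indicator_def)
    qed measurable
    also have "\<dots> = (CLBINT v. indicator {0<..<1/2} v *\<^sub>R G v) + (CLBINT v. indicator {1/2<..<1} v *\<^sub>R G v)"
      by (intro Bochner_Integration.integral_add intsub) auto
    finally show ?thesis .
  qed
  have left: "of_nat n * (CLBINT v. indicator {0<..<1/2} v *\<^sub>R G v) =
      (CLBINT s:{0<..}. levy_integrand \<theta> (left_quantile n a) (- t) s)"
  proof -
    have "(CLBINT v. indicator {0<..<1/2} v *\<^sub>R G v) =
        \<bar>1 / real n\<bar> *\<^sub>R (CLBINT s. indicator {0<..<1/2} (0 + 1 / real n * s) *\<^sub>R G (0 + 1 / real n * s))"
      by (rule lborel_integral_real_affine) (use n0 in auto)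
    then have "of_nat n * (CLBINT v. indicator {0<..<1/2} v *\<^sub>R G v) =
        (CLBINT s. indicator {0<..<1/2} (s / real n) *\<^sub>R G (s / real n))"
      using n0 by (simp add: scaleR_conv_of_real)
    also have "\<dots> = (CLBINT s:{0<..}. levy_integrand \<theta> (left_quantile n a) (- t) s)"
      unfolding set_lebesgue_integral_def
    proof (rule integral_cong_AE)
      show "AE s in lborel. indicator {0<..<1/2} (s / real n) *\<^sub>R G (s / real n) =
          indicator {0<..} s *\<^sub>R levy_integrand \<theta> (left_quantile n a) (- t) s"
        using AE_lborel_singleton[of "1::real"]
      proof eventually_elim
        case (elim s)
        show ?case
        proof (cases "0 < s \<and> s < real n / 2")
          case True
          have "s / real n \<in> {0<..<1/2}" "s / real n \<in> {0<..<1}" using True n0 by (auto simp: field_simps)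
          moreover have "s / real n \<in> {1 / real n..1 - 1 / real n} \<longleftrightarrow> s > 1"
            using True n0 elim by (auto simp: field_simps)
          ultimately show ?thesis using True
            by (auto simp: G_def J_def Q_def levy_integrand_def left_quantile_def u_def indicator_def)
        next
          case False
          then have "s / real n \<notin> {0<..<1/2}" using n0 by (auto simp: field_simps)
          then show ?thesis using False by (auto simp: levy_integrand_def left_quantile_def indicator_def)
        qed
      qed
    qed (use levy_integrand_measurable scaled_quantile_measurable n in auto)
    finally show ?thesis .
  qed
  have right: "of_nat n * (CLBINT v. indicator {1/2<..<1} v *\<^sub>R G v) =
      (CLBINT s:{0<..}. levy_integrand \<theta> (right_quantile n a) t s)"
  proof -
    have "(CLBINT v. indicator {1/2<..<1} v *\<^sub>R G v) =
        \<bar>- 1 / real n\<bar> *\<^sub>R (CLBINT s. indicator {1/2<..<1} (1 + - 1 / real n * s) *\<^sub>R G (1 + - 1 / real n * s))"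
      by (rule lborel_integral_real_affine) (use n0 in auto)
    then have "of_nat n * (CLBINT v. indicator {1/2<..<1} v *\<^sub>R G v) =
        (CLBINT s. indicator {1/2<..<1} (1 - s / real n) *\<^sub>R G (1 - s / real n))"
      using n0 by (simp add: scaleR_conv_of_real)
    also have "\<dots> = (CLBINT s:{0<..}. levy_integrand \<theta> (right_quantile n a) t s)"
      unfolding set_lebesgue_integral_def
    proof (rule integral_cong_AE)
      show "AE s in lborel. indicator {1/2<..<1} (1 - s / real n) *\<^sub>R G (1 - s / real n) =
          indicator {0<..} s *\<^sub>R levy_integrand \<theta> (right_quantile n a) t s"
        using AE_lborel_singleton[of "1::real"]
      proof eventually_elim
        case (elim s)
        show ?case
        proof (cases "0 < s \<and> s < real n / 2")
          case True
          have "1 - s / real n \<in> {1/2<..<1}" "1 - s / real n \<in> {0<..<1}" using True n0 by (auto simp: field_simps)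
          moreover have "1 - s / real n \<in> {1 / real n..1 - 1 / real n} \<longleftrightarrow> s > 1"
            using True n0 elim by (auto simp: field_simps)
          ultimately show ?thesis using True
            by (auto simp: G_def J_def Q_def levy_integrand_def right_quantile_def u_def indicator_def)
        next
          case False
          then have "1 - s / real n \<notin> {1/2<..<1}" using n0 by (auto simp: field_simps)
          then show ?thesis using False by (auto simp: levy_integrand_def right_quantile_def indicator_def)
        qed
      qed
    qed (use levy_integrand_measurable scaled_quantile_measurable n in auto)
    finally show ?thesis .
  qed
  have "of_nat n * (CLBINT v. indicator {0<..<1} v *\<^sub>R G v) =
      of_nat n * (char M (t / a) - 1) - \<i> * of_real (\<theta> * t * (centering (cdf M) n / a))"
    unfolding G_val u_def by (simp add: centering_def algebra_simps)
  then show ?thesis unfolding split distrib_left left right by (simp add: add.commute)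
qed

end

lemma LIMSEQ_0_subseq:
  fixes f :: "nat \<Rightarrow> 'a::real_normed_vector"
  assumes "\<And>s::nat \<Rightarrow> nat. strict_mono s \<Longrightarrow> \<exists>r. strict_mono (r :: nat \<Rightarrow> nat) \<and> (\<lambda>i. f (s (r i))) \<longlonglongrightarrow> 0"
  shows "f \<longlonglongrightarrow> 0"
proof (rule ccontr)
  assume "\<not> f \<longlonglongrightarrow> 0"
  then obtain \<epsilon> where eps: "\<epsilon> > 0" and "infinite {n. \<not> dist (f n) 0 < \<epsilon>}"
    by (auto simp: tendsto_iff not_eventually INFM_iff_infinite cofinite_eq_sequentially[symmetric])
  then obtain s :: "nat \<Rightarrow> nat" where s: "\<And>n. \<not> dist (f (s n)) 0 < \<epsilon>" and "strict_mono s"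
    using enumerate_in_set enumerate_mono by (fastforce simp: strict_mono_def)
  then obtain r where "(\<lambda>i. f (s (r i))) \<longlonglongrightarrow> 0" using assms by blast
  then have "\<forall>\<^sub>F i in sequentially. dist (f (s (r i))) 0 < \<epsilon>" using eps by (rule tendstoD)
  then show False using s by (auto simp: eventually_sequentially)
qed

section \<open>Merging of the characteristic functions\<close>

locale domain_of_attraction =
  cdf_distribution \<mu> +
  R: quantile_tail \<alpha> l1 c k M\<^sub>R h\<^sub>R "\<lambda>x. measure \<mu> {x<..}" b\<^sub>R "\<lambda>s. quantile (cdf \<mu>) (1 - s)" +
  L: quantile_tail \<alpha> l1 c k M\<^sub>L h\<^sub>L "\<lambda>x. measure \<mu> {..< - x}" b\<^sub>L "\<lambda>s. - quantile (cdf \<mu>) s"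
  for \<mu> \<alpha> l1 c k M\<^sub>R h\<^sub>R b\<^sub>R M\<^sub>L h\<^sub>L b\<^sub>L +
  assumes alpha_less_2: "\<alpha> < 2"
begin

abbreviation "An n \<equiv> norming \<alpha> l1 (real n)"
abbreviation "Cn n \<equiv> centering (cdf \<mu>) n"
abbreviation "psi u t \<equiv> semistable_cf \<alpha> M\<^sub>R M\<^sub>L u t"

definition normalized_char :: "nat \<Rightarrow> real \<Rightarrow> complex" where
  "normalized_char n t = char \<mu> (t / An n) ^ n * iexp (- (t * (Cn n / An n)))"

text \<open>\<open>\<beta>\<close> is the midpoint of 1/2 and min 1 (1/\<alpha>), and
  \<open>\<gamma>\<close> is the midpoint of 1 - \<beta> and 1/2. The minimum with 1 keeps
  \<open>\<gamma>\<close> nonnegative.\<close>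

definition \<beta> :: real where "\<beta> = (1 / 2 + min 1 (1 / \<alpha>)) / 2"
definition \<gamma> :: real where "\<gamma> = (3 / 2 - \<beta>) / 2"

lemma exponents: "1 / 2 < \<beta>" "\<beta> < 1 / \<alpha>" "0 \<le> \<gamma>" "\<gamma> < 1 / 2" "\<beta> + \<gamma> > 1" "\<beta> > 0"
proof -
  have a: "1 / \<alpha> > 1 / 2" using alpha_less_2 R.alpha_pos by (simp add: field_simps)
  define m where "m = min 1 (1 / \<alpha>)"
  have m: "1 / 2 < m" "m \<le> 1" "m \<le> 1 / \<alpha>" using a by (auto simp: m_def)
  have b: "\<beta> = (1 / 2 + m) / 2" by (simp add: \<beta>_def m_def)
  show "1 / 2 < \<beta>" "\<beta> < 1 / \<alpha>" "0 \<le> \<gamma>" "\<gamma> < 1 / 2" "\<beta> + \<gamma> > 1" "\<beta> > 0"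
    using m unfolding \<gamma>_def b by (auto simp: field_simps)
qed

lemma An_at_top: "filterlim An at_top sequentially"
  by (rule filterlim_compose[OF R.A_at_top filterlim_real_sequentially])

lemma An_pos: "n \<ge> 1 \<Longrightarrow> An n > 0"
  by (rule R.A_pos) simp

lemma scaled_quantiles_bound:
  obtains K where "K > 0" "\<forall>\<^sub>F n in sequentially. \<forall>s>1. \<bar>right_quantile n (An n) s\<bar> \<le> K * s powr (- \<beta>)"
    "\<forall>\<^sub>F n in sequentially. \<forall>s>1. \<bar>left_quantile n (An n) s\<bar> \<le> K * s powr (- \<beta>)"
proof -
  obtain K1 where K1: "K1 > 0" "\<forall>\<^sub>F n in sequentially. \<forall>s. 1 \<le> s \<and> s \<le> real n / 2 \<longrightarrow>
      \<bar>quantile (cdf \<mu>) (1 - s / real n)\<bar> / An n \<le> K1 * s powr (- \<beta>)"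
    using R.scaled_quantile_bound[OF exponents(6,2)] by blast
  obtain K2 where K2: "K2 > 0" "\<forall>\<^sub>F n in sequentially. \<forall>s. 1 \<le> s \<and> s \<le> real n / 2 \<longrightarrow>
      \<bar>- quantile (cdf \<mu>) (s / real n)\<bar> / An n \<le> K2 * s powr (- \<beta>)"
    using L.scaled_quantile_bound[OF exponents(6,2)] by blast
  show ?thesis
  proof (rule that)
    show "K1 + K2 > 0" using K1 K2 by simp
    have le: "K1 * s powr (- \<beta>) \<le> (K1 + K2) * s powr (- \<beta>)" "K2 * s powr (- \<beta>) \<le> (K1 + K2) * s powr (- \<beta>)"
      "0 \<le> (K1 + K2) * s powr (- \<beta>)" for s
      using K1 K2 by (auto simp: distrib_right)
    have n1: "\<forall>\<^sub>F n in sequentially. n \<ge> (1::nat)" by (rule eventually_ge_at_top)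
    show "\<forall>\<^sub>F n in sequentially. \<forall>s>1. \<bar>right_quantile n (An n) s\<bar> \<le> (K1 + K2) * s powr (- \<beta>)"
      using K1(2) n1
    proof (eventually_elim, intro allI impI)
      fix n s assume n: "\<forall>s. 1 \<le> s \<and> s \<le> real n / 2 \<longrightarrow> \<bar>quantile (cdf \<mu>) (1 - s / real n)\<bar> / An n \<le> K1 * s powr (- \<beta>)"
        and n1: "1 \<le> n" and s: "1 < (s::real)"
      then show "\<bar>right_quantile n (An n) s\<bar> \<le> (K1 + K2) * s powr (- \<beta>)"
        using order_trans[OF n[rule_format, of s] le(1)[of s]] le(3)[of s] An_pos[OF n1]
        by (auto simp: right_quantile_def abs_divide)
    qed
    show "\<forall>\<^sub>F n in sequentially. \<forall>s>1. \<bar>left_quantile n (An n) s\<bar> \<le> (K1 + K2) * s powr (- \<beta>)"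
      using K2(2) n1
    proof (eventually_elim, intro allI impI)
      fix n s assume n: "\<forall>s. 1 \<le> s \<and> s \<le> real n / 2 \<longrightarrow> \<bar>- quantile (cdf \<mu>) (s / real n)\<bar> / An n \<le> K2 * s powr (- \<beta>)"
        and n1: "1 \<le> n" and s: "1 < (s::real)"
      then show "\<bar>left_quantile n (An n) s\<bar> \<le> (K1 + K2) * s powr (- \<beta>)"
        using order_trans[OF n[rule_format, of s] le(2)[of s]] le(3)[of s] An_pos[OF n1]
        by (auto simp: left_quantile_def abs_divide)
    qed
  qed
qed

text \<open>n * |char - 1| is bounded by the uncentred integrals, of order n powr \<gamma>; squaring
  and dividing by n gives the exponent 2 * \<gamma> - 1 < 0. So the compound Poisson approximation
  has vanishing error, uniformly for bounded frequencies.\<close>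

lemma char_deviation_bound:
  assumes B: "B \<ge> 0"
  shows "\<exists>E. \<forall>\<^sub>F n in sequentially. \<forall>t. \<bar>t\<bar> \<le> B \<longrightarrow>
    real n * norm (char \<mu> (t / An n) - 1) ^ 2 \<le> E * real n powr (2 * \<gamma> - 1)"
proof -
  obtain K where K: "K > 0" "\<forall>\<^sub>F n in sequentially. \<forall>s>1. \<bar>right_quantile n (An n) s\<bar> \<le> K * s powr (- \<beta>)"
    "\<forall>\<^sub>F n in sequentially. \<forall>s>1. \<bar>left_quantile n (An n) s\<bar> \<le> K * s powr (- \<beta>)"
    using scaled_quantiles_bound by blast
  define W where "W = (LBINT s. indicator {1<..} s * s powr (- (\<beta> + \<gamma>)))"
  have W: "W \<ge> 0" unfolding W_def by (intro integral_nonneg_AE) (auto simp: indicator_def)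
  define E where "E = 2 * (2 + B * K * W)"
  show ?thesis
  proof (rule exI[of _ "E\<^sup>2"])
    show "\<forall>\<^sub>F n in sequentially. \<forall>t. \<bar>t\<bar> \<le> B \<longrightarrow>
        real n * norm (char \<mu> (t / An n) - 1) ^ 2 \<le> E\<^sup>2 * real n powr (2 * \<gamma> - 1)"
      using K(2,3) eventually_ge_at_top[of 2]
    proof (eventually_elim, intro allI impI)
      fix n :: nat and t :: real
      assume elim: "\<forall>s>1. \<bar>right_quantile n (An n) s\<bar> \<le> K * s powr (- \<beta>)"
          "\<forall>s>1. \<bar>left_quantile n (An n) s\<bar> \<le> K * s powr (- \<beta>)" "2 \<le> n"
        and t: "\<bar>t\<bar> \<le> B"
      have n1: "real n \<ge> 1" using elim by simp
      have ng: "real n powr \<gamma> \<ge> 1" using n1 exponents by (intro ge_one_powr_ge_zero) auto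
      note d = char_decomposition[OF elim(3), of t "An n" 0]
      have bnd: "norm (CLBINT s:{0<..}. levy_integrand 0 q (t') s) \<le> E / 2 * real n powr \<gamma>"
        if q: "q \<in> borel_measurable borel" "\<And>s. s > 1 \<Longrightarrow> \<bar>q s\<bar> \<le> K * s powr (- \<beta>)" "\<And>s. s \<ge> real n \<Longrightarrow> q s = 0"
          and t': "\<bar>t'\<bar> \<le> B" for q t'
      proof -
        have "(\<lambda>s. indicator {0<..} s * q s) \<in> borel_measurable borel" using q(1) by measurable
        then have "norm (CLBINT s:{0<..}. levy_integrand 0 q t' s) \<le> 2 + \<bar>t'\<bar> * K * real n powr \<gamma> * W"
          unfolding W_def by (rule uncentered_levy_integral_bound) (use q K n1 exponents in auto)
        also have "\<dots> \<le> 2 * real n powr \<gamma> + B * K * real n powr \<gamma> * W"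
          using ng t' K W by (intro add_mono mult_right_mono) auto
        also have "\<dots> = E / 2 * real n powr \<gamma>" by (simp add: E_def algebra_simps)
        finally show ?thesis .
      qed
      have "norm (of_nat n * (char \<mu> (t / An n) - 1)) \<le> E / 2 * real n powr \<gamma> + E / 2 * real n powr \<gamma>"
      proof -
        have "of_nat n * (char \<mu> (t / An n) - 1) =
           (CLBINT s:{0<..}. levy_integrand 0 (right_quantile n (An n)) t s) +
           (CLBINT s:{0<..}. levy_integrand 0 (left_quantile n (An n)) (- t) s)"
          using d by simp
        moreover have "norm (CLBINT s:{0<..}. levy_integrand 0 (right_quantile n (An n)) t s) \<le> E / 2 * real n powr \<gamma>"
          using elim t by (intro bnd scaled_quantile_measurable) (auto simp: right_quantile_def)
        moreover have "norm (CLBINT s:{0<..}. levy_integrand 0 (left_quantile n (An n)) (- t) s) \<le> E / 2 * real n powr \<gamma>"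
          using elim t by (intro bnd scaled_quantile_measurable) (auto simp: left_quantile_def)
        ultimately show ?thesis using norm_triangle_mono by metis
      qed
      then have "real n * norm (char \<mu> (t / An n) - 1) \<le> E * real n powr \<gamma>"
        by (simp add: norm_mult)
      then have "(real n * norm (char \<mu> (t / An n) - 1))\<^sup>2 \<le> (E * real n powr \<gamma>)\<^sup>2"
        by (intro power_mono) auto
      then have "real n * (real n * norm (char \<mu> (t / An n) - 1) ^ 2) \<le> E\<^sup>2 * real n powr (2 * \<gamma>)"
        using n1 by (simp add: power_mult_distrib power2_eq_square powr_add[symmetric] mult_ac)
      then have "real n * norm (char \<mu> (t / An n) - 1) ^ 2 \<le> E\<^sup>2 * real n powr (2 * \<gamma>) / real n"
        using n1 by (simp add: field_simps)
      also have "\<dots> = E\<^sup>2 * real n powr (2 * \<gamma> - 1)" using n1 by (simp add: powr_diff)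
      finally show "real n * norm (char \<mu> (t / An n) - 1) ^ 2 \<le> E\<^sup>2 * real n powr (2 * \<gamma> - 1)" .
    qed
  qed
qed

lemma normalized_char_approx:
  assumes n: "n \<ge> 1"
  shows "norm (normalized_char n t - exp (of_nat n * (char \<mu> (t / An n) - 1) - \<i> * of_real (t * (Cn n / An n))))
    \<le> exp 2 * (real n * norm (char \<mu> (t / An n) - 1) ^ 2)"
proof -
  have "normalized_char n t - exp (of_nat n * (char \<mu> (t / An n) - 1) - \<i> * of_real (t * (Cn n / An n))) =
    (char \<mu> (t / An n) ^ n - exp (of_nat n * (char \<mu> (t / An n) - 1))) * iexp (- (t * (Cn n / An n)))"
  proof -
    have "exp (of_nat n * (char \<mu> (t / An n) - 1) - \<i> * of_real (t * (Cn n / An n))) =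
        exp (of_nat n * (char \<mu> (t / An n) - 1)) * iexp (- (t * (Cn n / An n)))"
      by (simp only: diff_conv_add_uminus exp_add of_real_minus mult_minus_right)
    then show ?thesis by (simp only: normalized_char_def left_diff_distrib)
  qed
  then show ?thesis using power_exp_approx[OF cmod_char_le_1, of "t / An n" n]
    by (simp add: norm_mult)
qed

text \<open>The compound Poisson exponent converges by domination, and replacing the n-th power
  costs a vanishing error. The indices \<open>m\<close> need not be those in
  \<open>position_param\<close>, so that every u > 0 can be reached later.\<close>

lemma normalized_char_tendsto:
  fixes n m :: "nat \<Rightarrow> nat"
  assumes n: "filterlim n at_top sequentially" and m: "filterlim m at_top sequentially"
    and u: "(\<lambda>i. real (n i) / real (k (m i))) \<longlonglongrightarrow> u" "u > 0" and t: "t \<longlonglongrightarrow> t'"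
  shows "(\<lambda>i. normalized_char (n i) (t i)) \<longlonglongrightarrow> psi u t'"
proof -
  obtain K where K: "K > 0" "\<forall>\<^sub>F n in sequentially. \<forall>s>1. \<bar>right_quantile n (An n) s\<bar> \<le> K * s powr (- \<beta>)"
    "\<forall>\<^sub>F n in sequentially. \<forall>s>1. \<bar>left_quantile n (An n) s\<bar> \<le> K * s powr (- \<beta>)"
    using scaled_quantiles_bound by blast
  have nreal: "filterlim (\<lambda>i. real (n i)) at_top sequentially"
    by (rule filterlim_compose[OF filterlim_real_sequentially n])
  have rmeas: "(\<lambda>s. indicator {0<..} s * right_quantile n (An n) s) \<in> borel_measurable borel"
    and lmeas: "(\<lambda>s. indicator {0<..} s * left_quantile n (An n) s) \<in> borel_measurable borel" for n
    using scaled_quantile_measurable[of n "An n"] by measurable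
  define Z where "Z i = (CLBINT s:{0<..}. levy_integrand 1 (right_quantile (n i) (An (n i))) (t i) s) +
      (CLBINT s:{0<..}. levy_integrand 1 (left_quantile (n i) (An (n i))) (- t i) s)" for i
  have Z: "Z \<longlonglongrightarrow> levy_exponent \<alpha> M\<^sub>R M\<^sub>L u t'"
    unfolding Z_def levy_exponent_def
  proof (intro tendsto_add levy_integral_tendsto rmeas lmeas R.levy_inverse_measurable L.levy_inverse_measurable u t tendsto_minus)
    show "AE s in lborel. 0 < s \<longrightarrow> (\<lambda>i. right_quantile (n i) (An (n i)) s) \<longlonglongrightarrow> levy_inverse \<alpha> M\<^sub>R u s"
      using R.scaled_quantile_tendsto[OF n m u]
    proof eventually_elim
      case (elim s)
      show ?case
      proof
        assume s: "0 < s"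
        have "\<forall>\<^sub>F i in sequentially. real (n i) > 2 * s" using nreal by (simp add: filterlim_at_top_dense)
        then have "\<forall>\<^sub>F i in sequentially. quantile (cdf \<mu>) (1 - s / real (n i)) / An (n i) = right_quantile (n i) (An (n i)) s"
          by eventually_elim (use s in \<open>auto simp: right_quantile_def\<close>)
        with elim s show "(\<lambda>i. right_quantile (n i) (An (n i)) s) \<longlonglongrightarrow> levy_inverse \<alpha> M\<^sub>R u s"
          by (blast intro: Lim_transform_eventually)
      qed
    qed
    show "AE s in lborel. 0 < s \<longrightarrow> (\<lambda>i. left_quantile (n i) (An (n i)) s) \<longlonglongrightarrow> levy_inverse \<alpha> M\<^sub>L u s"
      using L.scaled_quantile_tendsto[OF n m u]
    proof eventually_elim
      case (elim s)
      show ?case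
      proof
        assume s: "0 < s"
        have "\<forall>\<^sub>F i in sequentially. real (n i) > 2 * s" using nreal by (simp add: filterlim_at_top_dense)
        then have "\<forall>\<^sub>F i in sequentially. - quantile (cdf \<mu>) (s / real (n i)) / An (n i) = left_quantile (n i) (An (n i)) s"
          by eventually_elim (use s in \<open>auto simp: left_quantile_def\<close>)
        with elim s show "(\<lambda>i. left_quantile (n i) (An (n i)) s) \<longlonglongrightarrow> levy_inverse \<alpha> M\<^sub>L u s"
          by (blast intro: Lim_transform_eventually)
      qed
    qed
    show "\<forall>\<^sub>F i in sequentially. \<forall>s>1. \<bar>right_quantile (n i) (An (n i)) s\<bar> \<le> K * s powr (- \<beta>)"
      using eventually_compose_filterlim[OF K(2) n] .
    show "\<forall>\<^sub>F i in sequentially. \<forall>s>1. \<bar>left_quantile (n i) (An (n i)) s\<bar> \<le> K * s powr (- \<beta>)"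
      using eventually_compose_filterlim[OF K(3) n] .
  qed (use exponents K in auto)
  have n2: "\<forall>\<^sub>F i in sequentially. n i \<ge> 2" using n by (simp add: filterlim_at_top)
  obtain B where B: "\<And>i. \<bar>t i\<bar> \<le> B"
    using convergent_imp_Bseq[of t] t unfolding Bseq_def convergent_def by force
  have "(\<lambda>i. exp (Z i)) \<longlonglongrightarrow> psi u t'"
    unfolding semistable_cf_eq by (intro tendsto_exp Z)
  moreover have "(\<lambda>i. normalized_char (n i) (t i) - exp (Z i)) \<longlonglongrightarrow> 0"
  proof (rule Lim_null_comparison)
    show "\<forall>\<^sub>F i in sequentially. norm (normalized_char (n i) (t i) - exp (Z i)) \<le>
        exp 2 * (real (n i) * norm (char \<mu> (t i / An (n i)) - 1) ^ 2)"
      using n2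
    proof eventually_elim
      case (elim i)
      have "Z i = of_nat (n i) * (char \<mu> (t i / An (n i)) - 1) - \<i> * of_real (t i * (Cn (n i) / An (n i)))"
        using char_decomposition[OF elim, of "t i" "An (n i)" 1] by (simp add: Z_def)
      then show ?case using normalized_char_approx[of "n i" "t i"] elim by simp
    qed
    show "(\<lambda>i. exp 2 * (real (n i) * norm (char \<mu> (t i / An (n i)) - 1) ^ 2)) \<longlonglongrightarrow> 0"
    proof -
      have "B \<ge> 0" using B[of 0] by linarith
      then obtain E where E: "\<forall>\<^sub>F n in sequentially. \<forall>t. \<bar>t\<bar> \<le> B \<longrightarrow>
          real n * norm (char \<mu> (t / An n) - 1) ^ 2 \<le> E * real n powr (2 * \<gamma> - 1)"
        using char_deviation_bound by blast
      have "(\<lambda>i. E * real (n i) powr (2 * \<gamma> - 1)) \<longlonglongrightarrow> E * 0"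
        using exponents(4) by (intro tendsto_mult tendsto_const tendsto_neg_powr nreal) auto
      then have "(\<lambda>i. E * real (n i) powr (2 * \<gamma> - 1)) \<longlonglongrightarrow> 0" by simp
      then have "(\<lambda>i. real (n i) * norm (char \<mu> (t i / An (n i)) - 1) ^ 2) \<longlonglongrightarrow> 0"
      proof (rule Lim_null_comparison[rotated])
        show "\<forall>\<^sub>F i in sequentially. norm (real (n i) * norm (char \<mu> (t i / An (n i)) - 1) ^ 2)
            \<le> E * real (n i) powr (2 * \<gamma> - 1)"
          using eventually_compose_filterlim[OF E n] by eventually_elim (use B in auto)
      qed
      then show ?thesis by (rule tendsto_mult_right_zero)
    qed
  qed
  ultimately show ?thesis using tendsto_add by fastforce
qed

lemma psi_tendsto:
  assumes v: "v \<longlonglongrightarrow> u" "u > 0" and t: "t \<longlonglongrightarrow> t'"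
  shows "(\<lambda>i. psi (v i) (t i)) \<longlonglongrightarrow> psi u t'"
proof -
  \<comment> \<open>The finitely many nonpositive parameters are replaced by \<open>u\<close>, since
    the bounds on the inverses require positivity.\<close>
  define w where "w i = (if v i > 0 then v i else u)" for i
  have pos: "\<forall>\<^sub>F i in sequentially. v i > 0" using v by (rule order_tendstoD)
  have wv: "\<forall>\<^sub>F i in sequentially. v i = w i" using pos by eventually_elim (simp add: w_def)
  have w: "w \<longlonglongrightarrow> u" using v(1) wv by (rule Lim_transform_eventually)
  have w0: "w i > 0" for i using v by (simp add: w_def)
  have split: "(b / s) powr (1 / \<alpha>) = b powr (1 / \<alpha>) * s powr (- (1 / \<alpha>))" if "b > 0" "s > 1" for b s :: real
    using that by (simp add: powr_divide powr_minus_divide)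
  have a: "1 / \<alpha> > 1 / 2" using alpha_less_2 R.alpha_pos by (simp add: field_simps)
  have "(\<lambda>i. psi (w i) (t i)) \<longlonglongrightarrow> psi u t'"
    unfolding semistable_cf_eq levy_exponent_def
  proof (intro tendsto_exp tendsto_add levy_integral_tendsto tendsto_minus t
      R.levy_inverse_measurable L.levy_inverse_measurable w0 v R.levy_inverse_continuous L.levy_inverse_continuous w)
    show "\<forall>\<^sub>F i in sequentially. \<forall>s>1. \<bar>levy_inverse \<alpha> M\<^sub>R (w i) s\<bar> \<le> b\<^sub>R powr (1 / \<alpha>) * s powr (- (1 / \<alpha>))"
    proof (intro always_eventually allI impI)
      fix i and s :: real assume s: "s > 1"
      then have "0 \<le> levy_inverse \<alpha> M\<^sub>R (w i) s" "levy_inverse \<alpha> M\<^sub>R (w i) s \<le> (b\<^sub>R / s) powr (1 / \<alpha>)"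
        by (intro R.levy_inverse_nonneg R.levy_inverse_upper w0; simp)+
      then show "\<bar>levy_inverse \<alpha> M\<^sub>R (w i) s\<bar> \<le> b\<^sub>R powr (1 / \<alpha>) * s powr (- (1 / \<alpha>))"
        using split[OF R.b_pos s] by simp
    qed
    show "\<forall>\<^sub>F i in sequentially. \<forall>s>1. \<bar>levy_inverse \<alpha> M\<^sub>L (w i) s\<bar> \<le> b\<^sub>L powr (1 / \<alpha>) * s powr (- (1 / \<alpha>))"
    proof (intro always_eventually allI impI)
      fix i and s :: real assume s: "s > 1"
      then have "0 \<le> levy_inverse \<alpha> M\<^sub>L (w i) s" "levy_inverse \<alpha> M\<^sub>L (w i) s \<le> (b\<^sub>L / s) powr (1 / \<alpha>)"
        by (intro L.levy_inverse_nonneg L.levy_inverse_upper w0; simp)+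
      then show "\<bar>levy_inverse \<alpha> M\<^sub>L (w i) s\<bar> \<le> b\<^sub>L powr (1 / \<alpha>) * s powr (- (1 / \<alpha>))"
        using split[OF L.b_pos s] by simp
    qed
  qed (use a in auto)
  moreover have "\<forall>\<^sub>F i in sequentially. psi (w i) (t i) = psi (v i) (t i)" using wv by eventually_elim simp
  ultimately show ?thesis by (rule Lim_transform_eventually)
qed

text \<open>Frequency and position subconverge by compactness, and both terms then have the same
  limit. As the bounded sequence \<open>t\<close> is arbitrary, this is local uniformity in
  sequential form.\<close>

lemma normalized_char_merge:
  assumes t: "\<And>n. \<bar>t n\<bar> \<le> B"
  shows "(\<lambda>n. normalized_char n (t n) - psi (position_param k n) (t n)) \<longlonglongrightarrow> 0"
proof (rule LIMSEQ_0_subseq)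
  fix s :: "nat \<Rightarrow> nat" assume s: "strict_mono s"
  have "seq_compact {-B..B}" using compact_Icc compact_imp_seq_compact by blast
  moreover have "\<forall>n. t (s n) \<in> {-B..B}" using t by (auto simp: abs_le_iff minus_le_iff)
  ultimately obtain t' r1 where r1: "strict_mono r1" "((\<lambda>i. t (s i)) \<circ> r1) \<longlonglongrightarrow> t'"
    unfolding seq_compact_def by metis
  have sr1: "filterlim (\<lambda>i. s (r1 i)) at_top sequentially"
    using filterlim_compose[OF filterlim_subseq[OF s] filterlim_subseq[OF r1(1)]] .
  obtain r2 u where r2: "strict_mono r2" "u > 0" "(\<lambda>i. position_param k (s (r1 (r2 i)))) \<longlonglongrightarrow> u"
    using R.position_param_subseq[OF sr1] by blast
  have tt: "(\<lambda>i. t (s (r1 (r2 i)))) \<longlonglongrightarrow> t'"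
    using LIMSEQ_subseq_LIMSEQ[OF r1(2) r2(1)] by (simp add: comp_def)
  have n: "filterlim (\<lambda>i. s (r1 (r2 i))) at_top sequentially"
    using filterlim_compose[OF sr1 filterlim_subseq[OF r2(1)]] .
  have m: "filterlim (\<lambda>i. R.block (s (r1 (r2 i)))) at_top sequentially"
    using filterlim_compose[OF R.block_at_top n] .
  have "(\<lambda>i. normalized_char (s (r1 (r2 i))) (t (s (r1 (r2 i)))) - psi (position_param k (s (r1 (r2 i)))) (t (s (r1 (r2 i)))))
      \<longlonglongrightarrow> psi u t' - psi u t'"
    by (intro tendsto_diff normalized_char_tendsto[OF n m] psi_tendsto r2 tt)
       (use r2(3) in \<open>simp add: R.position_param_eq\<close>)
  then show "\<exists>r. strict_mono (r :: nat \<Rightarrow> nat) \<and>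
      (\<lambda>i. normalized_char (s (r i)) (t (s (r i))) - psi (position_param k (s (r i))) (t (s (r i)))) \<longlonglongrightarrow> 0"
    using r1(1) r2(1) by (intro exI[of _ "\<lambda>i. r1 (r2 i)"]) (auto simp: strict_mono_def)
qed

end

section \<open>Decay of the characteristic functions\<close>

text \<open>By comparison with 1 / (1 + t^2). The weight 1 + |t| is carried along for the Lipschitz
  constants of the densities.\<close>

lemma stretched_exponential_integrable:
  assumes "\<kappa> > 0" "p > 0"
  shows "integrable lborel (\<lambda>t::real. (1 + \<bar>t\<bar>) * exp (- (\<kappa> * \<bar>t\<bar> powr p)))"
proof -
  have "((\<lambda>t::real. (1 + t) * (1 + t\<^sup>2) * exp (- (\<kappa> * t powr p))) \<longlongrightarrow> 0) at_top"
    using assms by real_asymp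
  then have "\<forall>\<^sub>F t::real in at_top. (1 + t) * (1 + t\<^sup>2) * exp (- (\<kappa> * t powr p)) < 1"
    by (rule order_tendstoD) simp
  then obtain T where T: "\<And>t::real. t \<ge> T \<Longrightarrow> (1 + t) * (1 + t\<^sup>2) * exp (- (\<kappa> * t powr p)) < 1"
    by (auto simp: eventually_at_top_linorder)
  define B where "B = 1 + (1 + \<bar>T\<bar>) * (1 + T\<^sup>2)"
  have B: "(1 + t) * (1 + t\<^sup>2) * exp (- (\<kappa> * t powr p)) \<le> B" if t: "t \<ge> 0" for t :: real
  proof (cases "t \<ge> T")
    case True
    have "0 \<le> (1 + \<bar>T\<bar>) * (1 + T\<^sup>2)" by simp
    then show ?thesis using T[OF True] unfolding B_def by linarith
  next
    case False
    have "(1 + t) * (1 + t\<^sup>2) * exp (- (\<kappa> * t powr p)) \<le> (1 + t) * (1 + t\<^sup>2) * 1"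
      using t assms by (intro mult_left_mono) auto
    also have "\<dots> \<le> (1 + \<bar>T\<bar>) * (1 + T\<^sup>2) * 1"
      using t False by (intro mult_mono add_mono power_mono) (auto simp: power2_le_iff_abs_le)
    finally show ?thesis by (simp add: B_def)
  qed
  have "integrable lborel (\<lambda>t::real. inverse (1 + t\<^sup>2))"
    using integrable_inverse_1_plus_square by (simp add: set_integrable_def)
  then have "integrable lborel (\<lambda>t::real. B * inverse (1 + t\<^sup>2))" by (rule integrable_mult_right)
  then show ?thesis
  proof (rule Bochner_Integration.integrable_bound)
    show "AE t in lborel. norm ((1 + \<bar>t\<bar>) * exp (- (\<kappa> * \<bar>t\<bar> powr p))) \<le> norm (B * inverse (1 + t\<^sup>2))"
    proof (rule AE_I2)
      fix t :: real
      have p: "1 + t\<^sup>2 > 0" by (simp add: add_pos_nonneg)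
      have "B \<ge> 0" by (simp add: B_def)
      moreover have "(1 + \<bar>t\<bar>) * exp (- (\<kappa> * \<bar>t\<bar> powr p)) \<le> B * inverse (1 + t\<^sup>2)"
        using B[of "\<bar>t\<bar>"] p by (simp add: field_simps)
      ultimately show "norm ((1 + \<bar>t\<bar>) * exp (- (\<kappa> * \<bar>t\<bar> powr p))) \<le> norm (B * inverse (1 + t\<^sup>2))"
        using p by (simp add: abs_mult)
    qed
  qed measurable
qed

section \<open>Decay of the limits, uniformly in the parameter\<close>

context semistable_profile
begin

lemma levy_integrand_integrable:
  assumes u: "u > 0" and a2: "\<alpha> < 2"
  shows "integrable lborel (\<lambda>s. indicator {0<..} s *\<^sub>R levy_integrand 1 (levy_inverse \<alpha> M u) t s)"
proof (rule Bochner_Integration.integrable_bound)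
  have "1 / \<alpha> > 1 / 2" using a2 alpha_pos by (simp add: field_simps)
  then show "integrable lborel (levy_dominant ((\<bar>t\<bar> * b powr (1 / \<alpha>))\<^sup>2 / 2) (1 / \<alpha>))" by (rule levy_dominant_integrable)
  show "AE s in lborel. norm (indicator {0<..} s *\<^sub>R levy_integrand 1 (levy_inverse \<alpha> M u) t s)
      \<le> norm (levy_dominant ((\<bar>t\<bar> * b powr (1 / \<alpha>))\<^sup>2 / 2) (1 / \<alpha>) s)"
  proof (rule AE_I2)
    fix s :: real
    show "norm (indicator {0<..} s *\<^sub>R levy_integrand 1 (levy_inverse \<alpha> M u) t s)
      \<le> norm (levy_dominant ((\<bar>t\<bar> * b powr (1 / \<alpha>))\<^sup>2 / 2) (1 / \<alpha>) s)"
    proof (cases "s > 0")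
      case True
      have "norm (levy_integrand 1 (levy_inverse \<alpha> M u) t s) \<le> levy_dominant ((\<bar>t\<bar> * b powr (1 / \<alpha>))\<^sup>2 / 2) (1 / \<alpha>) s"
      proof (rule levy_integrand_le_dominant[OF True])
        have "\<bar>levy_inverse \<alpha> M u s\<bar> \<le> (b / s) powr (1 / \<alpha>)"
          using levy_inverse_nonneg[OF u True] levy_inverse_upper[OF u True] by simp
        also have "\<dots> = b powr (1 / \<alpha>) * s powr (- (1 / \<alpha>))"
          using True b_pos by (simp add: powr_divide powr_minus_divide)
        finally show "\<bar>levy_inverse \<alpha> M u s\<bar> \<le> b powr (1 / \<alpha>) * s powr (- (1 / \<alpha>))" .
      qed auto
      then show ?thesis using True by simp
    qed simp
  qed
  show "(\<lambda>s. indicator {0<..} s *\<^sub>R levy_integrand 1 (levy_inverse \<alpha> M u) t s) \<in> borel_measurable lborel"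
    by (rule levy_integrand_measurable[OF levy_inverse_measurable[OF u]])
qed

text \<open>The centering is purely imaginary and drops out. What remains has a sign, so one tail
  can be discarded when the other already provides decay.\<close>

lemma Re_levy_integral:
  assumes u: "u > 0" and a2: "\<alpha> < 2"
  shows "Re (CLBINT s:{0<..}. levy_integrand 1 (levy_inverse \<alpha> M u) t s) =
      - (LBINT s. indicator {0<..} s * (1 - cos (t * levy_inverse \<alpha> M u s)))"
    and "integrable lborel (\<lambda>s. indicator {0<..} s * (1 - cos (t * levy_inverse \<alpha> M u s)))"
proof -
  note I = levy_integrand_integrable[OF u a2, of t]
  have e: "Re (indicator {0<..} s *\<^sub>R levy_integrand 1 (levy_inverse \<alpha> M u) t s) =
      - (indicator {0<..} s * (1 - cos (t * levy_inverse \<alpha> M u s)))" for s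
    by (simp add: levy_integrand_def Re_exp indicator_def)
  have "integrable lborel (\<lambda>s. - (indicator {0<..} s * (1 - cos (t * levy_inverse \<alpha> M u s))))"
    using integrable_Re[OF I] unfolding e .
  then show "integrable lborel (\<lambda>s. indicator {0<..} s * (1 - cos (t * levy_inverse \<alpha> M u s)))"
    by simp
  show "Re (CLBINT s:{0<..}. levy_integrand 1 (levy_inverse \<alpha> M u) t s) =
      - (LBINT s. indicator {0<..} s * (1 - cos (t * levy_inverse \<alpha> M u s)))"
    unfolding set_lebesgue_integral_def integral_Re[OF I, symmetric] e by simp
qed

lemma Re_levy_integral_nonpos:
  assumes "u > 0" "\<alpha> < 2"
  shows "Re (CLBINT s:{0<..}. levy_integrand 1 (levy_inverse \<alpha> M u) t s) \<le> 0"
  unfolding Re_levy_integral(1)[OF assms] by (simp add: integral_nonneg_AE)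

text \<open>The inverse at s lies between (a / s)^(1/\<alpha>) and (b / s)^(1/\<alpha>). For s
  between S and 2 * S with S = b * |t|^\<alpha>, its product with |t| therefore lies in [r, 1],
  where 1 - cos is at least 1 - cos r. This window has length S, which produces |t|^\<alpha>;
  \<open>a\<close> and \<open>b\<close> do not depend on \<open>u\<close>.\<close>

lemma Re_levy_integral_le:
  assumes a: "a > 0" "\<And>x. x > 0 \<Longrightarrow> a \<le> M x" and a2: "\<alpha> < 2"
  shows "\<exists>\<kappa>>0. \<forall>u>0. \<forall>t. Re (CLBINT s:{0<..}. levy_integrand 1 (levy_inverse \<alpha> M u) t s) \<le> - (\<kappa> * \<bar>t\<bar> powr \<alpha>)"
proof -
  define r where "r = (a / (2 * b)) powr (1 / \<alpha>)"
  have ab: "a \<le> b" using a(2)[of 1] M_le[of 1] by simp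
  have r: "0 < r" "r \<le> 1" using a ab b_pos alpha_pos by (auto simp: r_def intro!: powr_le1)
  have "cos r < cos 0" using r pi_gt3 by (intro cos_monotone_0_pi) auto
  then have cr: "1 - cos r > 0" by simp
  show ?thesis
  proof (intro exI[of _ "(1 - cos r) * b"] conjI allI impI)
    show "(1 - cos r) * b > 0" using cr b_pos by simp
    fix u t :: real assume u: "u > 0"
    show "Re (CLBINT s:{0<..}. levy_integrand 1 (levy_inverse \<alpha> M u) t s) \<le> - ((1 - cos r) * b * \<bar>t\<bar> powr \<alpha>)"
    proof (cases "t = 0")
      case True
      then show ?thesis using Re_levy_integral_nonpos[OF u a2, of t] by simp
    next
      case False
      define S where "S = b * \<bar>t\<bar> powr \<alpha>"
      have S: "S > 0" using False b_pos by (simp add: S_def)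
      have tS: "\<bar>t\<bar> = (S / b) powr (1 / \<alpha>)" using False b_pos alpha_pos by (simp add: S_def powr_powr)
      have pt: "(1 - cos r) * indicator {S<..2 * S} s \<le> indicator {0<..} s * (1 - cos (t * levy_inverse \<alpha> M u s))" for s
      proof (cases "s \<in> {S<..2 * S}")
        case True
        then have s: "s > 0" "S \<le> s" "s \<le> 2 * S" using S by auto
        define R where "R = levy_inverse \<alpha> M u s"
        have R: "(a / s) powr (1 / \<alpha>) \<le> R" "R \<le> (b / s) powr (1 / \<alpha>)"
          unfolding R_def using levy_inverse_lower[OF u s(1) a] levy_inverse_upper[OF u s(1)] by auto
        have R0: "R \<ge> 0" unfolding R_def by (rule levy_inverse_nonneg[OF u s(1)])
        have "\<bar>t\<bar> * R \<le> (S / b) powr (1 / \<alpha>) * (b / s) powr (1 / \<alpha>)"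
          unfolding tS using R by (intro mult_left_mono) auto
        also have "\<dots> = (S / s) powr (1 / \<alpha>)" using S b_pos s by (simp add: powr_mult[symmetric])
        also have "\<dots> \<le> 1" using S s alpha_pos by (intro powr_le1) auto
        finally have up: "\<bar>t\<bar> * R \<le> 1" .
        have "r \<le> (S / b * (a / s)) powr (1 / \<alpha>)"
          unfolding r_def using a b_pos S s alpha_pos by (intro powr_mono2) (auto simp: field_simps)
        also have "\<dots> = (S / b) powr (1 / \<alpha>) * (a / s) powr (1 / \<alpha>)"
          by (rule powr_mult)
        also have "\<dots> \<le> \<bar>t\<bar> * R" unfolding tS using R by (intro mult_left_mono) auto
        finally have lo: "r \<le> \<bar>t\<bar> * R" .
        have "cos (t * R) = cos (\<bar>t\<bar> * R)" by (cases "t \<ge> 0") auto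
        also have "\<dots> \<le> cos r" using r lo up pi_gt3 by (intro cos_monotone_0_pi_le) auto
        finally show ?thesis using True s by (simp add: R_def)
      qed simp
      have "(1 - cos r) * S = (LBINT s. (1 - cos r) * indicator {S<..2 * S} s)"
        using S by simp
      also have "\<dots> \<le> (LBINT s. indicator {0<..} s * (1 - cos (t * levy_inverse \<alpha> M u s)))"
        using S by (intro integral_mono Re_levy_integral(2)[OF u a2] pt) auto
      finally show ?thesis unfolding Re_levy_integral(1)[OF u a2] by (simp add: S_def mult.assoc)
    qed
  qed
qed

end

section \<open>Decay of the normalized characteristic functions\<close>

locale nonlattice_attraction = domain_of_attraction +
  assumes nontrivial: "(\<exists>a>0. \<forall>x>0. a \<le> M\<^sub>R x) \<or> (\<exists>a>0. \<forall>x>0. a \<le> M\<^sub>L x)"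
    and char_less_1: "\<And>v. v \<noteq> 0 \<Longrightarrow> norm (char \<mu> v) < 1"
begin

lemma psi_norm_le: "\<exists>\<kappa>>0. \<forall>u>0. \<forall>t. norm (psi u t) \<le> exp (- (\<kappa> * \<bar>t\<bar> powr \<alpha>))"
proof -
  have e: "norm (psi u t) = exp (Re (CLBINT s:{0<..}. levy_integrand 1 (levy_inverse \<alpha> M\<^sub>R u) t s) +
      Re (CLBINT s:{0<..}. levy_integrand 1 (levy_inverse \<alpha> M\<^sub>L u) (- t) s))" for u t
    by (simp add: semistable_cf_eq levy_exponent_def norm_exp_eq_Re)
  from nontrivial show ?thesis
  proof
    assume "\<exists>a>0. \<forall>x>0. a \<le> M\<^sub>R x"
    then obtain \<kappa> where k: "\<kappa> > 0" "\<And>u t. u > 0 \<Longrightarrow> Re (CLBINT s:{0<..}. levy_integrand 1 (levy_inverse \<alpha> M\<^sub>R u) t s) \<le> - (\<kappa> * \<bar>t\<bar> powr \<alpha>)"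
      using R.Re_levy_integral_le[OF _ _ alpha_less_2] by metis
    show ?thesis
    proof (intro exI[of _ \<kappa>] conjI allI impI k(1))
      fix u t :: real assume u: "u > 0"
      show "norm (psi u t) \<le> exp (- (\<kappa> * \<bar>t\<bar> powr \<alpha>))"
        unfolding e using k(2)[OF u, of t] L.Re_levy_integral_nonpos[OF u alpha_less_2, of "- t"] by simp
    qed
  next
    assume "\<exists>a>0. \<forall>x>0. a \<le> M\<^sub>L x"
    then obtain \<kappa> where k: "\<kappa> > 0" "\<And>u t. u > 0 \<Longrightarrow> Re (CLBINT s:{0<..}. levy_integrand 1 (levy_inverse \<alpha> M\<^sub>L u) t s) \<le> - (\<kappa> * \<bar>t\<bar> powr \<alpha>)"
      using L.Re_levy_integral_le[OF _ _ alpha_less_2] by metis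
    show ?thesis
    proof (intro exI[of _ \<kappa>] conjI allI impI k(1))
      fix u t :: real assume u: "u > 0"
      show "norm (psi u t) \<le> exp (- (\<kappa> * \<bar>t\<bar> powr \<alpha>))"
        unfolding e using k(2)[OF u, of "- t"] R.Re_levy_integral_nonpos[OF u alpha_less_2, of t] by simp
    qed
  qed
qed

lemma normalized_char_norm: "norm (normalized_char n t) = norm (char \<mu> (t / An n)) ^ n"
  by (simp add: normalized_char_def norm_mult norm_power)

text \<open>On the annulus the limits are at most exp (-\<kappa>), and \<open>\<rho>\<close> lies
  halfway between this and 1. Merging speaks of sequences, so for each n a frequency violating the
  bound \<open>\<rho>\<close> is selected if there is one, with default 1.\<close>

lemma normalized_char_annulus:
  "\<exists>\<kappa>>0. \<forall>\<^sub>F n in sequentially. \<forall>t. 1 \<le> \<bar>t\<bar> \<and> \<bar>t\<bar> \<le> 2 \<longrightarrow> norm (normalized_char n t) \<le> exp (- \<kappa>)"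
proof -
  obtain \<kappa> where k: "\<kappa> > 0" "\<And>u t. u > 0 \<Longrightarrow> norm (psi u t) \<le> exp (- (\<kappa> * \<bar>t\<bar> powr \<alpha>))"
    using psi_norm_le by blast
  define \<rho> where "\<rho> = (1 + exp (- \<kappa>)) / 2"
  have rho: "0 < \<rho>" "\<rho> < 1" "exp (- \<kappa>) < \<rho>" using k(1) by (auto simp: \<rho>_def field_simps add_pos_pos)
  define bad where "bad n t \<longleftrightarrow> 1 \<le> \<bar>t\<bar> \<and> \<bar>t\<bar> \<le> 2 \<and> norm (normalized_char n t) > \<rho>" for n t
  define w where "w n = (if \<exists>t. bad n t then SOME t. bad n t else 1)" for n
  have w: "bad n (w n)" if "bad n t" for n t
  proof -
    have "bad n (SOME t. bad n t)" by (rule someI[of "bad n", OF that])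
    then show ?thesis using that by (auto simp: w_def)
  qed
  have w12: "1 \<le> \<bar>w n\<bar>" "\<bar>w n\<bar> \<le> 2" for n
    using w[of n] by (cases "\<exists>t. bad n t"; force simp: w_def bad_def)+
  have "\<forall>\<^sub>F n in sequentially. dist (normalized_char n (w n) - psi (position_param k n) (w n)) 0 < \<rho> - exp (- \<kappa>)"
    using normalized_char_merge[of w 2] w12(2) rho(3) by (intro tendstoD) auto
  then have "\<forall>\<^sub>F n in sequentially. \<forall>t. 1 \<le> \<bar>t\<bar> \<and> \<bar>t\<bar> \<le> 2 \<longrightarrow> norm (normalized_char n t) \<le> \<rho>"
    using eventually_ge_at_top[of "1::nat"]
  proof (eventually_elim, intro allI impI)
    fix n :: nat and t :: real
    assume d: "dist (normalized_char n (w n) - psi (position_param k n) (w n)) 0 < \<rho> - exp (- \<kappa>)"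
      and n: "1 \<le> n" and t: "1 \<le> \<bar>t\<bar> \<and> \<bar>t\<bar> \<le> 2"
    show "norm (normalized_char n t) \<le> \<rho>"
    proof (rule ccontr)
      assume neg: "\<not> norm (normalized_char n t) \<le> \<rho>"
      have "norm (psi (position_param k n) (w n)) \<le> exp (- (\<kappa> * \<bar>w n\<bar> powr \<alpha>))"
        by (rule k(2)[OF R.position_param_pos[OF n]])
      also have "\<dots> \<le> exp (- \<kappa>)"
      proof -
        have "1 \<le> \<bar>w n\<bar> powr \<alpha>" using w12(1) R.alpha_pos by (intro ge_one_powr_ge_zero) auto
        then show ?thesis using k(1) by simp
    qed
    finally have "norm (normalized_char n (w n)) < \<rho>"
      using d norm_triangle_sub[of "normalized_char n (w n)" "psi (position_param k n) (w n)"] by (simp add: dist_norm)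
    moreover have "bad n (w n)" by (rule w[of n t]) (use t neg in \<open>auto simp: bad_def\<close>)
    ultimately show False by (simp add: bad_def)
    qed
  qed
  then show ?thesis using rho by (intro exI[of _ "- ln \<rho>"]) (auto simp: ln_less_zero)
qed

text \<open>Passing from n to N summands at the same frequency raises the bound to the power N /
  n.\<close>

lemma char_power_bound:
  assumes x: "0 \<le> x" "x ^ n \<le> exp (- \<kappa>)" and n: "0 < n" and N: "0 < N"
  shows "x ^ N \<le> exp (- (\<kappa> * (real N / real n)))"
proof (cases "x = 0")
  case True
  then show ?thesis using N by (simp add: power_0_left)
next
  case False
  then have x0: "x > 0" using x by simp
  have "real n * ln x \<le> - \<kappa>"
    using x(2) x0 by (metis exp_le_cancel_iff exp_of_nat_mult exp_ln)
  then have "(real N / real n) * (real n * ln x) \<le> (real N / real n) * (- \<kappa>)"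
    by (intro mult_left_mono) auto
  then have "real N * ln x \<le> - (\<kappa> * (real N / real n))" using n by (simp add: field_simps)
  moreover have "x ^ N = exp (real N * ln x)" using x0 by (simp add: exp_of_nat_mult)
  ultimately show ?thesis by simp
qed

text \<open>For \<open>1 \<le> \<bar>u\<bar> \<le> \<eta> A\<^sub>N\<close> there is \<open>n \<le> N\<close> with \<open>u A\<^sub>n / A\<^sub>N\<close> in the annulus
  where the normalized characteristic function is bounded away from 1; Potter's bound controls \<open>N / n\<close>.\<close>

lemma normalized_char_decay:
  "\<exists>\<kappa>>0. \<exists>p>0. \<exists>\<eta>>0. \<forall>\<^sub>F N in sequentially. \<forall>u. 1 \<le> \<bar>u\<bar> \<and> \<bar>u\<bar> \<le> \<eta> * An N \<longrightarrow>
    norm (normalized_char N u) \<le> exp (- (\<kappa> * \<bar>u\<bar> powr p))"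
proof -
  obtain \<kappa> where k: "\<kappa> > 0" "\<forall>\<^sub>F n in sequentially. \<forall>t. 1 \<le> \<bar>t\<bar> \<and> \<bar>t\<bar> \<le> 2 \<longrightarrow> norm (normalized_char n t) \<le> exp (- \<kappa>)"
    using normalized_char_annulus by blast
  define b where "b = 1 / \<alpha> + 1"
  have b0: "b > 0" "b > 1 / \<alpha>" using R.alpha_pos by (auto simp: b_def add_pos_pos)
  obtain x0 K where K: "x0 \<ge> 1" "K > 0" "\<And>x y. x \<ge> x0 \<Longrightarrow> y \<ge> x \<Longrightarrow> norming \<alpha> l1 y / norming \<alpha> l1 x \<le> K * (y / x) powr b"
    using R.potter_upper[OF b0(2)] by blast
  have "(\<lambda>n. An (Suc n) / An n) \<longlonglongrightarrow> 1 powr (1 / \<alpha>)"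
  proof (rule R.A_ratio_tendsto)
    show "(\<lambda>n. real (Suc n) / real n) \<longlonglongrightarrow> 1" by real_asymp
    show "filterlim (\<lambda>n. real (Suc n)) at_top sequentially" by real_asymp
  qed (auto intro: filterlim_real_sequentially)
  then have "\<forall>\<^sub>F n in sequentially. An (Suc n) / An n < 2" by (rule order_tendstoD) simp
  then have "\<forall>\<^sub>F n in sequentially. (\<forall>t. 1 \<le> \<bar>t\<bar> \<and> \<bar>t\<bar> \<le> 2 \<longrightarrow> norm (normalized_char n t) \<le> exp (- \<kappa>)) \<and>
      An (Suc n) / An n < 2 \<and> real n \<ge> x0 \<and> n \<ge> 1"
    using k(2) filterlim_real_sequentially[unfolded filterlim_at_top, rule_format, of x0] eventually_ge_at_top[of 1]
    by eventually_elim auto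
  then obtain N1 where N1: "\<And>n t. n \<ge> N1 \<Longrightarrow> 1 \<le> \<bar>t\<bar> \<Longrightarrow> \<bar>t\<bar> \<le> 2 \<Longrightarrow> norm (normalized_char n t) \<le> exp (- \<kappa>)"
      "\<And>n. n \<ge> N1 \<Longrightarrow> An (Suc n) / An n < 2" "\<And>n. n \<ge> N1 \<Longrightarrow> real n \<ge> x0" "\<And>n. n \<ge> N1 \<Longrightarrow> n \<ge> 1"
    unfolding eventually_sequentially by blast
  \<comment> \<open>|u| \<le> \<eta> * A N says A N1 \<le> A N / |u|; this covers the case that the
    search for n stops at its lower end N1.\<close>
  define \<eta> where "\<eta> = 1 / An N1"
  have A1: "An N1 > 0" using N1(4)[of N1] by (intro An_pos) simp
  define \<kappa>' where "\<kappa>' = \<kappa> * (1 / (2 * K)) powr (1 / b)"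
  have main: "norm (normalized_char N u) \<le> exp (- (\<kappa>' * \<bar>u\<bar> powr (1 / b)))"
    if N: "N \<ge> N1" and u: "1 \<le> \<bar>u\<bar>" "\<bar>u\<bar> \<le> \<eta> * An N" for N u
  proof -
    have AN: "An N > 0" using N N1(4) by (intro An_pos) auto
    have u0: "\<bar>u\<bar> > 0" using u by linarith
    \<comment> \<open>A need not be monotone, so n is the least admissible index with A n \<ge> A N
      / |u|; the matching upper bound comes from A n < 2 * A (n - 1).\<close>
    define P where "P n \<longleftrightarrow> n \<ge> N1 \<and> An n \<ge> An N / \<bar>u\<bar>" for n
    have PN: "P N" unfolding P_def using N u AN by (simp add: field_simps mult_right_le_one_le)
    define n where "n = (LEAST n. P n)"
    have Pn: "P n" unfolding n_def using PN by (rule LeastI)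
    have nN: "n \<le> N" unfolding n_def using PN by (rule Least_le)
    have n1: "n \<ge> N1" "An n \<ge> An N / \<bar>u\<bar>" using Pn by (auto simp: P_def)
    have n0: "n \<ge> 1" using n1 N1(4) by blast
    have Ann: "An n > 0" by (rule An_pos[OF n0])
    have up: "An n \<le> 2 * (An N / \<bar>u\<bar>)"
    proof (cases "n = N1")
      case True
      have "An N1 \<le> An N / \<bar>u\<bar>" using u u0 A1 by (simp add: \<eta>_def field_simps)
      moreover have "An N / \<bar>u\<bar> > 0" using AN u0 by simp
      ultimately show ?thesis using True by simp
    next
      case False
      then have n': "n - 1 \<ge> N1" using n1 by simp
      have "\<not> P (n - 1)" unfolding n_def by (rule not_less_Least) (use False n1 n_def in auto)
      then have lt: "An (n - 1) < An N / \<bar>u\<bar>" using n' by (simp add: P_def)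
      have "An (n - 1) > 0" using N1(4)[OF n'] by (rule An_pos)
      moreover have "Suc (n - 1) = n" using n0 by simp
      ultimately have "An n < 2 * An (n - 1)" using N1(2)[OF n'] by (simp add: field_simps)
      then show ?thesis using lt by linarith
    qed
    define t where "t = u * An n / An N"
    have tabs: "\<bar>t\<bar> = \<bar>u\<bar> * An n / An N" using AN Ann by (simp add: t_def abs_mult)
    have t: "1 \<le> \<bar>t\<bar>" "\<bar>t\<bar> \<le> 2" using n1(2) up AN u0 unfolding tabs by (auto simp: field_simps)
    have "norm (char \<mu> (t / An n)) ^ n \<le> exp (- \<kappa>)" using N1(1)[OF n1(1) t] by (simp add: normalized_char_norm)
    moreover have tn: "t / An n = u / An N" using Ann by (simp add: t_def)
    ultimately have "norm (char \<mu> (u / An N)) ^ N \<le> exp (- (\<kappa> * (real N / real n)))"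
      using n0 nN by (intro char_power_bound) auto
    also have "\<dots> \<le> exp (- (\<kappa>' * \<bar>u\<bar> powr (1 / b)))"
    proof -
      \<comment> \<open>Potter's bound, solved for N / n, shows that N / n is at least of order
        |u|^(1 / b): the origin of the exponent p.\<close>
      have "\<bar>u\<bar> / 2 \<le> An N / An n" using t(2) AN Ann unfolding tabs by (simp add: field_simps)
      also have "\<dots> \<le> K * (real N / real n) powr b" using N1(3)[OF n1(1)] nN by (intro K(3)) auto
      finally have "1 / (2 * K) * \<bar>u\<bar> \<le> (real N / real n) powr b" using K(2) by (simp add: field_simps)
      then have "(1 / (2 * K) * \<bar>u\<bar>) powr (1 / b) \<le> ((real N / real n) powr b) powr (1 / b)"
        using K(2) b0 by (intro powr_mono2) auto
      also have "\<dots> = real N / real n" using b0 n0 by (simp add: powr_powr)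
      finally have "(1 / (2 * K)) powr (1 / b) * \<bar>u\<bar> powr (1 / b) \<le> real N / real n"
        using K(2) by (simp only: powr_mult zero_le_divide_1_iff abs_ge_zero)
      then have "\<kappa> * ((1 / (2 * K)) powr (1 / b) * \<bar>u\<bar> powr (1 / b)) \<le> \<kappa> * (real N / real n)"
        using k(1) by (intro mult_left_mono) auto
      then show ?thesis by (simp add: \<kappa>'_def mult.assoc)
    qed
    finally show ?thesis by (simp add: normalized_char_norm)
  qed
  have "\<kappa>' > 0" using k(1) K(2) by (simp add: \<kappa>'_def)
  moreover have "1 / b > 0" using b0 by simp
  moreover have "\<eta> > 0" using A1 by (simp add: \<eta>_def)
  moreover have "\<forall>\<^sub>F N in sequentially. \<forall>u. 1 \<le> \<bar>u\<bar> \<and> \<bar>u\<bar> \<le> \<eta> * An N \<longrightarrow>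
    norm (normalized_char N u) \<le> exp (- (\<kappa>' * \<bar>u\<bar> powr (1 / b)))"
    using eventually_ge_at_top[of N1] by eventually_elim (use main in blast)
  ultimately show ?thesis by blast
qed

text \<open>Here the nonlattice condition enters, through \<open>char_less_1\<close> and the maximum
  over a compact set away from 0. The maximum with 1/2 keeps \<rho> positive.\<close>

lemma char_compact_bound:
  assumes "0 < \<eta>"
  shows "\<exists>\<rho>. 0 < \<rho> \<and> \<rho> < 1 \<and> (\<forall>v. \<eta> \<le> \<bar>v\<bar> \<and> \<bar>v\<bar> \<le> L \<longrightarrow> norm (char \<mu> v) \<le> \<rho>)"
proof (cases "\<eta> \<le> L")
  case True
  define S where "S = {\<eta>..L} \<union> {-L..-\<eta>}"
  have "compact S" "S \<noteq> {}" using True by (auto simp: S_def compact_Un)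
  moreover have "continuous_on S (\<lambda>v. norm (char \<mu> v))"
    by (intro continuous_at_imp_continuous_on ballI continuous_intros isCont_char)
  ultimately obtain v0 where v0: "v0 \<in> S" "\<And>v. v \<in> S \<Longrightarrow> norm (char \<mu> v) \<le> norm (char \<mu> v0)"
    using continuous_attains_sup by metis
  have "v0 \<noteq> 0" using v0(1) assms by (auto simp: S_def)
  then have "norm (char \<mu> v0) < 1" by (rule char_less_1)
  moreover have "norm (char \<mu> v) \<le> max (norm (char \<mu> v0)) (1/2)" if "\<eta> \<le> \<bar>v\<bar>" "\<bar>v\<bar> \<le> L" for v
    using that by (intro max.coboundedI1 v0(2)) (auto simp: S_def abs_if split: if_splits)
  ultimately show ?thesis by (intro exI[of _ "max (norm (char \<mu> v0)) (1/2)"]) auto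
next
  case False
  then show ?thesis by (intro exI[of _ "1/2"]) auto
qed

text \<open>Potter's bound limits A to polynomial growth. The claim pays for a frequency range whose
  length is proportional to A n.\<close>

lemma An_geometric:
  assumes "0 < \<rho>" "\<rho> < 1"
  shows "(\<lambda>n. An n * \<rho> ^ n) \<longlonglongrightarrow> 0"
proof -
  define b where "b = 1 / \<alpha> + 1"
  have b0: "b > 0" "b > 1 / \<alpha>" using R.alpha_pos by (auto simp: b_def add_pos_pos)
  obtain x0 K where K: "x0 \<ge> 1" "K > 0" "\<And>x y. x \<ge> x0 \<Longrightarrow> y \<ge> x \<Longrightarrow> norming \<alpha> l1 y / norming \<alpha> l1 x \<le> K * (y / x) powr b"
    using R.potter_upper[OF b0(2)] by blast
  have A0: "norming \<alpha> l1 x0 > 0" using K(1) by (rule R.A_pos)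
  define K' where "K' = norming \<alpha> l1 x0 * K * x0 powr (- b)"
  have "(\<lambda>n. real n powr b * \<rho> ^ n) \<longlonglongrightarrow> 0" using assms b0 by real_asymp
  then have "(\<lambda>n. K' * (real n powr b * \<rho> ^ n)) \<longlonglongrightarrow> 0" by (rule tendsto_mult_right_zero)
  then show ?thesis
  proof (rule Lim_null_comparison[rotated])
    have "\<forall>\<^sub>F n in sequentially. real n \<ge> x0" using filterlim_real_sequentially by (simp add: filterlim_at_top)
    then show "\<forall>\<^sub>F n in sequentially. norm (An n * \<rho> ^ n) \<le> K' * (real n powr b * \<rho> ^ n)"
    proof eventually_elim
      case (elim n)
      have "An n \<le> norming \<alpha> l1 x0 * (K * (real n / x0) powr b)"
        using K(3)[OF order_refl elim] A0 by (simp add: field_simps)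
      also have "\<dots> = K' * real n powr b" using K(1) elim by (simp add: K'_def powr_divide powr_minus_divide)
      finally have "An n * \<rho> ^ n \<le> K' * real n powr b * \<rho> ^ n" using assms by (intro mult_right_mono) auto
      moreover have "An n \<ge> 0" using elim K(1) R.A_pos[of "real n"] by simp
      ultimately show ?case using assms by (simp add: abs_mult mult.assoc)
    qed
  qed
qed

end

section \<open>The local limit theorem\<close>

lemma continuous_densities_eq:
  fixes f g :: "real \<Rightarrow> real"
  assumes cont: "continuous_on UNIV f" "continuous_on UNIV g"
    and nonneg: "\<And>x. f x \<ge> 0" "\<And>x. g x \<ge> 0"
    and eq: "density lborel (\<lambda>x. ennreal (f x)) = density lborel (\<lambda>x. ennreal (g x))"
  shows "f = g"
proof
  fix x
  have [measurable]: "f \<in> borel_measurable borel" "g \<in> borel_measurable borel"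
    using cont by (auto intro: borel_measurable_continuous_onI)
  have "AE x in lborel. ennreal (f x) = ennreal (g x)"
    using eq by (subst (asm) sigma_finite_measure.density_unique_iff[OF sigma_finite_lborel]) auto
  then have "AE x in lborel. x \<in> {x. f x = g x}" by eventually_elim (use nonneg in auto)
  moreover have "closed {x. f x = g x}" using cont by (intro closed_Collect_eq) auto
  ultimately have "x \<in> {x. f x = g x}" by (intro mem_closed_if_AE_lebesgue) (auto intro: AE_completion)
  then show "f x = g x" by simp
qed

text \<open>If the mean of a unit-modulus variable has modulus 1, the variable is almost surely
  constant. With iexp \<theta> as that constant, 1 - cos (v * x - \<theta>) is nonnegative with
  integral 0, so v * x lies almost surely in \<theta> plus the multiples of 2 * pi.\<close>

lemma (in real_distribution) lattice_if_norm_char_1: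
  assumes v: "v \<noteq> 0" and c1: "norm (char M v) = 1"
  shows "\<exists>a h. h > 0 \<and> (AE x in M. \<exists>j::int. x = a + h * real_of_int j)"
proof -
  obtain \<theta> where th: "char M v = iexp \<theta>" using c1 complex_norm_eq_1_exp[of "char M v"] by metis
  have int: "integrable M (\<lambda>x. iexp (v * x) * iexp (- \<theta>))"
    by (rule integrable_const_bound[where B=1]) (auto simp: norm_mult)
  have "(CLINT x|M. iexp (v * x) * iexp (- \<theta>)) = char M v * iexp (- \<theta>)"
    by (simp add: char_def)
  also have "\<dots> = 1" by (simp add: th exp_minus)
  finally have one: "(CLINT x|M. iexp (v * x) * iexp (- \<theta>)) = 1" .
  have re: "Re (iexp (v * x) * iexp (- \<theta>)) = cos (v * x - \<theta>)" for x
  proof -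
    have "iexp (v * x) * iexp (- \<theta>) = iexp (v * x - \<theta>)" by (simp add: exp_add[symmetric] algebra_simps)
    then show ?thesis by (simp only: Re_exp) simp
  qed
  have cint: "integrable M (\<lambda>x. cos (v * x - \<theta>))" using integrable_Re[OF int] unfolding re .
  have "(LINT x|M. cos (v * x - \<theta>)) = 1"
    using integral_Re[OF int] unfolding re one by simp
  then have "(LINT x|M. 1 - cos (v * x - \<theta>)) = 0"
    using cint by (subst Bochner_Integration.integral_diff) (auto simp: prob_space[unfolded space_eq_univ])
  moreover have "integrable M (\<lambda>x. 1 - cos (v * x - \<theta>))" using cint by simp
  ultimately have ae: "AE x in M. 1 - cos (v * x - \<theta>) = 0"
    by (subst (asm) integral_nonneg_eq_0_iff_AE) auto
  show ?thesis
  proof (intro exI conjI)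
    show "2 * pi / \<bar>v\<bar> > 0" using v by simp
    show "AE x in M. \<exists>j::int. x = \<theta> / v + 2 * pi / \<bar>v\<bar> * real_of_int j"
      using ae
    proof eventually_elim
      case (elim x)
      then obtain n :: int where n: "v * x - \<theta> = of_int n * 2 * pi" using cos_one_2pi_int[of "v * x - \<theta>"] by auto
      then have x: "x = \<theta> / v + 2 * pi / v * of_int n" using v by (simp add: field_simps)
      show ?case
      proof (cases "v > 0")
        case True
        then show ?thesis using x by auto
      next
        case False
        then show ?thesis using x v by (intro exI[of _ "- n"]) simp
      qed
    qed
  qed
qed

section \<open>Semistable densities and the smoothed local limit\<close>

locale sums_attraction = nonlattice_attraction +
  fixes S :: "nat \<Rightarrow> real measure"
  assumes S_distribution: "\<And>n. real_distribution (S n)"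
    and char_S: "\<And>n t. char (S n) t = char \<mu> t ^ n"
begin

definition normalized_law :: "nat \<Rightarrow> real measure" where
  "normalized_law n = distr (S n) borel (\<lambda>x. (x - Cn n) / An n)"

lemma normalized_law_distribution: "real_distribution (normalized_law n)"
proof -
  interpret S: real_distribution "S n" by (rule S_distribution)
  show ?thesis unfolding normalized_law_def by (rule S.real_distribution_distr) simp
qed

lemma char_normalized_law: "char (normalized_law n) t = normalized_char n t"
proof -
  interpret S: real_distribution "S n" by (rule S_distribution)
  have "char (normalized_law n) t = (CLINT x|S n. iexp (t * ((x - Cn n) / An n)))"
    unfolding normalized_law_def char_def by (rule integral_distr) auto
  also have "\<dots> = (CLINT x|S n. iexp (t / An n * x) * iexp (- (t * (Cn n / An n))))"
    by (intro Bochner_Integration.integral_cong refl) (simp add: exp_add[symmetric] algebra_simps diff_divide_distrib)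
  also have "\<dots> = char (S n) (t / An n) * iexp (- (t * (Cn n / An n)))"
    by (simp add: char_def)
  finally show ?thesis by (simp add: char_S normalized_char_def)
qed

lemma psi_continuous: "u > 0 \<Longrightarrow> isCont (psi u) t"
  unfolding continuous_at_sequentially comp_def by (auto intro!: psi_tendsto)

lemma psi_measurable: "u > 0 \<Longrightarrow> psi u \<in> borel_measurable borel"
  using psi_continuous by (intro borel_measurable_continuous_onI continuous_at_imp_continuous_on) auto

lemma psi_integral_bounds:
  obtains L where "\<And>u. u > 0 \<Longrightarrow> integrable lborel (\<lambda>t. (1 + \<bar>t\<bar>) * norm (psi u t))"
    "\<And>u. u > 0 \<Longrightarrow> (LBINT t. (1 + \<bar>t\<bar>) * norm (psi u t)) \<le> L"
proof -
  obtain \<kappa> where k: "\<kappa> > 0" "\<And>u t. u > 0 \<Longrightarrow> norm (psi u t) \<le> exp (- (\<kappa> * \<bar>t\<bar> powr \<alpha>))"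
    using psi_norm_le by blast
  note I = stretched_exponential_integrable[OF k(1) R.alpha_pos]
  have int: "integrable lborel (\<lambda>t. (1 + \<bar>t\<bar>) * norm (psi u t))" if u: "u > 0" for u
  proof (rule Bochner_Integration.integrable_bound[OF I])
    have [measurable]: "psi u \<in> borel_measurable borel" by (rule psi_measurable[OF u])
    show "(\<lambda>t. (1 + \<bar>t\<bar>) * norm (psi u t)) \<in> borel_measurable lborel" by measurable
    show "AE t in lborel. norm ((1 + \<bar>t\<bar>) * norm (psi u t)) \<le> norm ((1 + \<bar>t\<bar>) * exp (- (\<kappa> * \<bar>t\<bar> powr \<alpha>)))"
      using k(2)[OF u] by (intro AE_I2) (simp add: abs_mult mult_left_mono)
  qed
  show ?thesis
  proof (rule that)
    show "integrable lborel (\<lambda>t. (1 + \<bar>t\<bar>) * norm (psi u t))" if "u > 0" for u by (rule int[OF that])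
    show "(LBINT t. (1 + \<bar>t\<bar>) * norm (psi u t)) \<le> (LBINT t. (1 + \<bar>t\<bar>) * exp (- (\<kappa> * \<bar>t\<bar> powr \<alpha>)))" if "u > 0" for u
      using k(2)[OF that] by (intro integral_mono int[OF that] I) (simp add: mult_left_mono)
  qed
qed

lemma psi_integrable:
  assumes u: "u > 0"
  shows "integrable lborel (psi u)"
proof -
  obtain L where "\<And>u. u > 0 \<Longrightarrow> integrable lborel (\<lambda>t. (1 + \<bar>t\<bar>) * norm (psi u t))"
    using psi_integral_bounds by metis
  from this[OF u] show ?thesis
  proof (rule Bochner_Integration.integrable_bound)
    show "AE t in lborel. norm (psi u t) \<le> norm ((1 + \<bar>t\<bar>) * norm (psi u t))"
      by (intro AE_I2) (simp add: abs_mult distrib_right)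
  qed (use psi_measurable[OF u] in simp)
qed

text \<open>For n = floor (u * k i), with \<open>i\<close> itself as block index, the ratio n / k i
  tends to \<open>u\<close>, whatever positive number that is. So each \<open>psi u\<close> is a
  limit of characteristic functions, as the inversion lemmas require.\<close>

lemma psi_limit:
  assumes u: "u > 0"
  shows "(\<lambda>i. char (normalized_law (nat \<lfloor>u * real (k i)\<rfloor>)) t) \<longlonglongrightarrow> psi u t"
  unfolding char_normalized_law
proof (rule normalized_char_tendsto)
  define n where "n i = nat \<lfloor>u * real (k i)\<rfloor>" for i
  have n: "u * real (k i) - 1 \<le> real (n i)" "real (n i) \<le> u * real (k i)" for i
    using u by (auto simp: n_def of_nat_nat)
  have uk: "filterlim (\<lambda>i. - 1 + u * real (k i)) at_top sequentially"
    by (intro filterlim_tendsto_add_at_top[OF tendsto_const] filterlim_tendsto_pos_mult_at_top[OF tendsto_const u] R.k_at_top)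
  have "filterlim (\<lambda>i. real (n i)) at_top sequentially"
    by (rule filterlim_at_top_mono[OF uk]) (use n in \<open>auto simp: algebra_simps intro!: always_eventually\<close>)
  then have "\<forall>\<^sub>F i in sequentially. real Z \<le> real (n i)" for Z
    unfolding filterlim_at_top by blast
  then show "filterlim (\<lambda>i. nat \<lfloor>u * real (k i)\<rfloor>) at_top sequentially"
    unfolding filterlim_at_top n_def[symmetric] by simp
  show "filterlim (\<lambda>i. i) at_top sequentially" by (rule filterlim_ident)
  have k1: "\<forall>\<^sub>F i in sequentially. real (k i) \<ge> 1" using R.k_at_top unfolding filterlim_at_top by blast
  have lo: "(\<lambda>i. u - 1 / real (k i)) \<longlonglongrightarrow> u - 0"
    by (intro tendsto_diff tendsto_const tendsto_divide_0[OF tendsto_const] filterlim_at_top_imp_at_infinity R.k_at_top)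
  show "(\<lambda>i. real (nat \<lfloor>u * real (k i)\<rfloor>) / real (k i)) \<longlonglongrightarrow> u"
    unfolding n_def[symmetric]
  proof (rule tendsto_sandwich[OF _ _ _ tendsto_const])
    show "(\<lambda>i. u - 1 / real (k i)) \<longlonglongrightarrow> u" using lo by simp
    show "\<forall>\<^sub>F i in sequentially. u - 1 / real (k i) \<le> real (n i) / real (k i)"
      using k1
    proof eventually_elim
      case (elim i)
      have "(u * real (k i) - 1) / real (k i) \<le> real (n i) / real (k i)" using n(1) by (intro divide_right_mono) auto
      then show ?case using elim by (simp add: diff_divide_distrib)
    qed
    show "\<forall>\<^sub>F i in sequentially. real (n i) / real (k i) \<le> u"
      using k1
    proof eventually_elim
      case (elim i)
      have "real (n i) / real (k i) \<le> (u * real (k i)) / real (k i)" using n(2) by (intro divide_right_mono) auto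
      then show ?case using elim by simp
    qed
  qed
qed (use u in auto)

abbreviation "dens u \<equiv> inverse_fourier (psi u)"

text \<open>Inversion gives existence and Levy's theorem uniqueness, so the definite description
  denotes.\<close>

lemma semistable_law_eq:
  assumes u: "u > 0"
  shows "semistable_law \<alpha> M\<^sub>R M\<^sub>L u = density lborel (\<lambda>x. ennreal (dens u x))"
  unfolding semistable_law_def
proof (rule the_equality)
  note facts = normalized_law_distribution psi_limit[OF u] psi_integrable[OF u] psi_continuous[OF u]
  show 1: "real_distribution (density lborel (\<lambda>x. ennreal (dens u x))) \<and>
      (\<forall>t. char (density lborel (\<lambda>x. ennreal (dens u x))) t = psi u t)"
    using real_distribution_inverse_fourier[OF facts] char_inverse_fourier[OF facts] by blast
  fix N assume "real_distribution N \<and> (\<forall>t. char N t = psi u t)"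
  then show "N = density lborel (\<lambda>x. ennreal (dens u x))"
    using 1 by (intro Levy_uniqueness) auto
qed

lemma semistable_density_eq:
  assumes u: "u > 0"
  shows "semistable_density \<alpha> M\<^sub>R M\<^sub>L u = dens u"
  unfolding semistable_density_def semistable_law_eq[OF u]
proof (rule the_equality)
  note facts = normalized_law_distribution psi_limit[OF u] psi_integrable[OF u] psi_continuous[OF u]
  show 1: "continuous_on UNIV (dens u) \<and> (\<forall>x. dens u x \<ge> 0) \<and>
      density lborel (\<lambda>x. ennreal (dens u x)) = density lborel (\<lambda>x. ennreal (dens u x))"
    using inverse_fourier_continuous[OF facts] inverse_fourier_nonneg[OF facts] by blast
  fix g assume "continuous_on UNIV g \<and> (\<forall>x. g x \<ge> 0) \<and>
      density lborel (\<lambda>x. ennreal (dens u x)) = density lborel (\<lambda>x. ennreal (g x))"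
  then show "g = dens u" using 1 by (intro continuous_densities_eq) auto
qed

text \<open>Uniformity in \<open>u\<close> is the point: both constants come from one bound on the
  integral of (1 + |t|) * norm (psi u t).\<close>

lemma dens_properties:
  obtains B L where "\<And>u x. u > 0 \<Longrightarrow> 0 \<le> dens u x \<and> dens u x \<le> B"
    "\<And>u x y. u > 0 \<Longrightarrow> \<bar>dens u x - dens u y\<bar> \<le> L * \<bar>x - y\<bar>"
proof -
  obtain L where L: "\<And>u. u > 0 \<Longrightarrow> integrable lborel (\<lambda>t. (1 + \<bar>t\<bar>) * norm (psi u t))"
    "\<And>u. u > 0 \<Longrightarrow> (LBINT t. (1 + \<bar>t\<bar>) * norm (psi u t)) \<le> L"
    using psi_integral_bounds by metis
  show ?thesis
  proof (rule that)
    fix u x :: real assume u: "u > 0"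
    note facts = normalized_law_distribution psi_limit[OF u] psi_integrable[OF u] psi_continuous[OF u]
    have "(LBINT t. norm (psi u t)) \<le> (LBINT t. (1 + \<bar>t\<bar>) * norm (psi u t))"
      using psi_integrable[OF u] by (intro integral_mono L(1)[OF u]) (auto simp: distrib_right)
    then have "(LBINT t. norm (psi u t)) / (2 * pi) \<le> L / (2 * pi)" using L(2)[OF u] by (simp add: divide_right_mono)
    then show "0 \<le> dens u x \<and> dens u x \<le> L / (2 * pi)"
      using inverse_fourier_nonneg[OF facts, of x] inverse_fourier_le[OF facts, of x] by linarith
  next
    fix u x y :: real assume u: "u > 0"
    note facts = normalized_law_distribution psi_limit[OF u] psi_integrable[OF u] psi_continuous[OF u]
    have [measurable]: "psi u \<in> borel_measurable borel" by (rule psi_measurable[OF u])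
    have I: "integrable lborel (\<lambda>t. iexp (- (t * x)) * psi u t)" for x
      by (rule iexp_limit_integrable[OF facts])
    define Z where "Z = (CLBINT t. iexp (- (t * x)) * psi u t - iexp (- (t * y)) * psi u t)"
    have "dens u x - dens u y = Re Z / (2 * pi)"
      unfolding inverse_fourier_def Z_def Bochner_Integration.integral_diff[OF I I] by (simp add: diff_divide_distrib)
    then have 1: "\<bar>dens u x - dens u y\<bar> \<le> norm Z / (2 * pi)"
      using abs_Re_le_cmod[of Z] by (simp add: abs_divide divide_right_mono)
    have "norm Z \<le> (LBINT t. \<bar>x - y\<bar> * ((1 + \<bar>t\<bar>) * norm (psi u t)))"
      unfolding Z_def
    proof (rule Bochner_Integration.integral_norm_bound_integral)
      show "integrable lborel (\<lambda>t. \<bar>x - y\<bar> * ((1 + \<bar>t\<bar>) * norm (psi u t)))"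
        by (rule integrable_mult_right, rule L(1)[OF u])
      fix t
      have "norm (iexp (- (t * x)) - iexp (- (t * y))) \<le> \<bar>t\<bar> * \<bar>x - y\<bar>"
      proof -
        have "iexp (- (t * x)) - iexp (- (t * y)) = iexp (- (t * y)) * (iexp (t * (y - x)) - 1)"
        proof -
          have "- (t * y) + t * (y - x) = - (t * x)" by (simp add: algebra_simps)
          then have "iexp (- (t * y)) * iexp (t * (y - x)) = iexp (- (t * x))"
            by (simp only: exp_add[symmetric] distrib_left[symmetric] of_real_add[symmetric])
          then show ?thesis by (simp only: right_diff_distrib mult_1_right)
        qed
        then have "norm (iexp (- (t * x)) - iexp (- (t * y))) = norm (iexp (t * (y - x)) - 1)"
          by (simp only: norm_mult norm_exp_i_times mult_1)
        also have "\<dots> \<le> \<bar>t * (y - x)\<bar>" by (rule norm_iexp_minus_1)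
        finally show ?thesis by (simp add: abs_mult abs_minus_commute)
      qed
      then have "norm (iexp (- (t * x)) - iexp (- (t * y))) * norm (psi u t) \<le> (\<bar>x - y\<bar> * (1 + \<bar>t\<bar>)) * norm (psi u t)"
        by (intro mult_right_mono) (auto simp: algebra_simps)
      then show "norm (iexp (- (t * x)) * psi u t - iexp (- (t * y)) * psi u t) \<le> \<bar>x - y\<bar> * ((1 + \<bar>t\<bar>) * norm (psi u t))"
        by (simp only: left_diff_distrib[symmetric] norm_mult mult.assoc)
    qed (intro Bochner_Integration.integrable_diff I)
    also have "\<dots> \<le> \<bar>x - y\<bar> * L" using L(2)[OF u] by (simp add: mult_left_mono)
    finally have "norm Z / (2 * pi) \<le> \<bar>x - y\<bar> * L / (2 * pi)" by (intro divide_right_mono) auto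
    then show "\<bar>dens u x - dens u y\<bar> \<le> L / (2 * pi) * \<bar>x - y\<bar>"
      using 1 by (simp add: mult.commute)
  qed
qed

text \<open>Three frequency ranges. Up to \<eta> * A n the stretched exponential gives a majorant,
  with 1 on [-1, 1]; from there to A n / \<epsilon> the factor \<rho> ^ n beats the length 2 * A n /
  \<epsilon>; beyond, the tent vanishes.\<close>

lemma smoothed_char_L1:
  assumes eps: "\<epsilon> > 0"
  shows "(\<lambda>n. LBINT w. norm (normalized_char n w * of_real (tent (\<epsilon> * (w / An n))) - psi (position_param k n) w)) \<longlonglongrightarrow> 0"
proof -
  let ?s = "\<lambda>n w. normalized_char n w * of_real (tent (\<epsilon> * (w / An n)))"
  let ?p = "\<lambda>n. psi (position_param k n)"
  obtain \<kappa> where k: "\<kappa> > 0" "\<And>u t. u > 0 \<Longrightarrow> norm (psi u t) \<le> exp (- (\<kappa> * \<bar>t\<bar> powr \<alpha>))"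
    using psi_norm_le by blast
  obtain \<kappa>' p \<eta> where d: "\<kappa>' > 0" "p > 0" "\<eta> > 0" "\<forall>\<^sub>F N in sequentially. \<forall>u. 1 \<le> \<bar>u\<bar> \<and> \<bar>u\<bar> \<le> \<eta> * An N \<longrightarrow>
    norm (normalized_char N u) \<le> exp (- (\<kappa>' * \<bar>u\<bar> powr p))"
    using normalized_char_decay by blast
  obtain \<rho> where rho: "0 < \<rho>" "\<rho> < 1" "\<And>v. \<eta> \<le> \<bar>v\<bar> \<Longrightarrow> \<bar>v\<bar> \<le> 1 / \<epsilon> \<Longrightarrow> norm (char \<mu> v) \<le> \<rho>"
    using char_compact_bound[OF d(3), of "1 / \<epsilon>"] by blast
  obtain N0 where N0: "\<And>N u. N \<ge> N0 \<Longrightarrow> 1 \<le> \<bar>u\<bar> \<Longrightarrow> \<bar>u\<bar> \<le> \<eta> * An N \<Longrightarrow> norm (normalized_char N u) \<le> exp (- (\<kappa>' * \<bar>u\<bar> powr p))"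
    using d(4) unfolding eventually_sequentially by blast
  define N where "N = max N0 1"
  define J where "J n w = (indicator {- (\<eta> * An n)..\<eta> * An n} w :: real)" for n w
  \<comment> \<open>The cutoff \<open>J\<close> applies to the normalized characteristic function
    alone, so \<open>f\<close> also carries \<open>psi\<close> on the whole line.\<close>
  define f where "f n w = norm (J n w *\<^sub>R ?s n w - ?p n w)" for n w
  define W where "W w = indicator {-1..1} w + (1 + \<bar>w\<bar>) * exp (- (\<kappa>' * \<bar>w\<bar> powr p)) + (1 + \<bar>w\<bar>) * exp (- (\<kappa> * \<bar>w\<bar> powr \<alpha>))" for w :: real
  have W: "integrable lborel W"
    unfolding W_def[abs_def]
    by (intro Bochner_Integration.integrable_add stretched_exponential_integrable k d R.alpha_pos) simp
  have nc_meas [measurable]: "normalized_char n \<in> borel_measurable borel" for n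
    unfolding normalized_char_def[abs_def] by measurable
  have [measurable]: "J n \<in> borel_measurable borel" for n unfolding J_def[abs_def] by measurable
  have psi_meas: "?p n \<in> borel_measurable borel" if "n \<ge> 1" for n
    by (rule psi_measurable[OF R.position_param_pos[OF that]])
  have nc1: "norm (normalized_char n w) \<le> 1" for n w
    unfolding normalized_char_norm using cmod_char_le_1 by (simp add: power_le_one)
  have fW: "f n w \<le> W w" if n: "n \<ge> N" for n w
  proof -
    have n': "n \<ge> N0" "n \<ge> 1" using n by (auto simp: N_def)
    have le_mult: "e \<le> (1 + \<bar>w\<bar>) * e" if "e \<ge> 0" for e :: real using that by (simp add: distrib_right)
    have "norm (?p n w) \<le> (1 + \<bar>w\<bar>) * exp (- (\<kappa> * \<bar>w\<bar> powr \<alpha>))"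
      by (rule order_trans[OF k(2)[OF R.position_param_pos[OF n'(2)]] le_mult]) simp
    moreover have "norm (J n w *\<^sub>R ?s n w) \<le> J n w * norm (normalized_char n w)"
      using tent_bounds(1,2)[of "\<epsilon> * (w / An n)"]
      by (simp add: norm_mult J_def mult_left_mono mult_right_le_one_le)
    moreover have "J n w * norm (normalized_char n w) \<le> indicator {-1..1} w + (1 + \<bar>w\<bar>) * exp (- (\<kappa>' * \<bar>w\<bar> powr p))"
    proof (cases "w \<in> {-1..1}")
      case True
      have "J n w * norm (normalized_char n w) \<le> 1 * 1" using nc1 by (intro mult_mono) (auto simp: J_def indicator_def)
      moreover have "0 \<le> (1 + \<bar>w\<bar>) * exp (- (\<kappa>' * \<bar>w\<bar> powr p))" by simp
      moreover have "indicator {-1..1} w = (1::real)" using True by (rule indicator_simps)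
      ultimately show ?thesis by linarith
    next
      case False
      then have w1: "1 \<le> \<bar>w\<bar>" by auto
      show ?thesis
      proof (cases "\<bar>w\<bar> \<le> \<eta> * An n")
        case True
        then have "J n w = 1" by (auto simp: J_def indicator_def abs_le_iff)
        then show ?thesis using order_trans[OF N0[OF n'(1) w1 True] le_mult] False by simp
      next
        case f: False
        then have "J n w = 0" by (auto simp: J_def indicator_def abs_le_iff)
        then show ?thesis using False by simp
      qed
    qed
    ultimately show ?thesis
      unfolding f_def W_def
      using norm_triangle_ineq4[of "J n w *\<^sub>R ?s n w" "?p n w"]
      by linarith
  qed
  have f_meas: "f n \<in> borel_measurable lborel" if "n \<ge> 1" for n
  proof -
    note [measurable] = psi_meas[OF that]
    show ?thesis unfolding f_def[abs_def] by measurable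
  qed
  have f_int: "integrable lborel (f n)" if "n \<ge> N" for n
  proof (rule Bochner_Integration.integrable_bound[OF W])
    show "AE w in lborel. norm (f n w) \<le> norm (W w)"
      using fW[OF that] by (intro AE_I2) (simp add: f_def order_trans[OF _ abs_ge_self])
  qed (use f_meas that in \<open>auto simp: N_def\<close>)
  have lim_f: "(\<lambda>n. LBINT w. f (n + N) w) \<longlonglongrightarrow> integral\<^sup>L lborel (\<lambda>w::real. 0::real)"
  proof (rule integral_dominated_convergence[where w=W])
    show "AE w in lborel. (\<lambda>n. f (n + N) w) \<longlonglongrightarrow> 0"
    proof (rule AE_I2)
      fix w :: real
      have Ainf: "filterlim An at_top sequentially" by (rule An_at_top)
      have "(\<lambda>n. \<epsilon> * (w / An n)) \<longlonglongrightarrow> \<epsilon> * 0"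
        by (intro tendsto_mult tendsto_const tendsto_divide_0[OF tendsto_const] filterlim_at_top_imp_at_infinity Ainf)
      then have "(\<lambda>n. tent (\<epsilon> * (w / An n))) \<longlonglongrightarrow> tent 0"
        by (intro isCont_tendsto_compose[OF continuous_tent]) simp
      then have t0: "(\<lambda>n. tent (\<epsilon> * (w / An n)) - 1) \<longlonglongrightarrow> 0" by (simp add: tent_0 LIM_zero_iff)
      \<comment> \<open>The normalized characteristic function has no limit in n, so the tent is
        first replaced by 1 using boundedness, and merging is applied afterwards.\<close>
      have "(\<lambda>n. normalized_char n w * of_real (tent (\<epsilon> * (w / An n)) - 1)) \<longlonglongrightarrow> 0"
      proof (rule Lim_null_comparison)
        show "\<forall>\<^sub>F n in sequentially. norm (normalized_char n w * of_real (tent (\<epsilon> * (w / An n)) - 1)) \<le> \<bar>tent (\<epsilon> * (w / An n)) - 1\<bar>"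
          using nc1 by (intro always_eventually allI) (simp add: norm_mult mult_left_le_one_le del: of_real_diff)
        show "(\<lambda>n. \<bar>tent (\<epsilon> * (w / An n)) - 1\<bar>) \<longlonglongrightarrow> 0" using t0 by (rule tendsto_rabs_zero)
      qed
      from tendsto_add[OF this normalized_char_merge[of "\<lambda>_. w" "\<bar>w\<bar>"]]
      have "(\<lambda>n. ?s n w - ?p n w) \<longlonglongrightarrow> 0"
        by (simp add: algebra_simps)
      then have "(\<lambda>n. norm (?s n w - ?p n w)) \<longlonglongrightarrow> 0"
        by (rule tendsto_norm_zero)
      moreover have "\<forall>\<^sub>F n in sequentially. norm (?s n w - ?p n w) = f n w"
      proof -
        have "\<forall>\<^sub>F n in sequentially. An n \<ge> \<bar>w\<bar> / \<eta>" using Ainf by (simp add: filterlim_at_top)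
        then show ?thesis
        proof eventually_elim
          case (elim n)
          then have "\<bar>w\<bar> \<le> \<eta> * An n" using d(3) by (simp add: field_simps)
          then have "J n w = 1" by (auto simp: J_def indicator_def abs_le_iff)
          then show ?case by (simp add: f_def)
        qed
      qed
      ultimately have "(\<lambda>n. f n w) \<longlonglongrightarrow> 0" by (rule Lim_transform_eventually)
      then show "(\<lambda>n. f (n + N) w) \<longlonglongrightarrow> 0" by (rule LIMSEQ_ignore_initial_segment)
    qed
    show "AE w in lborel. norm (f (n + N) w) \<le> W w" for n
      using fW[of "n + N"] by (intro AE_I2) (simp add: f_def)
  qed (use W f_meas in \<open>auto simp: N_def\<close>)
  then have lim_f: "(\<lambda>n. LBINT w. f n w) \<longlonglongrightarrow> 0" by (auto intro: LIMSEQ_offset)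
  have lim_r: "(\<lambda>n. 2 / \<epsilon> * (An n * \<rho> ^ n)) \<longlonglongrightarrow> 0"
    by (intro tendsto_mult_right_zero An_geometric rho)
  from tendsto_add[OF lim_f lim_r] have "(\<lambda>n. (LBINT w. f n w) + 2 / \<epsilon> * (An n * \<rho> ^ n)) \<longlonglongrightarrow> 0" by simp
  then show ?thesis
  proof (rule Lim_null_comparison[rotated])
    show "\<forall>\<^sub>F n in sequentially. norm (LBINT w. norm (?s n w - ?p n w))
        \<le> (LBINT w. f n w) + 2 / \<epsilon> * (An n * \<rho> ^ n)"
      using eventually_ge_at_top[of N]
    proof eventually_elim
      case (elim n)
      then have n1: "n \<ge> 1" by (simp add: N_def)
      have Ap: "An n > 0" by (rule An_pos[OF n1])
      note [measurable] = psi_meas[OF n1]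
      let ?I = "{- (An n / \<epsilon>)..An n / \<epsilon>}"
      have i2: "integrable lborel (\<lambda>w. \<rho> ^ n * indicator ?I w)"
        by (intro integrable_mult_right integrable_real_indicator) (auto simp: emeasure_lborel_Icc_eq)
      have pt: "norm (?s n w - ?p n w) \<le> f n w + \<rho> ^ n * indicator ?I w" for w
      proof (cases "\<bar>w\<bar> \<le> \<eta> * An n")
        case True
        then have "J n w = 1" by (auto simp: J_def indicator_def abs_le_iff)
        then show ?thesis using rho by (simp add: f_def indicator_def)
      next
        case False
        then have J0: "J n w = 0" by (auto simp: J_def indicator_def abs_le_iff)
        have "norm (?s n w) \<le> \<rho> ^ n * indicator ?I w"
        proof (cases "w \<in> ?I")
          case True
          then have "\<bar>w / An n\<bar> \<le> 1 / \<epsilon>" using Ap eps by (auto simp: abs_le_iff field_simps)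
          moreover have "\<eta> \<le> \<bar>w / An n\<bar>" using False Ap by (simp add: field_simps)
          ultimately have "norm (char \<mu> (w / An n)) \<le> \<rho>" by (intro rho(3))
          then have "norm (normalized_char n w) \<le> \<rho> ^ n" unfolding normalized_char_norm by (intro power_mono) auto
          then have "norm (normalized_char n w) * tent (\<epsilon> * (w / An n)) \<le> \<rho> ^ n * 1"
            using tent_bounds(1,2) rho by (intro mult_mono) auto
          then show ?thesis using True tent_bounds(1) by (simp add: norm_mult)
        next
          case f: False
          then have "\<bar>w\<bar> > An n / \<epsilon>" by auto
          then have "\<bar>\<epsilon> * (w / An n)\<bar> \<ge> 1" using Ap eps by (simp add: abs_mult field_simps)
          then show ?thesis using tent_bounds(3)[of "\<epsilon> * (w / An n)"] f by simp
        qed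
        moreover have "f n w = norm (?p n w)" using J0 by (simp add: f_def)
        ultimately show ?thesis
          using norm_triangle_ineq4[of "?s n w" "?p n w"] by linarith
      qed
      have "(LBINT w. norm (?s n w - ?p n w))
          \<le> (LBINT w. f n w + \<rho> ^ n * indicator ?I w)"
      proof (rule integral_mono[OF _ _ pt])
        show i3: "integrable lborel (\<lambda>w. f n w + \<rho> ^ n * indicator ?I w)"
          by (intro Bochner_Integration.integrable_add f_int elim i2)
        show "integrable lborel (\<lambda>w. norm (?s n w - ?p n w))"
        proof (rule Bochner_Integration.integrable_bound[OF i3])
          show "AE w in lborel. norm (norm (?s n w - ?p n w))
              \<le> norm (f n w + \<rho> ^ n * indicator ?I w)"
            unfolding real_norm_def abs_norm_cancel by (intro AE_I2 order_trans[OF pt abs_ge_self])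
        qed measurable
      qed
      also have "\<dots> = (LBINT w. f n w) + \<rho> ^ n * (2 * (An n / \<epsilon>))"
        using f_int[OF elim] i2 Ap eps by (subst Bochner_Integration.integral_add) auto
      finally show ?case by (simp add: integral_nonneg_AE mult_ac)
    qed
  qed
qed

text \<open>Inversion on both sides, with frequencies rescaled by A n, leaves the L1 distance of the
  transforms divided by 2 * pi, a bound that does not involve z.\<close>

lemma smoothed_density_close:
  assumes eps: "\<epsilon> > 0" and eta: "\<eta> > 0"
  shows "\<forall>\<^sub>F n in sequentially. \<forall>z.
    \<bar>An n * (LINT s|S n. fejer ((z - s) / \<epsilon>) / \<epsilon>) - dens (position_param k n) ((z - Cn n) / An n)\<bar> \<le> \<eta>"
proof -
  have "\<forall>\<^sub>F n in sequentially. (LBINT w. norm (normalized_char n w * of_real (tent (\<epsilon> * (w / An n))) - psi (position_param k n) w)) < \<eta>"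
    using smoothed_char_L1[OF eps] eta by (rule order_tendstoD)
  then show ?thesis using eventually_ge_at_top[of "1::nat"]
  proof (eventually_elim, intro allI)
    fix n z assume close: "(LBINT w. norm (normalized_char n w * of_real (tent (\<epsilon> * (w / An n))) - psi (position_param k n) w)) < \<eta>"
      and n: "1 \<le> n"
    interpret S: real_distribution "S n" by (rule S_distribution)
    define u where "u = position_param k n"
    have u: "u > 0" unfolding u_def by (rule R.position_param_pos[OF n])
    note facts = normalized_law_distribution psi_limit[OF u] psi_integrable[OF u] psi_continuous[OF u]
    have [measurable]: "psi u \<in> borel_measurable borel" by (rule psi_measurable[OF u])
    have [measurable]: "normalized_char n \<in> borel_measurable borel" unfolding normalized_char_def[abs_def] by measurable
    have Ap: "An n > 0" by (rule An_pos[OF n])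
    define y where "y = (z - Cn n) / An n"
    let ?F = "\<lambda>t. iexp (- (t * z)) * char (S n) t * of_real (tent (\<epsilon> * t))"
    let ?G = "\<lambda>w. iexp (- (w * y)) * (normalized_char n w * of_real (tent (\<epsilon> * (w / An n))))"
    \<comment> \<open>After the substitution t = w / A n the shift by the centering is absorbed into
      the phase of the normalized characteristic function.\<close>
    have FG: "?F (0 + 1 / An n * w) = ?G w" for w
    proof -
      have "iexp (- (w / An n * z)) = iexp (- (w * y)) * iexp (- (w * (Cn n / An n)))"
        using Ap by (simp add: exp_add[symmetric] y_def field_simps)
      then show ?thesis by (simp add: normalized_char_def char_S mult_ac)
    qed
    have iG: "integrable lborel ?G"
    proof (rule Bochner_Integration.integrable_bound)
      show "integrable lborel (\<lambda>w. tent (\<epsilon> / An n * w))" using eps Ap by (intro tent_scaled_integrable) simp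
      show "AE w in lborel. norm (?G w) \<le> norm (tent (\<epsilon> / An n * w))"
        using cmod_char_le_1 tent_bounds(1)
        by (intro AE_I2) (simp add: norm_mult normalized_char_norm mult_left_le_one_le power_le_one)
    qed measurable
    have iP: "integrable lborel (\<lambda>w. iexp (- (w * y)) * psi u w)" by (rule iexp_limit_integrable[OF facts])
    have "complex_of_real (LINT s|S n. fejer ((z - s) / \<epsilon>) / \<epsilon>) = (CLBINT t. ?F t) / of_real (2 * pi)"
      by (rule S.fejer_smoothing[OF eps])
    also have "(CLBINT t. ?F t) = \<bar>1 / An n\<bar> *\<^sub>R (CLBINT w. ?F (0 + 1 / An n * w))"
      by (rule lborel_integral_real_affine) (use Ap in auto)
    also have "\<dots> = (CLBINT w. ?G w) / of_real (An n)"
      unfolding FG using Ap by (simp add: scaleR_conv_of_real)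
    finally have 1: "complex_of_real (An n * (LINT s|S n. fejer ((z - s) / \<epsilon>) / \<epsilon>)) = (CLBINT w. ?G w) / of_real (2 * pi)"
      using Ap by (simp add: field_simps)
    have 2: "complex_of_real (dens u y) = (CLBINT w. iexp (- (w * y)) * psi u w) / of_real (2 * pi)"
      by (rule of_real_inverse_fourier[OF facts])
    have "complex_of_real (An n * (LINT s|S n. fejer ((z - s) / \<epsilon>) / \<epsilon>) - dens u y) =
        (CLBINT w. ?G w - iexp (- (w * y)) * psi u w) / of_real (2 * pi)" (is "complex_of_real ?a = ?Z / _")
      unfolding Bochner_Integration.integral_diff[OF iG iP] of_real_diff 1 2 by (simp add: diff_divide_distrib)
    then have "norm (complex_of_real ?a) = norm (?Z / of_real (2 * pi))" by (simp only:)
    then have "\<bar>?a\<bar> = norm ?Z / (2 * pi)" unfolding norm_of_real norm_divide by simp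
    also have "\<dots> \<le> (LBINT w. norm (?G w - iexp (- (w * y)) * psi u w)) / (2 * pi)"
      by (intro divide_right_mono integral_norm_bound) simp
    also have "(LBINT w. norm (?G w - iexp (- (w * y)) * psi u w)) =
        (LBINT w. norm (normalized_char n w * of_real (tent (\<epsilon> * (w / An n))) - psi u w))"
      by (intro Bochner_Integration.integral_cong refl) (simp only: right_diff_distrib[symmetric] norm_mult norm_exp_i_times mult_1)
    also have "\<dots> / (2 * pi) \<le> \<dots> / 1"
      using pi_gt3 by (intro divide_left_mono) (auto intro!: integral_nonneg_AE)
    finally show "\<bar>An n * (LINT s|S n. fejer ((z - s) / \<epsilon>) / \<epsilon>) - dens (position_param k n) ((z - Cn n) / An n)\<bar> \<le> \<eta>"
      using close by (simp add: u_def y_def)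
  qed
qed

lemma local_limit:
  assumes h: "h > 0" and eta: "\<eta> > 0"
  shows "\<forall>\<^sub>F n in sequentially. \<forall>x. \<bar>An n / (2 * h) * measure (S n) {x - h<..x + h}
     - semistable_density \<alpha> M\<^sub>R M\<^sub>L (position_param k n) ((x - Cn n) / An n)\<bar> \<le> \<eta>"
proof -
  obtain B L where BL: "\<And>u x. u > 0 \<Longrightarrow> 0 \<le> dens u x \<and> dens u x \<le> B"
    "\<And>u x y. u > 0 \<Longrightarrow> \<bar>dens u x - dens u y\<bar> \<le> L * \<bar>x - y\<bar>"
    using dens_properties by blast
  have n1: "\<forall>\<^sub>F n in sequentially. n \<ge> (1::nat)" by (rule eventually_ge_at_top)
  have "\<forall>\<^sub>F n in sequentially. \<forall>x. \<bar>An n / (2 * h) * measure (S n) {x - h<..x + h}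
     - dens (position_param k n) ((x - Cn n) / An n)\<bar> \<le> \<eta>"
  proof (rule local_limit_from_smoothed_densities[OF S_distribution An_at_top smoothed_density_close _ _ h eta])
    show "\<forall>\<^sub>F n in sequentially. \<forall>x. 0 \<le> dens (position_param k n) x \<and> dens (position_param k n) x \<le> B"
      using n1 by eventually_elim (use BL(1) R.position_param_pos in blast)
    show "\<forall>\<^sub>F n in sequentially. \<forall>x y. \<bar>dens (position_param k n) x - dens (position_param k n) y\<bar> \<le> L * \<bar>x - y\<bar>"
      using n1 by eventually_elim (use BL(2) R.position_param_pos in blast)
  qed
  then show ?thesis using n1
    by eventually_elim (simp add: semistable_density_eq[OF R.position_param_pos])
qed

end

section \<open>From the hypotheses of the theorem to the locales\<close>

lemma admissible_profile_facts:
  assumes "admissible_profile \<alpha> c M" and c: "c > 0"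
  obtains b where "b > 0" "\<And>x. x > 0 \<Longrightarrow> M x \<ge> 0" "\<And>x. x > 0 \<Longrightarrow> M x \<le> b"
    "\<And>x. x > 0 \<Longrightarrow> M (c powr (1 / \<alpha>) * x) = M x" "antimono_on {0<..} (\<lambda>x. M x * x powr (- \<alpha>))"
    "(\<forall>x>0. M x = 0) \<or> (\<exists>a>0. \<forall>x>0. a \<le> M x)"
proof (cases "\<forall>x>0. M x = 0")
  case True
  show ?thesis
  \<comment> \<open>Any positive bound serves the vanishing profile.\<close>
  proof (rule that[of 1])
    fix x :: real assume x: "x > 0"
    show "M (c powr (1 / \<alpha>) * x) = M x"
      using True x c by simp
  qed (use True assms in \<open>auto simp: admissible_profile_def\<close>)
next
  case False
  then obtain a b where ab: "0 < a" "\<And>x. x > 0 \<Longrightarrow> a \<le> M x \<and> M x \<le> b"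
    and per: "\<And>x. x > 0 \<Longrightarrow> M (c powr (1 / \<alpha>) * x) = M x"
    and am: "antimono_on {0<..} (\<lambda>x. M x * x powr (- \<alpha>))"
    using assms unfolding admissible_profile_def by blast
  show ?thesis
  proof (rule that[of b])
    show "b > 0" using ab(1) ab(2)[of 1] by simp
    show "0 \<le> M x" if "x > 0" for x using ab(1) ab(2)[OF that] by simp
    show "M x \<le> b" if "x > 0" for x using ab(2)[OF that] by simp
    show "(\<forall>x>0. M x = 0) \<or> (\<exists>a>0. \<forall>x>0. a \<le> M x)" using ab by blast
  qed (use per am in auto)
qed

lemma (in real_distribution) tail_measure_tendsto_0:
  shows "((\<lambda>x. measure M {x<..}) \<longlongrightarrow> 0) at_top" "((\<lambda>x. measure M {..< - x}) \<longlongrightarrow> 0) at_top"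
proof -
  have "measure M {x<..} = 1 - cdf M x" for x
  proof -
    have "{x<..} = UNIV - {..x}" by auto
    then show ?thesis using prob_compl[of "{..x}"] by (simp add: cdf_def)
  qed
  moreover have "((\<lambda>x. 1 - cdf M x) \<longlongrightarrow> 1 - 1) at_top"
    by (intro tendsto_intros cdf_lim_at_top_prob)
  ultimately show "((\<lambda>x. measure M {x<..}) \<longlongrightarrow> 0) at_top" by simp
  have "((\<lambda>x. cdf M (- x)) \<longlongrightarrow> 0) at_top"
    using filterlim_compose[OF cdf_lim_at_bot filterlim_uminus_at_bot_at_top] .
  then show "((\<lambda>x. measure M {..< - x}) \<longlongrightarrow> 0) at_top"
  proof (rule Lim_null_comparison[rotated])
    have "measure M {..< - x} \<le> cdf M (- x)" for x
      unfolding cdf_def by (intro finite_measure_mono) auto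
    then show "\<forall>\<^sub>F x in at_top. norm (measure M {..< - x}) \<le> cdf M (- x)"
      by (intro always_eventually allI) simp
  qed
qed

text \<open>In \<open>ereal\<close> the supremum exists without a boundedness argument, so a uniform
  bound valid eventually is enough.\<close>

lemma ereal_SUP_tendsto_0:
  fixes f :: "nat \<Rightarrow> real \<Rightarrow> real"
  assumes "\<And>\<eta>. \<eta> > 0 \<Longrightarrow> \<forall>\<^sub>F n in sequentially. \<forall>x. \<bar>f n x\<bar> \<le> \<eta>"
  shows "(\<lambda>n. SUP x. ereal \<bar>f n x\<bar>) \<longlonglongrightarrow> 0"
proof (rule order_tendstoI)
  fix y :: ereal assume "y < 0"
  have "0 \<le> (SUP x. ereal \<bar>f n x\<bar>)" for n by (rule SUP_upper2[of 0]) auto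
  then show "\<forall>\<^sub>F n in sequentially. y < (SUP x. ereal \<bar>f n x\<bar>)"
    using \<open>y < 0\<close> by (intro always_eventually allI) (rule less_le_trans)
next
  fix y :: ereal assume "0 < y"
  then obtain \<eta> where eta: "0 < ereal \<eta>" "ereal \<eta> < y" using ereal_dense2 by blast
  then have "\<forall>\<^sub>F n in sequentially. \<forall>x. \<bar>f n x\<bar> \<le> \<eta>" by (intro assms) simp
  then show "\<forall>\<^sub>F n in sequentially. (SUP x. ereal \<bar>f n x\<bar>) < y"
  proof eventually_elim
    case (elim n)
    then have "(SUP x. ereal \<bar>f n x\<bar>) \<le> ereal \<eta>" by (intro SUP_least) auto
    then show ?case using eta(2) by (rule le_less_trans)
  qed
qed

theorem theorem3:
  fixes P :: "'a measure" and X :: "nat \<Rightarrow> 'a \<Rightarrow> real"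
    and \<alpha> c :: real and k :: "nat \<Rightarrow> nat" and l1 :: "real \<Rightarrow> real"
    and M\<^sub>R M\<^sub>L h\<^sub>R h\<^sub>L :: "real \<Rightarrow> real"
  assumes alpha: "0 < \<alpha>" "\<alpha> < 2"
    and P: "prob_space P"
    and indep: "prob_space.indep_vars P (\<lambda>_. borel) X UNIV"
    and ident: "\<And>i. distr P borel (X i) = distr P borel (X 0)"
    and nonlattice: "\<not> lattice_rv P (X 0)"
    and c: "c > 1"
    and k: "k 0 = 0" "strict_mono k" "(\<lambda>n. real (k (n + 1)) / real (k n)) \<longlonglongrightarrow> c"
    and l1: "slowly_varying l1"
    and M_R: "admissible_profile \<alpha> c M\<^sub>R"
    and M_L: "admissible_profile \<alpha> c M\<^sub>L"
    and not_both_zero: "\<not> ((\<forall>x>0. M\<^sub>R x = 0) \<and> (\<forall>x>0. M\<^sub>L x = 0))"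
    and not_both_const: "\<not> (M\<^sub>R constant_on {0<..} \<and> M\<^sub>L constant_on {0<..})"
    and right_tail: "\<forall>\<^sub>F x in at_top.
        \<P>(\<omega> in P. X 0 \<omega> > x) =
          tail_sv \<alpha> l1 x / x powr \<alpha> * (M\<^sub>R (rel_position (norming \<alpha> l1) k x) + h\<^sub>R x)"
    and left_tail: "\<forall>\<^sub>F x in at_top.
        \<P>(\<omega> in P. X 0 \<omega> < - x) =
          tail_sv \<alpha> l1 x / x powr \<alpha> * (M\<^sub>L (rel_position (norming \<alpha> l1) k x) + h\<^sub>L x)"
    and hR_rcont: "\<And>x. x > 0 \<Longrightarrow> continuous (at_right x) h\<^sub>R"
    and hL_rcont: "\<And>x. x > 0 \<Longrightarrow> continuous (at_right x) h\<^sub>L"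
    and hR_lim: "\<And>x. x > 0 \<Longrightarrow> isCont M\<^sub>R x \<Longrightarrow>
        (\<lambda>n. h\<^sub>R (norming \<alpha> l1 (real (k n)) * x)) \<longlonglongrightarrow> 0"
    and hL_lim: "\<And>x. x > 0 \<Longrightarrow> isCont M\<^sub>L x \<Longrightarrow>
        (\<lambda>n. h\<^sub>L (norming \<alpha> l1 (real (k n)) * x)) \<longlonglongrightarrow> 0"
  shows "\<forall>h>0. (\<lambda>n. SUP x::real. ereal
      \<bar>norming \<alpha> l1 (real n) / (2 * h)
          * \<P>(\<omega> in P. (\<Sum>i=1..n. X i \<omega>) \<in> {x - h<..x + h})
        - semistable_density \<alpha> M\<^sub>R M\<^sub>L (position_param k n)
            ((x - centering (cdf (distr P borel (X 0))) n) / norming \<alpha> l1 (real n))\<bar>)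
      \<longlonglongrightarrow> 0"
proof -
  interpret prob_space P by (rule P)
  have meas [measurable]: "X i \<in> borel_measurable P" for i
    using indep by (simp add: indep_vars_def)
  define \<mu> where "\<mu> = distr P borel (X 0)"
  have mu: "real_distribution \<mu>" unfolding \<mu>_def by (rule real_distribution_distr) simp
  interpret \<mu>: cdf_distribution \<mu> unfolding cdf_distribution_def by (rule mu)
  interpret N: geometric_norming \<alpha> l1 c k
    by standard (use alpha l1 c k in auto)
  obtain bR where R: "bR > 0" "\<And>x. x > 0 \<Longrightarrow> M\<^sub>R x \<ge> 0" "\<And>x. x > 0 \<Longrightarrow> M\<^sub>R x \<le> bR"
    "\<And>x. x > 0 \<Longrightarrow> M\<^sub>R (c powr (1 / \<alpha>) * x) = M\<^sub>R x" "antimono_on {0<..} (\<lambda>x. M\<^sub>R x * x powr (- \<alpha>))"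
    "(\<forall>x>0. M\<^sub>R x = 0) \<or> (\<exists>a>0. \<forall>x>0. a \<le> M\<^sub>R x)"
    using admissible_profile_facts[OF M_R] c by auto
  obtain bL where L: "bL > 0" "\<And>x. x > 0 \<Longrightarrow> M\<^sub>L x \<ge> 0" "\<And>x. x > 0 \<Longrightarrow> M\<^sub>L x \<le> bL"
    "\<And>x. x > 0 \<Longrightarrow> M\<^sub>L (c powr (1 / \<alpha>) * x) = M\<^sub>L x" "antimono_on {0<..} (\<lambda>x. M\<^sub>L x * x powr (- \<alpha>))"
    "(\<forall>x>0. M\<^sub>L x = 0) \<or> (\<exists>a>0. \<forall>x>0. a \<le> M\<^sub>L x)"
    using admissible_profile_facts[OF M_L] c by auto
  have right_eq: "\<forall>\<^sub>F x in at_top. measure \<mu> {x<..} =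
      tail_sup \<alpha> l1 x * (M\<^sub>R (rel_position (norming \<alpha> l1) k x) + h\<^sub>R x)"
    using right_tail eventually_gt_at_top[of 0]
  proof eventually_elim
    case (elim x)
    have "measure \<mu> {x<..} = \<P>(\<omega> in P. X 0 \<omega> > x)"
      unfolding \<mu>_def by (subst measure_distr) (auto intro!: arg_cong[where f="measure P"])
    then show ?case using elim tail_sv_eq_tail_sup[of x \<alpha> l1] by simp
  qed
  have left_eq: "\<forall>\<^sub>F x in at_top. measure \<mu> {..< - x} =
      tail_sup \<alpha> l1 x * (M\<^sub>L (rel_position (norming \<alpha> l1) k x) + h\<^sub>L x)"
    using left_tail eventually_gt_at_top[of 0]
  proof eventually_elim
    case (elim x)
    have "measure \<mu> {..< - x} = \<P>(\<omega> in P. X 0 \<omega> < - x)"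
      unfolding \<mu>_def by (subst measure_distr) (auto intro!: arg_cong[where f="measure P"])
    then show ?case using elim tail_sv_eq_tail_sup[of x \<alpha> l1] by simp
  qed
  have nontrivial: "(\<exists>a>0. \<forall>x>0. a \<le> M\<^sub>R x) \<or> (\<exists>a>0. \<forall>x>0. a \<le> M\<^sub>L x)"
    using R(6) L(6) not_both_zero by blast
  \<comment> \<open>A side with a positive profile forces \<open>tail_sup\<close> to vanish at
    infinity. The function is shared by both tails, so the other side profits even if its profile is
    zero.\<close>
  have T0: "(tail_sup \<alpha> l1 \<longlongrightarrow> 0) at_top"
    using nontrivial
  proof
    assume "\<exists>a>0. \<forall>x>0. a \<le> M\<^sub>R x"
    then have pos: "\<And>x. x > 0 \<Longrightarrow> M\<^sub>R x > 0" by (meson less_le_trans)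
    show ?thesis
    proof (rule N.tail_sup_tendsto_0[OF \<mu>.tail_measure_tendsto_0(1)])
      show "\<forall>\<^sub>F x in at_top. measure \<mu> {x<..} =
          tail_sup \<alpha> l1 x * (M\<^sub>R (rel_position (norming \<alpha> l1) k x) + h\<^sub>R x)" by (rule right_eq)
    qed (use pos R(4,5) hR_lim in auto)
  next
    assume "\<exists>a>0. \<forall>x>0. a \<le> M\<^sub>L x"
    then have pos: "\<And>x. x > 0 \<Longrightarrow> M\<^sub>L x > 0" by (meson less_le_trans)
    show ?thesis
    proof (rule N.tail_sup_tendsto_0[OF \<mu>.tail_measure_tendsto_0(2)])
      show "\<forall>\<^sub>F x in at_top. measure \<mu> {..< - x} =
          tail_sup \<alpha> l1 x * (M\<^sub>L (rel_position (norming \<alpha> l1) k x) + h\<^sub>L x)" by (rule left_eq)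
    qed (use pos L(4,5) hL_lim in auto)
  qed
  have anti: "antimono (\<lambda>x. measure \<mu> {x<..})" "antimono (\<lambda>x. measure \<mu> {..< - x})"
    by (auto intro!: antimonoI \<mu>.finite_measure_mono)
  interpret R: quantile_tail \<alpha> l1 c k M\<^sub>R h\<^sub>R "\<lambda>x. measure \<mu> {x<..}" bR "\<lambda>s. quantile (cdf \<mu>) (1 - s)"
  proof unfold_locales
    fix s x :: real assume s: "0 < s" "s < 1"
    show "measure \<mu> {x<..} < s \<Longrightarrow> quantile (cdf \<mu>) (1 - s) \<le> x"
      using \<mu>.right_quantile_le_iff[OF s, of x] by simp
    show "s < measure \<mu> {x<..} \<Longrightarrow> x \<le> quantile (cdf \<mu>) (1 - s)"
      using \<mu>.right_quantile_le_iff[OF s, of x] by simp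
  next
    fix s s' :: real assume "0 < s" "s \<le> s'" "s' < 1"
    then show "quantile (cdf \<mu>) (1 - s') \<le> quantile (cdf \<mu>) (1 - s)"
      by (intro \<mu>.quantile_mono) auto
  qed (use R T0 anti right_eq hR_lim c alpha in auto)
  interpret L: quantile_tail \<alpha> l1 c k M\<^sub>L h\<^sub>L "\<lambda>x. measure \<mu> {..< - x}" bL "\<lambda>s. - quantile (cdf \<mu>) s"
  proof unfold_locales
    fix s x :: real assume s: "0 < s" "s < 1"
    show "measure \<mu> {..< - x} < s \<Longrightarrow> - quantile (cdf \<mu>) s \<le> x"
      by (rule \<mu>.left_quantile_le[OF s])
    show "s < measure \<mu> {..< - x} \<Longrightarrow> x \<le> - quantile (cdf \<mu>) s"
      by (rule \<mu>.left_quantile_ge[OF s])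
  next
    fix s s' :: real assume "0 < s" "s \<le> s'" "s' < 1"
    then show "- quantile (cdf \<mu>) s' \<le> - quantile (cdf \<mu>) s"
      using \<mu>.quantile_mono[of s s'] by simp
  qed (use L T0 anti left_eq hL_lim c alpha in auto)
  have char_lt: "norm (char \<mu> v) < 1" if v: "v \<noteq> 0" for v
  proof (rule ccontr)
    assume "\<not> norm (char \<mu> v) < 1"
    then have "norm (char \<mu> v) = 1" using \<mu>.cmod_char_le_1[of v] by simp
    then obtain a h where "h > 0" "AE x in \<mu>. \<exists>j::int. x = a + h * real_of_int j"
      using \<mu>.lattice_if_norm_char_1[OF v] by blast
    then have "AE \<omega> in P. \<exists>j::int. X 0 \<omega> = a + h * real_of_int j"
      unfolding \<mu>_def by (intro AE_distrD[where M'=borel and f="X 0"]) auto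
    then show False using nonlattice \<open>h > 0\<close> by (auto simp: lattice_rv_def)
  qed
  define S where "S n = distr P borel (\<lambda>\<omega>. \<Sum>i=1..n. X i \<omega>)" for n
  have S_distribution: "real_distribution (S n)" for n
    unfolding S_def by (rule real_distribution_distr) simp
  have char_S: "char (S n) t = char \<mu> t ^ n" for n t
  proof -
    have "indep_vars (\<lambda>_. borel) X {1..n}" using indep by (rule indep_vars_subset) auto
    then have "char (S n) t = (\<Prod>i\<in>{1..n}. char (distr P borel (X i)) t)"
      unfolding S_def by (rule char_distr_sum)
    moreover have "char (distr P borel (X i)) t = char \<mu> t" for i
      unfolding \<mu>_def by (subst ident) (rule refl)
    ultimately show ?thesis by simp
  qed
  interpret A: nonlattice_attraction \<mu> \<alpha> l1 c k M\<^sub>R h\<^sub>R bR M\<^sub>L h\<^sub>L bL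
    by unfold_locales (use alpha nontrivial char_lt in auto)
  interpret A: sums_attraction \<mu> \<alpha> l1 c k M\<^sub>R h\<^sub>R bR M\<^sub>L h\<^sub>L bL S
    by (intro sums_attraction.intro A.nonlattice_attraction_axioms sums_attraction_axioms.intro
        S_distribution char_S)
  show ?thesis
  proof (intro allI impI)
    fix h :: real assume h: "h > 0"
    have "measure (S n) {x - h<..x + h} = \<P>(\<omega> in P. (\<Sum>i=1..n. X i \<omega>) \<in> {x - h<..x + h})" for n x
      unfolding S_def by (subst measure_distr) (auto intro!: arg_cong[where f="measure P"])
    then show "(\<lambda>n. SUP x::real. ereal
      \<bar>norming \<alpha> l1 (real n) / (2 * h)
          * \<P>(\<omega> in P. (\<Sum>i=1..n. X i \<omega>) \<in> {x - h<..x + h})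
        - semistable_density \<alpha> M\<^sub>R M\<^sub>L (position_param k n)
            ((x - centering (cdf (distr P borel (X 0))) n) / norming \<alpha> l1 (real n))\<bar>)
      \<longlonglongrightarrow> 0"
      using A.local_limit[OF h] unfolding \<mu>_def[symmetric] by (intro ereal_SUP_tendsto_0) simp
  qed
qed

end
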